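(* Let $d\ge1$, let $\eta$ be a random vector in $\mathbb{R}^d$ with $\mathbb{E}|\eta|^2<\infty$, and let $m:=\mathbb{E}\,\eta$. Let $(\mathcal{T}_t)_{t\ge0}$ be the Yule tree, and let $\widetilde\mu_t$ be the empirical distribution of the branching random walk on $\mathcal{T}_t$ with offset $\eta$. Then, as $t\to\infty$, almost surely $$\Theta_{\sqrt{t},\,m t}(\widetilde\mu_t)\longrightarrow N\bigl(0,\mathbb{E}[\eta\eta^{\mathsf t}]\bigr)$$ in $\mathcal{P}(\mathbb{R}^d)$ with the usual weak topology. More generally, the same result holds for the weighted Yule tree with an arbitrary weight $\rho>0$.
   Context: Vectors are column vectors, and ${}^{\mathsf t}$ denotes transpose. $\mathcal{P}(\mathbb{R}^d)$ is the space of Borel probability measures on $\mathbb{R}^d$, $\delta_x$ is the point mass at $x$, and $N(0,\Sigma)$ is the (possibly degenerate) normal distribution with mean $0$ and covariance matrix $\Sigma$. For $a>0$ and $b\in\mathbb{R}^d$, the map $\Theta_{a,b}:\mathcal{P}(\mathbb{R}^d)\to\mathcal{P}(\mathbb{R}^d)$ is defined by: if $X\sim\mu$, then $(X-b)/a\sim\Theta_{a,b}(\mu)$. Weighted Yule tree with weight $\rho>0$: a growing family of random rooted trees $(\mathcal{T}_t)_{t\ge0}$, the family tree of a continuous-time Markov branching process that starts with a single node (the root $o$) at time $0$. The root has weight $\omega_o=\rho$ and every other node $v$ has weight $\omega_v=1$. Every node lives for ever and, independently of the others, gets children according to a Poisson process with intensity equal to its weight (starting at its birth). The Yule tree is the case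 $\rho=1$. $|\mathcal{T}_t|$ denotes the total weight of the nodes of $\mathcal{T}_t$ (the number of nodes when $\rho=1$). Let $T_\infty:=\bigcup_t \mathcal{T}_t$. Branching random walk: let $(\eta_v)_{v\in T_\infty}$ be i.i.d. copies of $\eta$, independent of the tree process $(\mathcal{T}_t)_t$. Set $X_o:=0$, and $X_w:=X_v+\eta_w$ if $w$ is a child of $v$. The empirical distribution is the random probability measure $$\widetilde\mu_t:=\frac1{|\mathcal{T}_t|}\sum_{v\in\mathcal{T}_t}\omega_v\,\delta_{X_v}.$$ *)

theory Defs
  imports "HOL-Probability.Probability"
begin

section \<open>Weak convergence, normalization and normal laws\<close>

text \<open>Convergence along a filter in the space of Borel probability measures with the weak
  topology. The library notion \<open>weak_conv_m\<close> is restricted to sequences of measures on the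
  real line.\<close>

definition weakly_converges ::
  "('i \<Rightarrow> 'b::topological_space measure) \<Rightarrow> 'b measure \<Rightarrow> 'i filter \<Rightarrow> bool" where
  "weakly_converges \<mu> \<nu> F \<longleftrightarrow>
     (\<forall>\<^sub>F i in F. \<mu> i \<in> space (prob_algebra borel)) \<and>
     \<nu> \<in> space (prob_algebra borel) \<and>
     (\<forall>f :: 'b \<Rightarrow> real. continuous_on UNIV f \<and> bounded (range f) \<longrightarrow>
        ((\<lambda>i. \<integral>x. f x \<partial>\<mu> i) \<longlongrightarrow> (\<integral>x. f x \<partial>\<nu>)) F)"

definition Theta :: "real \<Rightarrow> 'b::euclidean_space \<Rightarrow> 'b measure \<Rightarrow> 'b measure" where
  "Theta a b \<mu> = distr \<mu> borel (\<lambda>x. (x - b) /\<^sub>R a)"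

definition std_normal_vector :: "(real ^ 'd) measure" where
  "std_normal_vector = density lborel (\<lambda>z. ennreal (\<Prod>i\<in>UNIV. std_normal_density (z $ i)))"

text \<open>\<open>centered_normal \<Sigma>\<close> is the law of \<open>A Z\<close> with \<open>Z\<close> standard normal
  and \<open>A A\<^sup>t = \<Sigma>\<close>. A square factor \<open>A\<close> exists precisely for symmetric positive semidefinite
  \<open>\<Sigma>\<close>, which may be singular, and the law does not depend on the factor chosen.\<close>

definition centered_normal :: "real ^ 'd ^ 'd \<Rightarrow> (real ^ 'd) measure" where
  "centered_normal \<Sigma> =
     (let A = (SOME A :: real ^ 'd ^ 'd. A ** transpose A = \<Sigma>)
      in distr std_normal_vector borel (\<lambda>z. A *v z))"


section \<open>The weighted Yule tree\<close>

text \<open>\<open>\<tau> k\<close> is the time of the \<open>k\<close>-th arrival (counted from 0): a Poisson process is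
  described by independent exponentially distributed waiting times.\<close>

definition waiting_time :: "(nat \<Rightarrow> 'a \<Rightarrow> real) \<Rightarrow> nat \<Rightarrow> 'a \<Rightarrow> real" where
  "waiting_time \<tau> k \<omega> = (case k of 0 \<Rightarrow> \<tau> 0 \<omega> | Suc j \<Rightarrow> \<tau> (Suc j) \<omega> - \<tau> j \<omega>)"

definition (in prob_space) poisson_arrivals :: "real \<Rightarrow> (nat \<Rightarrow> 'a \<Rightarrow> real) \<Rightarrow> bool" where
  "poisson_arrivals r \<tau> \<longleftrightarrow>
     indep_vars (\<lambda>_. borel) (waiting_time \<tau>) UNIV \<and>
     (\<forall>k. distributed M lborel (waiting_time \<tau> k) (\<lambda>s. ennreal (exponential_density r s)))"

text \<open>Every node almost surely gets infinitely many children, so the nodes of the final tree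
  are indexed by all finite sequences of natural numbers: \<open>[]\<close> is the root, and \<open>k # v\<close> is the
  child number \<open>k\<close> of \<open>v\<close> (a node is thus its path to the root, read upwards).
  In the following functions \<open>a v k\<close> is the age of \<open>v\<close> at the birth of \<open>k # v\<close>, and
  \<open>x w\<close> is the offset attached to node \<open>w\<close>.\<close>

type_synonym node = "nat list"

definition weight :: "real \<Rightarrow> node \<Rightarrow> real" where
  "weight \<rho> v = (if v = [] then \<rho> else 1)"

primrec birth_time :: "(node \<Rightarrow> nat \<Rightarrow> real) \<Rightarrow> node \<Rightarrow> real" where
  "birth_time a [] = 0"
| "birth_time a (k # v) = birth_time a v + a v k"

definition tree :: "(node \<Rightarrow> nat \<Rightarrow> real) \<Rightarrow> real \<Rightarrow> node set" where
  "tree a t = {v. birth_time a v \<le> t}"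

definition total_weight :: "real \<Rightarrow> node set \<Rightarrow> real" where
  "total_weight \<rho> T = (\<Sum>v\<in>T. weight \<rho> v)"

primrec position :: "(node \<Rightarrow> 'b::comm_monoid_add) \<Rightarrow> node \<Rightarrow> 'b" where
  "position x [] = 0"
| "position x (k # v) = position x v + x (k # v)"

text \<open>A point mass of size \<open>weight \<rho> v / total_weight \<rho> T\<close> at \<open>position x v\<close> for each
  node \<open>v\<close> of \<open>T\<close>, that is, the weighted sum of Dirac measures. Only finite \<open>T\<close> are relevant,
  since the trees are almost surely finite at all times.\<close>

definition empirical_distribution ::
  "real \<Rightarrow> (node \<Rightarrow> 'b::euclidean_space) \<Rightarrow> node set \<Rightarrow> 'b measure" where
  "empirical_distribution \<rho> x T =
     distr (point_measure T (\<lambda>v. ennreal (weight \<rho> v / total_weight \<rho> T))) borel (position x)"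

locale weighted_yule_tree = prob_space M
  for M :: "'a measure" and \<rho> :: real and age :: "node \<Rightarrow> nat \<Rightarrow> 'a \<Rightarrow> real" +
  assumes weight_pos: "0 < \<rho>"
    and children: "\<And>v. poisson_arrivals (weight \<rho> v) (age v)"
    and nodes_indep: "indep_vars (\<lambda>_. \<Pi>\<^sub>M k\<in>UNIV. borel) (\<lambda>v \<omega> k. age v k \<omega>) UNIV"

definition random_tree :: "(node \<Rightarrow> nat \<Rightarrow> 'a \<Rightarrow> real) \<Rightarrow> 'a \<Rightarrow> real \<Rightarrow> node set" where
  "random_tree age \<omega> t = tree (\<lambda>v k. age v k \<omega>) t"


section \<open>The branching random walk\<close>

text \<open>The offsets \<open>X v\<close> are i.i.d. with law \<open>D\<close> and independent of the \<open>\<sigma>\<close>-algebra generated by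
  the tree process. The offset of the root is never used.\<close>

locale yule_branching_random_walk = weighted_yule_tree M \<rho> age
  for M :: "'a measure" and \<rho> :: real and age :: "node \<Rightarrow> nat \<Rightarrow> 'a \<Rightarrow> real" +
  fixes X :: "node \<Rightarrow> 'a \<Rightarrow> 'b::euclidean_space" and D :: "'b measure"
  assumes offsets_indep: "indep_vars (\<lambda>_. borel) X UNIV"
    and offsets_law: "\<And>v. distr M borel (X v) = D"
    and offsets_indep_tree:
      "indep_set
         (sigma_sets (space M) {{\<omega> \<in> space M. v \<in> random_tree age \<omega> t} | v t. 0 \<le> t})
         (sigma_sets (space M) {X v -` B \<inter> space M | v B. B \<in> sets borel})"

end

theory Submission
  imports Defs "HOL-Library.Sublist" "HOL-Real_Asymp.Real_Asymp"
begin

text \<open>For a frequency \<open>s\<close> let \<open>F\<^sub>t(s)\<close> be the weighted sum of \<open>exp(i s\<cdot>X\<^sub>v)\<close> over the nodes \<open>v\<close> born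
  before \<open>t\<close>, and let \<open>\<phi>\<close> be the characteristic function of the offset. Then \<open>exp(-\<phi>(s) t) F\<^sub>t(s)\<close> is a
  martingale. Its second moments are sums over pairs of nodes; splitting these at the most recent
  common ancestor shows that, for \<open>\<phi>(s)\<close> close to 1, the increment between times \<open>r\<close> and \<open>t\<close> is
  exponentially small in \<open>r\<close> in mean square, uniformly in \<open>s\<close>. So the martingale at time \<open>t\<close> and
  frequency \<open>s/\<surd>t\<close> is close to its value at a much earlier time \<open>r\<close>, where the positions are on average
  \<open>o(\<surd>t)\<close> and the value is essentially \<open>exp(-r)\<close> times the total weight. As \<open>exp(-t)\<close> times the total
  weight has a positive limit, \<open>F\<^sub>t(s/\<surd>t)\<close> divided by the total weight is asymptotic to
  \<open>exp((\<phi>(s/\<surd>t) - 1) t)\<close>, which is the characteristic function of a compound Poisson law and, after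
  centring, converges to the Gaussian limit. Almost sure convergence holds along the grid
  \<open>t\<^sub>n = n\<^bsup>1/4\<^esup>\<close> by Borel--Cantelli, and the grid is fine enough to interpolate. By Fubini the
  convergence holds almost surely for almost every frequency, which suffices after smoothing
  with a small Gaussian.\<close>

section \<open>Factorization of positive semidefinite matrices\<close>

text \<open>The frequency \<open>s / sqrt t\<close> moves with \<open>t\<close>, so martingale
  convergence at a fixed frequency is of no use. What replaces it is a mean square bound with one
  constant for all frequencies at which the characteristic function \<phi> of the offset has real
  part at least 3/4. The births grow like \<open>exp t\<close>, so a discount of rate 5/4 > 1 makes
  their intensity finite; a common ancestor born at \<open>x\<close> contributes
  \<open>exp (- 2 * Re \<phi> * x)\<close> to the second moment, and 5/4 - 2 * 3/4 = -1/4 is the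
  decay that remains. Pairs of nodes are tractable because the second factorial moment of a Poisson
  process is a product: below their common ancestor two lines of descent count as if independent,
  and the sum over both generation gaps is a product of two exponential series. Second moments alone
  show only that the limiting weight is nonzero with probability at least 1/2; the infinitely many
  independent subtrees at the root raise this to 1. The exceptional null set depends on the
  frequency. Hence the criterion for weak convergence must work with almost every frequency, and
  mass must be kept from escaping by means of the limit law alone.\<close>

lemma psd_eliminate_column:
  fixes S :: "real ^ 'd ^ 'd"
  assumes sym: "\<And>i j. S $ i $ j = S $ j $ i"
    and psd: "\<And>v. 0 \<le> v \<bullet> (S *v v)"
  obtains x where "\<And>v. (x \<bullet> v)\<^sup>2 \<le> v \<bullet> (S *v v)"
    and "\<And>i. S $ i $ k = x $ i * x $ k"
    and "\<And>j. (\<And>i. S $ i $ j = 0) \<Longrightarrow> x $ j = 0"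
proof -
  let ?e = "\<lambda>i. axis i 1 :: real ^ 'd"
  define B where "B u v = u \<bullet> (S *v v)" for u v
  have Bsum: "B u v = (\<Sum>i\<in>UNIV. \<Sum>j\<in>UNIV. u $ i * S $ i $ j * v $ j)" for u v
    by (simp add: B_def inner_vec_def matrix_vector_mult_def sum_distrib_left mult.assoc)
  have Bsym: "B u v = B v u" for u v
    unfolding Bsum by (subst sum.swap) (simp add: sym mult_ac)
  have Be: "B (?e i) v = (S *v v) $ i" for i v
    by (simp add: B_def inner_axis')
  have Bee: "B (?e i) (?e j) = S $ i $ j" for i j
    by (simp add: Be matrix_vector_mult_basis column_def)
  have Bexp: "B (u + c *\<^sub>R v) (u + c *\<^sub>R v) = B u u + 2 * c * B u v + c\<^sup>2 * B v v" for u v c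
  proof -
    have "B (u + c *\<^sub>R v) (u + c *\<^sub>R v) = B u u + c * B u v + c * B v u + c\<^sup>2 * B v v"
      unfolding Bsum
      by (simp add: sum.distrib[symmetric] sum_distrib_left algebra_simps power2_eq_square)
    then show ?thesis using Bsym[of u v] by simp
  qed
  have B0: "0 \<le> B v v" for v using psd by (simp add: B_def)
  show ?thesis
  proof (cases "S $ k $ k = 0")
    case True
    have "S $ i $ k = 0" for i
    proof (rule ccontr)
      assume n: "S $ i $ k \<noteq> 0"
      \<comment> \<open>With a zero diagonal entry the form is affine in \<open>c\<close> along
        \<open>axis i 1 + c *\<^sub>R axis k 1\<close>; this value of \<open>c\<close> would make it
        equal to -1.\<close>
      let ?c = "- (S $ i $ i + 1) / (2 * S $ i $ k)"
      have "0 \<le> S $ i $ i + 2 * ?c * S $ i $ k"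
        using B0[of "?e i + ?c *\<^sub>R ?e k"] True unfolding Bexp Bee by simp
      then show False using n by (simp add: field_simps)
    qed
    then show ?thesis by (intro that[of 0]) (use psd in auto)
  next
    case False
    then have pos: "0 < S $ k $ k" using B0[of "?e k"] by (simp add: Bee)
    define x where "x = (1 / sqrt (S $ k $ k)) *\<^sub>R (S *v ?e k)"
    have xv: "x \<bullet> v = B v (?e k) / sqrt (S $ k $ k)" for v
      by (simp add: x_def B_def inner_commute)
    have xi: "x $ i = S $ i $ k / sqrt (S $ k $ k)" for i
      by (simp add: x_def matrix_vector_mult_basis column_def)
    show ?thesis
    proof (rule that[of x])
      fix v
      \<comment> \<open>The minimiser of the form on the line through \<open>v\<close> in direction
        \<open>axis k 1\<close>; nonnegativity there is the Cauchy-Schwarz inequality for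
        \<open>B\<close>.\<close>
      let ?c = "- B v (?e k) / S $ k $ k"
      have "0 \<le> B v v + 2 * ?c * B v (?e k) + ?c\<^sup>2 * S $ k $ k"
        using B0[of "v + ?c *\<^sub>R ?e k"] unfolding Bexp Bee by simp
      also have "\<dots> = B v v - (B v (?e k))\<^sup>2 / S $ k $ k"
        using pos by (simp add: field_simps power2_eq_square)
      finally show "(x \<bullet> v)\<^sup>2 \<le> v \<bullet> (S *v v)"
        using pos by (simp add: xv power_divide B_def)
    next
      fix i show "S $ i $ k = x $ i * x $ k"
        using pos by (simp add: xi)
    next
      fix j assume "\<And>i. S $ i $ j = 0"
      then show "x $ j = 0" using sym[of j k] by (simp add: xi)
    qed
  qed
qed

text \<open>Symmetric Gaussian elimination. Subtracting the rank one matrix of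
  \<open>x = S e_k / sqrt (S_kk)\<close> (or of \<open>x = 0\<close> if that entry vanishes) clears
  column \<open>k\<close>, keeps the remainder positive semidefinite and does not disturb columns
  cleared before. Each vector is indexed by the column that it clears, so together they form a
  square factor.\<close>

lemma psd_factorization:
  fixes R :: "real ^ 'd ^ 'd"
  assumes sym: "\<And>i j. R $ i $ j = R $ j $ i"
    and psd: "\<And>v. 0 \<le> v \<bullet> (R *v v)"
  shows "\<exists>A :: real ^ 'd ^ 'd. A ** transpose A = R"
proof -
  have "\<exists>x :: 'd \<Rightarrow> real ^ 'd.
      (\<forall>v. (\<Sum>i\<in>I. (x i \<bullet> v)\<^sup>2) \<le> v \<bullet> (R *v v)) \<and>
      (\<forall>j\<in>I. \<forall>a. R $ a $ j = (\<Sum>i\<in>I. x i $ a * x i $ j))" if "finite I" for I :: "'d set"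
    using that
  proof (induction I rule: finite_induct)
    case empty
    then show ?case using psd by auto
  next
    case (insert k I)
    then obtain x :: "'d \<Rightarrow> real ^ 'd" where
      x: "\<And>v. (\<Sum>i\<in>I. (x i \<bullet> v)\<^sup>2) \<le> v \<bullet> (R *v v)"
         "\<And>j a. j \<in> I \<Longrightarrow> R $ a $ j = (\<Sum>i\<in>I. x i $ a * x i $ j)" by blast
    \<comment> \<open>The remainder after the columns in \<open>I\<close>; the two invariants say
      that it is positive semidefinite and vanishes in these columns.\<close>
    define S where "S = (\<chi> a b. R $ a $ b - (\<Sum>i\<in>I. x i $ a * x i $ b))"
    have Sv: "v \<bullet> (S *v v) = v \<bullet> (R *v v) - (\<Sum>i\<in>I. (x i \<bullet> v)\<^sup>2)" for v
    proof -
      have "S *v v = R *v v - (\<Sum>i\<in>I. (x i \<bullet> v) *\<^sub>R x i)"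
        by (simp add: vec_eq_iff S_def matrix_vector_mult_def inner_vec_def left_diff_distrib
            sum_subtractf sum_distrib_right sum_distrib_left right_diff_distrib mult_ac)
          (intro allI sum.swap)
      then show ?thesis
        by (simp add: inner_diff_right inner_sum_right power2_eq_square inner_commute)
    qed
    have S: "\<And>i j. S $ i $ j = S $ j $ i" "\<And>v. 0 \<le> v \<bullet> (S *v v)"
      using x(1) sym by (auto simp: Sv) (simp add: S_def mult.commute)
    obtain y where y: "\<And>v. (y \<bullet> v)\<^sup>2 \<le> v \<bullet> (S *v v)"
        "\<And>i. S $ i $ k = y $ i * y $ k" "\<And>j. (\<And>i. S $ i $ j = 0) \<Longrightarrow> y $ j = 0"
      using psd_eliminate_column[OF S] by metis
    have *: "(\<Sum>i\<in>I. f (if i = k then y else x i)) = (\<Sum>i\<in>I. f (x i))" for f :: "real ^ 'd \<Rightarrow> real"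
      using insert by (intro sum.cong) auto
    show ?case
    proof (intro exI[of _ "\<lambda>i. if i = k then y else x i"] conjI allI ballI)
      fix v
      show "(\<Sum>i\<in>insert k I. ((if i = k then y else x i) \<bullet> v)\<^sup>2) \<le> v \<bullet> (R *v v)"
        using insert y(1)[of v] by (simp add: *[of "\<lambda>z. (z \<bullet> v)\<^sup>2"] Sv)
    next
      fix j a assume j: "j \<in> insert k I"
      have 1: "(\<Sum>i\<in>insert k I. (if i = k then y else x i) $ a * (if i = k then y else x i) $ j)
        = y $ a * y $ j + (\<Sum>i\<in>I. x i $ a * x i $ j)"
        using insert by (simp add: *[of "\<lambda>z. z $ a * z $ j"])
      show "R $ a $ j = (\<Sum>i\<in>insert k I. (if i = k then y else x i) $ a * (if i = k then y else x i) $ j)"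
      proof (cases "j = k")
        case True
        then show ?thesis using y(2)[of a] unfolding 1 by (simp add: S_def)
      next
        case False
        then have "j \<in> I" using j by simp
        then have "y $ j = 0" using x(2) by (intro y(3)) (simp add: S_def)
        then show ?thesis unfolding 1 using x(2)[OF \<open>j \<in> I\<close>] by simp
      qed
    qed
  qed
  from this[of UNIV] obtain x :: "'d \<Rightarrow> real ^ 'd" where
    "\<And>j a. R $ a $ j = (\<Sum>i\<in>UNIV. x i $ a * x i $ j)" by auto
  then show ?thesis
    by (intro exI[of _ "\<chi> a i. x i $ a"])
      (simp add: vec_eq_iff matrix_matrix_mult_def transpose_def)
qed

section \<open>The standard normal law on \<open>\<real>\<^sup>d\<close>\<close>

lemma prod_Basis_cart:
  "(\<Prod>b\<in>(Basis :: (real ^ 'd) set). f b) = (\<Prod>i\<in>UNIV. f (axis i 1))"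
proof -
  have B: "(Basis :: (real ^ 'd) set) = (\<lambda>i. axis i 1) ` UNIV"
    by (auto simp: Basis_vec_def)
  show ?thesis
    unfolding B by (subst prod.reindex) (auto simp: inj_on_def axis_eq_axis)
qed

lemma integral_lborel_prod_cart:
  fixes h :: "'d::finite \<Rightarrow> real \<Rightarrow> complex"
  assumes h: "\<And>i. integrable lborel (h i)"
  shows "(\<integral>z. (\<Prod>i\<in>UNIV. h i (z $ i)) \<partial>(lborel :: (real ^ 'd) measure)) =
    (\<Prod>i\<in>UNIV. \<integral>x. h i x \<partial>lborel)"
proof -
  interpret product_sigma_finite "\<lambda>_. lborel :: real measure" ..
  have [measurable]: "h i \<in> borel_measurable borel" for i
    using borel_measurable_integrable[OF h] by simp
  \<comment> \<open>\<open>lborel\<close> is a product over basis vectors, while the functions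
    \<open>h\<close> are indexed by coordinates; \<open>ix\<close> translates between the two index
    sets.\<close>
  define ix where "ix = inv (\<lambda>i. axis i 1 :: real ^ 'd)"
  have ix: "ix (axis i 1) = i" for i
    unfolding ix_def by (intro inv_f_f) (auto simp: inj_on_def axis_eq_axis)
  have nth: "(\<Sum>b\<in>Basis. f b *\<^sub>R b) $ i = f (axis i 1)" for i and f :: "real ^ 'd \<Rightarrow> real"
  proof -
    have "(\<Sum>b\<in>Basis. f b *\<^sub>R b) $ i = (\<Sum>b\<in>Basis. f b *\<^sub>R b) \<bullet> axis i 1"
      by (simp add: inner_axis)
    also have "\<dots> = f (axis i 1)"
      by (subst inner_sum_left_Basis) (auto simp: Basis_vec_def)
    finally show ?thesis .
  qed
  have "(\<integral>z. (\<Prod>i\<in>UNIV. h i (z $ i)) \<partial>(lborel :: (real ^ 'd) measure)) =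
      (\<integral>f. (\<Prod>i\<in>UNIV. h i (f (axis i 1))) \<partial>(\<Pi>\<^sub>M b\<in>(Basis :: (real ^ 'd) set). lborel))"
    by (subst lborel_eq, subst integral_distr) (simp_all add: nth del: sum_component)
  also have "\<dots> = (\<integral>f. (\<Prod>b\<in>Basis. h (ix b) (f b)) \<partial>(\<Pi>\<^sub>M b\<in>(Basis :: (real ^ 'd) set). lborel))"
    by (simp add: prod_Basis_cart ix)
  also have "\<dots> = (\<Prod>b\<in>(Basis :: (real ^ 'd) set). \<integral>x. h (ix b) x \<partial>lborel)"
    by (rule product_integral_prod) (auto intro: h)
  also have "\<dots> = (\<Prod>i\<in>UNIV. \<integral>x. h i x \<partial>lborel)"
    by (simp add: prod_Basis_cart ix)
  finally show ?thesis .
qed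

lemma sets_std_normal_vector [measurable_cong, simp]:
  "sets (std_normal_vector :: (real ^ 'd) measure) = sets borel"
  by (simp add: std_normal_vector_def)

lemma space_std_normal_vector [simp]: "space (std_normal_vector :: (real ^ 'd) measure) = UNIV"
  by (simp add: std_normal_vector_def)

definition std_normal_vector_density :: "real ^ 'd \<Rightarrow> real" where
  "std_normal_vector_density z = (\<Prod>i\<in>UNIV. std_normal_density (z $ i))"

lemma std_normal_vector_density_nonneg: "0 \<le> std_normal_vector_density z"
  by (simp add: std_normal_vector_density_def prod_nonneg)

lemma borel_measurable_std_normal_vector_density [measurable]:
  "std_normal_vector_density \<in> borel_measurable borel"
  unfolding std_normal_vector_density_def by measurable

lemma std_normal_vector_eq: "std_normal_vector = density lborel std_normal_vector_density"
  by (simp add: std_normal_vector_def std_normal_vector_density_def)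

lemma std_normal_vector_density_eq:
  fixes z :: "real ^ 'd"
  shows "std_normal_vector_density z = exp (- (norm z)\<^sup>2 / 2) / sqrt (2 * pi) ^ CARD('d)"
proof -
  have "(\<Prod>i\<in>UNIV. exp (- (z $ i)\<^sup>2 / 2)) = exp (- (norm z)\<^sup>2 / 2)"
    by (simp add: norm_vec_def L2_set_def real_sqrt_pow2 sum_nonneg exp_sum[symmetric]
        sum_negf sum_divide_distrib[symmetric])
  then show ?thesis
    by (simp add: std_normal_vector_density_def normal_density_def prod_dividef)
qed

lemma std_normal_vector_density_le:
  fixes z :: "real ^ 'd"
  shows "std_normal_vector_density z \<le> 1 / sqrt (2 * pi) ^ CARD('d)"
  unfolding std_normal_vector_density_eq by (intro divide_right_mono) auto

lemma prob_space_std_normal_vector: "prob_space (std_normal_vector :: (real ^ 'd) measure)"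
proof
  have "emeasure (std_normal_vector :: (real ^ 'd) measure) UNIV =
      (\<integral>\<^sup>+z. (\<Prod>b\<in>Basis. ennreal (std_normal_density (z \<bullet> b))) \<partial>(lborel :: (real ^ 'd) measure))"
    by (simp add: std_normal_vector_def emeasure_density prod_Basis_cart inner_axis prod_ennreal)
  also have "\<dots> = (\<Prod>b\<in>(Basis :: (real ^ 'd) set). \<integral>\<^sup>+x. ennreal (std_normal_density x) \<partial>lborel)"
    by (rule nn_integral_lborel_prod) auto
  also have "(\<integral>\<^sup>+x. ennreal (std_normal_density x) \<partial>lborel) = 1"
    using prob_space.emeasure_space_1[OF prob_space_normal_density[of 1 0]]
    by (simp add: emeasure_density)
  finally show "emeasure (std_normal_vector :: (real ^ 'd) measure)
      (space (std_normal_vector :: (real ^ 'd) measure)) = 1" by simp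
qed

lemma char_std_normal_vector:
  fixes s :: "real ^ 'd"
  shows "(\<integral>z. iexp (s \<bullet> z) \<partial>std_normal_vector) = of_real (exp (- (norm s)\<^sup>2 / 2))"
proof -
  let ?h = "\<lambda>i x. std_normal_density x *\<^sub>R iexp (s $ i * x)"
  have int: "integrable lborel (?h i)" for i
  proof (rule Bochner_Integration.integrable_bound)
    show "integrable lborel (std_normal_density :: real \<Rightarrow> real)"
      using integrable_normal_moment[of 1 0 0] by simp
  qed auto
  have "(\<integral>z. iexp (s \<bullet> z) \<partial>std_normal_vector)
      = (\<integral>z. (\<Prod>i\<in>UNIV. std_normal_density (z $ i)) *\<^sub>R iexp (s \<bullet> z) \<partial>lborel)"
    unfolding std_normal_vector_def
    by (rule integral_density) (auto intro!: prod_nonneg)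
  also have "\<dots> = (\<integral>z. (\<Prod>i\<in>UNIV. ?h i (z $ i)) \<partial>lborel)"
    by (intro Bochner_Integration.integral_cong refl)
      (simp add: scaleR_conv_of_real prod.distrib inner_vec_def exp_sum sum_distrib_left)
  also have "\<dots> = (\<Prod>i\<in>UNIV. \<integral>x. ?h i x \<partial>lborel)"
    by (rule integral_lborel_prod_cart[OF int])
  also have "(\<lambda>i. \<integral>x. ?h i x \<partial>lborel) = (\<lambda>i. char std_normal_distribution (s $ i))"
    by (auto simp: char_def integral_density)
  also have "(\<Prod>i\<in>UNIV. char std_normal_distribution (s $ i)) = of_real (\<Prod>i\<in>UNIV. exp (- (s $ i)\<^sup>2 / 2))"
    by (simp add: char_std_normal_distribution)
  also have "(\<Prod>i\<in>UNIV. exp (- (s $ i)\<^sup>2 / 2)) = exp (- (norm s)\<^sup>2 / 2)"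
    by (simp add: norm_vec_def L2_set_def real_sqrt_pow2 sum_nonneg exp_sum[symmetric]
        sum_negf sum_divide_distrib[symmetric])
  finally show ?thesis .
qed

text \<open>The factor \<open>A\<close> picked by the choice operator enters only through
  \<open>A ** transpose A\<close>: the characteristic function of \<open>A Z\<close> at
  \<open>s\<close> is that of \<open>Z\<close> at \<open>transpose A *v s\<close>, and the squared
  norm of this vector is the quadratic form of \<open>S\<close>.\<close>

lemma
  fixes S :: "real ^ 'd ^ 'd"
  assumes sym: "\<And>i j. S $ i $ j = S $ j $ i"
    and psd: "\<And>v. 0 \<le> v \<bullet> (S *v v)"
  shows prob_algebra_centered_normal: "centered_normal S \<in> space (prob_algebra borel)"
    and char_centered_normal:
      "(\<integral>x. iexp (s \<bullet> x) \<partial>centered_normal S) = of_real (exp (- (s \<bullet> (S *v s)) / 2))"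
proof -
  obtain A :: "real ^ 'd ^ 'd" where A: "A ** transpose A = S"
    and eq: "centered_normal S = distr std_normal_vector borel (\<lambda>z. A *v z)"
    unfolding centered_normal_def Let_def using someI_ex[OF psd_factorization[OF sym psd]] by blast
  have [measurable]: "(\<lambda>z. A *v z) \<in> borel_measurable borel"
    by (intro borel_measurable_continuous_onI linear_continuous_on) simp
  interpret prob_space "std_normal_vector :: (real ^ 'd) measure"
    by (rule prob_space_std_normal_vector)
  show "centered_normal S \<in> space (prob_algebra borel)"
    unfolding eq space_prob_algebra by (auto intro!: prob_space_distr)
  have "(\<integral>x. iexp (s \<bullet> x) \<partial>centered_normal S) = (\<integral>z. iexp ((transpose A *v s) \<bullet> z) \<partial>std_normal_vector)"
    unfolding eq
    by (subst integral_distr) (auto simp: dot_matrix_vector_mul dot_lmul_matrix[symmetric] inner_commute)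
  also have "(norm (transpose A *v s))\<^sup>2 = s \<bullet> (S *v s)"
    unfolding A[symmetric] power2_norm_eq_inner
    by (simp add: matrix_vector_mul_assoc[symmetric] dot_lmul_matrix[symmetric] inner_commute)
  ultimately show "(\<integral>x. iexp (s \<bullet> x) \<partial>centered_normal S) = of_real (exp (- (s \<bullet> (S *v s)) / 2))"
    by (simp add: char_std_normal_vector)
qed

section \<open>Convergence of characteristic functions\<close>

lemma abs_std_normal_vector_density_le:
  fixes z :: "real ^ 'd"
  shows "\<bar>std_normal_vector_density z\<bar> \<le> 1 / sqrt (2 * pi) ^ CARD('d)"
  using std_normal_vector_density_le[of z] std_normal_vector_density_nonneg[of z] by simp

text \<open>The Gaussian density is, up to a constant, its own characteristic function. By Fubini a
  Gaussian smoothing of \<open>M\<close> is therefore an average of the characteristic function of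
  \<open>M\<close> over Gaussian frequencies, and a null set of frequencies does not matter.\<close>

lemma gaussian_kernel_eq_char:
  fixes M :: "(real ^ 'd) measure" and y :: "real ^ 'd"
  assumes "prob_space M" and sets [measurable_cong]: "sets M = sets borel"
  shows "complex_of_real (\<integral>x. std_normal_vector_density (c *\<^sub>R (y - x)) \<partial>M) =
    (\<integral>z. iexp (- (c *\<^sub>R z \<bullet> y)) * (\<integral>x. iexp ((c *\<^sub>R z) \<bullet> x) \<partial>M) \<partial>std_normal_vector) /
      sqrt (2 * pi) ^ CARD('d)"
proof -
  interpret M: prob_space M by fact
  interpret G: prob_space "std_normal_vector :: (real ^ 'd) measure"
    by (rule prob_space_std_normal_vector)
  interpret P: pair_prob_space M "std_normal_vector :: (real ^ 'd) measure" ..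
  have [simp]: "space M = UNIV" using sets_eq_imp_space_eq[OF sets] by simp
  have int: "integrable (M \<Otimes>\<^sub>M (std_normal_vector :: (real ^ 'd) measure))
      (\<lambda>(x, z). iexp (c *\<^sub>R z \<bullet> (x - y)))"
    by (rule P.integrable_const_bound[of _ 1]) auto
  have "complex_of_real (\<integral>x. std_normal_vector_density (c *\<^sub>R (y - x)) \<partial>M) * sqrt (2 * pi) ^ CARD('d)
      = (\<integral>x. of_real (std_normal_vector_density (c *\<^sub>R (y - x)) * sqrt (2 * pi) ^ CARD('d)) \<partial>M)"
    by (simp flip: of_real_mult of_real_power)
  also have "\<dots> = (\<integral>x. (\<integral>z. iexp (c *\<^sub>R z \<bullet> (x - y)) \<partial>std_normal_vector) \<partial>M)"
  proof (intro Bochner_Integration.integral_cong refl)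
    fix x
    have "(\<integral>z. iexp (c *\<^sub>R z \<bullet> (x - y)) \<partial>std_normal_vector) =
        (\<integral>z. iexp (c *\<^sub>R (x - y) \<bullet> z) \<partial>std_normal_vector)"
      by (simp add: inner_commute)
    also have "\<dots> = of_real (std_normal_vector_density (c *\<^sub>R (y - x)) * sqrt (2 * pi) ^ CARD('d))"
      unfolding char_std_normal_vector std_normal_vector_density_eq by (simp add: norm_minus_commute)
    finally show "of_real (std_normal_vector_density (c *\<^sub>R (y - x)) * sqrt (2 * pi) ^ CARD('d)) =
        (\<integral>z. iexp (c *\<^sub>R z \<bullet> (x - y)) \<partial>std_normal_vector)" by simp
  qed
  also have "\<dots> = (\<integral>z. (\<integral>x. iexp (c *\<^sub>R z \<bullet> (x - y)) \<partial>M) \<partial>std_normal_vector)"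
    using P.Fubini_integral[OF int] by simp
  also have "\<dots> = (\<integral>z. iexp (- (c *\<^sub>R z \<bullet> y)) * (\<integral>x. iexp ((c *\<^sub>R z) \<bullet> x) \<partial>M) \<partial>std_normal_vector)"
  proof (intro Bochner_Integration.integral_cong refl)
    fix z
    have "(\<integral>x. iexp (c *\<^sub>R z \<bullet> (x - y)) \<partial>M) = (\<integral>x. iexp (- (c *\<^sub>R z \<bullet> y)) * iexp ((c *\<^sub>R z) \<bullet> x) \<partial>M)"
      by (intro Bochner_Integration.integral_cong refl)
        (simp add: exp_add[symmetric] inner_diff_right algebra_simps)
    then show "(\<integral>x. iexp (c *\<^sub>R z \<bullet> (x - y)) \<partial>M) =
        iexp (- (c *\<^sub>R z \<bullet> y)) * (\<integral>x. iexp ((c *\<^sub>R z) \<bullet> x) \<partial>M)" by simp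
  qed
  finally show ?thesis by (simp add: field_simps)
qed

text \<open>The substitution \<open>y = x + z / c\<close> exhibits \<open>c ^ CARD('d)\<close> times
  the inner integral as the density at \<open>y\<close> of \<open>M\<close> convolved with Gaussian
  noise of scale \<open>1 / c\<close>. Lebesgue integrability of \<open>f\<close> and boundedness of
  the kernel justify Fubini.\<close>

lemma integral_gaussian_smoothing:
  fixes M :: "(real ^ 'd) measure" and f :: "real ^ 'd \<Rightarrow> real"
  assumes "prob_space M" and sets [measurable_cong]: "sets M = sets borel"
    and f: "integrable lborel f" and c: "0 < c"
  shows "(\<integral>x. (\<integral>z. f (x + (1 / c) *\<^sub>R z) \<partial>std_normal_vector) \<partial>M) =
    c ^ CARD('d) * (\<integral>y. f y * (\<integral>x. std_normal_vector_density (c *\<^sub>R (y - x)) \<partial>M) \<partial>lborel)"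
proof -
  interpret M: prob_space M by fact
  interpret P: pair_sigma_finite M "lborel :: (real ^ 'd) measure" ..
  let ?g = "std_normal_vector_density :: real ^ 'd \<Rightarrow> real"
  have [measurable]: "f \<in> borel_measurable borel" using f by auto
  have int: "integrable (M \<Otimes>\<^sub>M lborel) (\<lambda>(x, y). f y * ?g (c *\<^sub>R (y - x)))"
  proof (rule Bochner_Integration.integrable_bound)
    have "integrable (M \<Otimes>\<^sub>M lborel) (\<lambda>p. f (snd p))"
    proof (rule P.integrable_product_swap_iff[THEN iffD1])
      interpret Q: pair_sigma_finite "lborel :: (real ^ 'd) measure" M ..
      show "integrable (lborel \<Otimes>\<^sub>M M) (\<lambda>(x, y). f (snd (y, x)))"
        using f by (intro Q.Fubini_integrable) (auto simp: M.prob_space)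
    qed
    then show "integrable (M \<Otimes>\<^sub>M lborel) (\<lambda>p. f (snd p) * (1 / sqrt (2 * pi) ^ CARD('d)))"
      by simp
    show "AE p in M \<Otimes>\<^sub>M lborel. norm (case p of (x, y) \<Rightarrow> f y * ?g (c *\<^sub>R (y - x))) \<le>
        norm (f (snd p) * (1 / sqrt (2 * pi) ^ CARD('d)))"
    proof (intro AE_I2, clarify)
      fix x y :: "real ^ 'd"
      show "norm (f y * ?g (c *\<^sub>R (y - x))) \<le> norm (f (snd (x, y)) * (1 / sqrt (2 * pi) ^ CARD('d)))"
        using mult_left_mono[OF std_normal_vector_density_le[of "c *\<^sub>R (y - x)"], of "\<bar>f y\<bar>"]
          std_normal_vector_density_nonneg[of "c *\<^sub>R (y - x)"]
        by (simp add: abs_mult)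
    qed
  qed measurable
  have "(\<integral>z. f (x + (1 / c) *\<^sub>R z) \<partial>std_normal_vector) = c ^ CARD('d) * (\<integral>y. f y * ?g (c *\<^sub>R (y - x)) \<partial>lborel)" for x
  proof -
    have "(\<integral>y. f y * ?g (c *\<^sub>R (y - x)) \<partial>lborel) =
        (\<integral>z. (1 / c) ^ CARD('d) * (f (x + (1 / c) *\<^sub>R z) * ?g z) \<partial>lborel)"
      using c
      by (subst lborel_affine[of "1 / c" x], simp, subst integral_density; simp; subst integral_distr) auto
    also have "\<dots> = (1 / c) ^ CARD('d) * (\<integral>z. f (x + (1 / c) *\<^sub>R z) \<partial>std_normal_vector)"
      unfolding std_normal_vector_eq
      by (subst integral_density) (auto simp: std_normal_vector_density_nonneg mult.commute)
    finally show ?thesis using c by (simp add: power_divide)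
  qed
  then have "(\<integral>x. (\<integral>z. f (x + (1 / c) *\<^sub>R z) \<partial>std_normal_vector) \<partial>M) =
      c ^ CARD('d) * (\<integral>x. (\<integral>y. f y * ?g (c *\<^sub>R (y - x)) \<partial>lborel) \<partial>M)" by simp
  also have "(\<integral>x. (\<integral>y. f y * ?g (c *\<^sub>R (y - x)) \<partial>lborel) \<partial>M) =
      (\<integral>y. (\<integral>x. f y * ?g (c *\<^sub>R (y - x)) \<partial>M) \<partial>lborel)"
    using P.Fubini_integral[OF int] by simp
  finally show ?thesis by simp
qed

text \<open>The noise \<open>z / k\<close> moves the argument by \<delta> or more only if the norm
  of \<open>z\<close> is at least \<open>k * \<delta>\<close>. This has small Gaussian probability
  for large \<open>k\<close>, and the difference is then at most \<open>2 * B\<close>. The bound is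
  uniform in \<open>x\<close>, hence in the measure against which it is later integrated.\<close>

lemma gaussian_smoothing_close:
  fixes f :: "real ^ 'd \<Rightarrow> real"
  assumes uc: "uniformly_continuous_on UNIV f" and b: "\<And>x. \<bar>f x\<bar> \<le> B" and e: "0 < e"
  shows "\<exists>k::nat. 0 < k \<and> (\<forall>x. \<bar>(\<integral>z. f (x + (1 / real k) *\<^sub>R z) \<partial>std_normal_vector) - f x\<bar> \<le> e)"
proof -
  let ?G = "std_normal_vector :: (real ^ 'd) measure"
  interpret G: prob_space ?G by (rule prob_space_std_normal_vector)
  have [measurable]: "f \<in> borel_measurable borel"
    using uc by (intro borel_measurable_continuous_onI uniformly_continuous_imp_continuous)
  obtain \<delta> where d: "0 < \<delta>" "\<And>x y. dist x y < \<delta> \<Longrightarrow> \<bar>f x - f y\<bar> < e / 2"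
    using uc e unfolding uniformly_continuous_on_def dist_real_def by (metis UNIV_I half_gt_zero)
  have B0: "0 \<le> B" using b[of 0] by linarith
  let ?T = "\<lambda>n. {z :: real ^ 'd. real n * \<delta> \<le> norm z}"
  have "(\<lambda>n. G.prob (?T n)) \<longlonglongrightarrow> G.prob (\<Inter>n. ?T n)"
    using d(1) by (intro G.finite_Lim_measure_decseq)
      (auto simp: decseq_def intro: order_trans[OF mult_right_mono[OF of_nat_mono]])
  moreover have "(\<Inter>n. ?T n) = {}"
  proof -
    have "\<exists>n. norm z < real n * \<delta>" for z :: "real ^ 'd"
      using d(1) reals_Archimedean3 by blast
    then show ?thesis by (simp add: set_eq_iff not_le)
  qed
  ultimately have "(\<lambda>n. 2 * B * G.prob (?T n)) \<longlonglongrightarrow> 2 * B * 0"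
    by (intro tendsto_intros) simp
  then have "\<forall>\<^sub>F n in sequentially. 2 * B * G.prob (?T n) < e / 2"
    using e by (intro order_tendstoD) auto
  then have "\<forall>\<^sub>F n in sequentially. 0 < n \<and> 2 * B * G.prob (?T n) < e / 2"
    using eventually_gt_at_top[of 0] by eventually_elim auto
  then obtain k where k: "0 < k" "2 * B * G.prob (?T k) < e / 2"
    by (auto simp: eventually_sequentially)
  show ?thesis
  proof (intro exI[of _ k] conjI allI)
    fix x
    let ?h = "\<lambda>z. f (x + (1 / real k) *\<^sub>R z)"
    have i1: "integrable ?G ?h"
      by (rule G.integrable_const_bound[of _ B]) (auto simp: b)
    have i2: "integrable ?G (\<lambda>z. e / 2 + 2 * B * indicator (?T k) z :: real)"
      by (intro Bochner_Integration.integrable_add integrable_mult_right G.integrable_const)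
        (auto simp: G.emeasure_eq_measure)
    have "\<bar>(\<integral>z. ?h z \<partial>?G) - f x\<bar> = \<bar>\<integral>z. ?h z - f x \<partial>?G\<bar>"
      using i1 by (simp add: G.prob_space[simplified])
    also have "\<dots> \<le> (\<integral>z. \<bar>?h z - f x\<bar> \<partial>?G)"
      by (rule integral_abs_bound)
    also have "\<dots> \<le> (\<integral>z. e / 2 + 2 * B * indicator (?T k) z \<partial>?G)"
    proof (rule integral_mono)
      show "integrable ?G (\<lambda>z. \<bar>?h z - f x\<bar>)" using i1 by auto
      fix z :: "real ^ 'd"
      show "\<bar>?h z - f x\<bar> \<le> e / 2 + 2 * B * indicator (?T k) z"
      proof (cases "z \<in> ?T k")
        case True
        have "\<bar>?h z - f x\<bar> \<le> B + B"
          using b[of x] b[of "x + (1 / real k) *\<^sub>R z"] by linarith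
        then show ?thesis using True e by simp
      next
        case False
        then have "dist (x + (1 / real k) *\<^sub>R z) x < \<delta>"
          using k(1) by (simp add: dist_norm field_simps)
        from d(2)[OF this] show ?thesis using False by simp
      qed
    qed fact
    also have "\<dots> = e / 2 + 2 * B * G.prob (?T k)"
      by (subst Bochner_Integration.integral_add)
        (auto simp: G.emeasure_eq_measure G.prob_space[simplified] intro!: integrable_mult_right)
    also have "\<dots> \<le> e" using k by simp
    finally show "\<bar>(\<integral>z. ?h z \<partial>?G) - f x\<bar> \<le> e" .
  qed (use k in auto)
qed

text \<open>Compact support is used twice: \<open>f\<close> is Lebesgue integrable, so pointwise
  convergence of the smoothed densities gives convergence of the smoothed integrals, and
  \<open>f\<close> is uniformly continuous, so removing the smoothing costs little under every
  probability measure. The frequencies have the form \<open>k z\<close> because the noise has scale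
  \<open>1 / k\<close>; only countably many \<open>k\<close> occur.\<close>

lemma tendsto_integral_compact_support:
  fixes \<mu> :: "nat \<Rightarrow> (real ^ 'd) measure" and f :: "real ^ 'd \<Rightarrow> real"
  assumes p: "\<And>n. prob_space (\<mu> n)" "\<And>n. sets (\<mu> n) = sets borel"
    and q: "prob_space \<nu>" "sets \<nu> = sets borel"
    and char: "\<And>k :: nat. AE z in std_normal_vector.
      (\<lambda>n. \<integral>x. iexp ((real k *\<^sub>R z) \<bullet> x) \<partial>\<mu> n) \<longlonglongrightarrow> (\<integral>x. iexp ((real k *\<^sub>R z) \<bullet> x) \<partial>\<nu>)"
    and f: "continuous_on UNIV f" "\<And>x. x \<notin> cball 0 R \<Longrightarrow> f x = 0"
  shows "(\<lambda>n. \<integral>x. f x \<partial>\<mu> n) \<longlonglongrightarrow> (\<integral>x. f x \<partial>\<nu>)"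
proof -
  let ?G = "std_normal_vector :: (real ^ 'd) measure"
  interpret G: prob_space ?G by (rule prob_space_std_normal_vector)
  note [measurable_cong] = p(2) q(2)
  have sp [simp]: "space (\<mu> n) = UNIV" "space \<nu> = UNIV" for n
    using sets_eq_imp_space_eq[OF p(2)] sets_eq_imp_space_eq[OF q(2)] by auto
  have [measurable]: "f \<in> borel_measurable borel"
    using f(1) by (intro borel_measurable_continuous_onI)
  have "compact (f ` cball 0 R)"
    by (intro compact_continuous_image continuous_on_subset[OF f(1)]) auto
  then obtain B where B: "\<And>x. x \<in> cball 0 R \<Longrightarrow> \<bar>f x\<bar> \<le> B" "0 < B"
    using compact_imp_bounded[of "f ` cball 0 R"] unfolding bounded_pos by (metis imageI real_norm_def)
  have b: "\<bar>f x\<bar> \<le> B" for x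
    using B(1)[of x] B(2) f(2)[of x] by (cases "x \<in> cball 0 R") auto
  have uc: "uniformly_continuous_on UNIV f"
  proof -
    have "uniformly_continuous_on (cball 0 (R + 1)) f"
      by (intro compact_uniformly_continuous continuous_on_subset[OF f(1)]) auto
    show ?thesis
      unfolding uniformly_continuous_on_def
    proof (intro allI impI)
      fix e :: real assume "0 < e"
      then obtain d where d: "0 < d" "\<And>x y. x \<in> cball 0 (R + 1) \<Longrightarrow> y \<in> cball 0 (R + 1) \<Longrightarrow>
          dist y x < d \<Longrightarrow> dist (f y) (f x) < e"
        using \<open>uniformly_continuous_on (cball 0 (R + 1)) f\<close> unfolding uniformly_continuous_on_def by metis
      show "\<exists>d>0. \<forall>x\<in>UNIV. \<forall>x'\<in>UNIV. dist x' x < d \<longrightarrow> dist (f x') (f x) < e"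
      proof (intro exI[of _ "min d 1"] conjI ballI impI)
        fix x y :: "real ^ 'd" assume xy: "dist y x < min d 1"
        show "dist (f y) (f x) < e"
        proof (cases "x \<in> cball 0 (R + 1) \<and> y \<in> cball 0 (R + 1)")
          case True then show ?thesis using d xy by auto
        next
          case False
          have "norm x \<le> norm y + dist y x" "norm y \<le> norm x + dist y x"
            by norm+
          then have "x \<notin> cball 0 R" "y \<notin> cball 0 R" using False xy by auto
          then show ?thesis using f(2) \<open>0 < e\<close> by simp
        qed
      qed (use d in auto)
    qed
  qed
  have fint: "integrable lborel f"
  proof -
    have "set_integrable lborel (cball 0 R) f"
      unfolding set_integrable_def
      by (rule integrableI_bounded_set_indicator[where B=B]) (use emeasure_bounded_finite[OF bounded_cball] in \<open>auto simp: b\<close>)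
    moreover have "(\<lambda>x. indicator (cball 0 R) x *\<^sub>R f x) = f"
      using f(2) by (auto simp: fun_eq_iff split: split_indicator)
    ultimately show ?thesis by (simp add: set_integrable_def)
  qed
  define h where "h M c y = (\<integral>x. std_normal_vector_density (c *\<^sub>R (y - x)) \<partial>M)"
    for M :: "(real ^ 'd) measure" and c and y :: "real ^ 'd"
  \<comment> \<open>Densities of the smoothed laws converge at every point: dominated convergence in
    the frequency, the characteristic functions being bounded by 1.\<close>
  have hlim: "(\<lambda>n. h (\<mu> n) (real k) y) \<longlonglongrightarrow> h \<nu> (real k) y" for k y
  proof -
    have "(\<lambda>n. complex_of_real (h (\<mu> n) (real k) y)) \<longlonglongrightarrow> complex_of_real (h \<nu> (real k) y)"
      unfolding h_def gaussian_kernel_eq_char[OF p] gaussian_kernel_eq_char[OF q]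
    proof (intro tendsto_divide tendsto_const integral_dominated_convergence)
      interpret Q: prob_space \<nu> by fact
      show "AE z in std_normal_vector. (\<lambda>n. iexp (- (real k *\<^sub>R z \<bullet> y)) * (CLINT x|\<mu> n. iexp (real k *\<^sub>R z \<bullet> x)))
         \<longlonglongrightarrow> iexp (- (real k *\<^sub>R z \<bullet> y)) * (CLINT x|\<nu>. iexp (real k *\<^sub>R z \<bullet> x))"
        using char[of k] by eventually_elim (intro tendsto_intros)
      show "(\<lambda>z. iexp (- (real k *\<^sub>R z \<bullet> y)) * (CLINT x|\<nu>. iexp (real k *\<^sub>R z \<bullet> x)))
          \<in> borel_measurable std_normal_vector"
        by measurable
      fix n
      interpret P: prob_space "\<mu> n" by fact
      show "(\<lambda>z. iexp (- (real k *\<^sub>R z \<bullet> y)) * (CLINT x|\<mu> n. iexp (real k *\<^sub>R z \<bullet> x)))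
          \<in> borel_measurable std_normal_vector"
        by measurable
      have "norm (CLINT x|\<mu> n. iexp (real k *\<^sub>R z \<bullet> x)) \<le> 1" for z
      proof -
        have "norm (CLINT x|\<mu> n. iexp (real k *\<^sub>R z \<bullet> x)) \<le> (\<integral>x. norm (iexp (real k *\<^sub>R z \<bullet> x)) \<partial>\<mu> n)"
          by (rule integral_norm_bound)
        then show ?thesis using P.prob_space by simp
      qed
      then show "AE z in std_normal_vector.
          norm (iexp (- (real k *\<^sub>R z \<bullet> y)) * (CLINT x|\<mu> n. iexp (real k *\<^sub>R z \<bullet> x))) \<le> 1"
        by (simp add: norm_mult)
    qed auto
    then show ?thesis by (simp add: tendsto_of_real_iff)
  qed
  have hb: "\<bar>h M c y\<bar> \<le> 1 / sqrt (2 * pi) ^ CARD('d)"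
    if "prob_space M" "sets M = sets borel" for M c y
  proof -
    interpret M: prob_space M by fact
    have [measurable_cong]: "sets M = sets borel" by fact
    have "h M c y \<le> (\<integral>x. 1 / sqrt (2 * pi) ^ CARD('d) \<partial>M)"
      unfolding h_def using std_normal_vector_density_le std_normal_vector_density_nonneg
      by (intro integral_mono M.integrable_const_bound[of _ "1 / sqrt (2 * pi) ^ CARD('d)"])
        (auto simp: abs_std_normal_vector_density_le)
    moreover have "0 \<le> h M c y" unfolding h_def
      by (simp add: std_normal_vector_density_nonneg)
    ultimately show ?thesis by (simp add: M.prob_space)
  qed
  have hm: "h M c \<in> borel_measurable borel" if "prob_space M" "sets M = sets borel" for M c
  proof -
    interpret M: prob_space M by fact
    have [measurable_cong]: "sets M = sets borel" by fact
    show ?thesis unfolding h_def by measurable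
  qed
  have slim: "(\<lambda>n. \<integral>x. (\<integral>z. f (x + (1 / real k) *\<^sub>R z) \<partial>?G) \<partial>\<mu> n) \<longlonglongrightarrow>
      (\<integral>x. (\<integral>z. f (x + (1 / real k) *\<^sub>R z) \<partial>?G) \<partial>\<nu>)" if "0 < k" for k :: nat
  proof -
    have k: "0 < real k" using that by simp
    show ?thesis
      unfolding integral_gaussian_smoothing[OF p fint k] integral_gaussian_smoothing[OF q fint k]
        h_def[symmetric]
    proof (intro tendsto_mult tendsto_const integral_dominated_convergence
        [where w = "\<lambda>y. \<bar>f y\<bar> * (1 / sqrt (2 * pi) ^ CARD('d))"])
      show "integrable lborel (\<lambda>y. \<bar>f y\<bar> * (1 / sqrt (2 * pi) ^ CARD('d)))" using fint by auto
      show "AE y in lborel. norm (f y * h (\<mu> n) (real k) y) \<le> \<bar>f y\<bar> * (1 / sqrt (2 * pi) ^ CARD('d))" for n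
        using mult_left_mono[OF hb[OF p], of "\<bar>f _\<bar>"] by (simp add: abs_mult)
    qed (use hlim hm[OF p] hm[OF q] in \<open>auto intro!: tendsto_intros borel_measurable_times\<close>)
  qed
  show ?thesis
  proof (rule LIMSEQ_I)
    fix r :: real assume r: "0 < r"
    then obtain k :: nat where k: "0 < k"
        "\<And>x. \<bar>(\<integral>z. f (x + (1 / real k) *\<^sub>R z) \<partial>?G) - f x\<bar> \<le> r / 4"
      using gaussian_smoothing_close[OF uc b, of "r / 4"] by auto
    let ?s = "\<lambda>x. \<integral>z. f (x + (1 / real k) *\<^sub>R z) \<partial>?G"
    have close: "\<bar>(\<integral>x. ?s x \<partial>M) - (\<integral>x. f x \<partial>M)\<bar> \<le> r / 4"
      if "prob_space M" "sets M = sets borel" for M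
    proof -
      interpret M: prob_space M by fact
      have [measurable_cong]: "sets M = sets borel" by fact
      have if': "integrable M f" by (rule M.integrable_const_bound[of _ B]) (auto simp: b)
      have "\<bar>?s x\<bar> \<le> B + r / 4" for x using k(2)[of x] b[of x] by linarith
      then have ints: "integrable M ?s" by (intro M.integrable_const_bound[of _ "B + r / 4"]) auto
      have "\<bar>(\<integral>x. ?s x \<partial>M) - (\<integral>x. f x \<partial>M)\<bar> = \<bar>\<integral>x. ?s x - f x \<partial>M\<bar>"
        using ints if' by simp
      also have "\<dots> \<le> (\<integral>x. \<bar>?s x - f x\<bar> \<partial>M)" by (rule integral_abs_bound)
      also have "\<dots> \<le> (\<integral>x. r / 4 \<partial>M)" using ints if' k by (intro integral_mono) auto
      also have "\<dots> = r / 4" by (simp add: M.prob_space)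
      finally show ?thesis .
    qed
    obtain N where N: "\<And>n. n \<ge> N \<Longrightarrow> \<bar>(\<integral>x. ?s x \<partial>\<mu> n) - (\<integral>x. ?s x \<partial>\<nu>)\<bar> < r / 4"
      using LIMSEQ_D[OF slim[OF k(1)], of "r / 4"] r by auto
    show "\<exists>no. \<forall>n\<ge>no. norm ((\<integral>x. f x \<partial>\<mu> n) - (\<integral>x. f x \<partial>\<nu>)) < r"
    proof (intro exI[of _ N] allI impI)
      fix n assume "N \<le> n"
      then show "norm ((\<integral>x. f x \<partial>\<mu> n) - (\<integral>x. f x \<partial>\<nu>)) < r"
        using N[of n] close[OF p, of n] close[OF q] r by (simp add: abs_if split: if_splits)
    qed
  qed
qed

text \<open>Tightness comes from the limit. A compactly supported cut-off has integral close to 1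
  under \<nu>, hence, by the compactly supported case, also under \<open>\<mu> n\<close> for large
  \<open>n\<close>; the mass outside is then small.\<close>

lemma tendsto_integral_if_char:
  fixes \<mu> :: "nat \<Rightarrow> (real ^ 'd) measure" and f :: "real ^ 'd \<Rightarrow> real"
  assumes p: "\<And>n. prob_space (\<mu> n)" "\<And>n. sets (\<mu> n) = sets borel"
    and q: "prob_space \<nu>" "sets \<nu> = sets borel"
    and char: "\<And>k :: nat. AE z in std_normal_vector.
      (\<lambda>n. \<integral>x. iexp ((real k *\<^sub>R z) \<bullet> x) \<partial>\<mu> n) \<longlonglongrightarrow> (\<integral>x. iexp ((real k *\<^sub>R z) \<bullet> x) \<partial>\<nu>)"
    and f: "continuous_on UNIV f" "bounded (range f)"
  shows "(\<lambda>n. \<integral>x. f x \<partial>\<mu> n) \<longlonglongrightarrow> (\<integral>x. f x \<partial>\<nu>)"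
proof -
  note [measurable_cong] = p(2) q(2)
  interpret Q: prob_space \<nu> by fact
  have [simp]: "space \<nu> = UNIV" using sets_eq_imp_space_eq[OF q(2)] by simp
  have [measurable]: "f \<in> borel_measurable borel"
    using f(1) by (intro borel_measurable_continuous_onI)
  obtain B where b: "\<And>x. \<bar>f x\<bar> \<le> B" and B: "0 < B"
    using f(2) unfolding bounded_pos by auto
  define cut where "cut R x = max 0 (min 1 (R + 1 - norm x))" for R and x :: "real ^ 'd"
  have cut: "continuous_on UNIV (cut R)" "\<And>x. x \<notin> cball 0 (R + 1) \<Longrightarrow> cut R x = 0"
      "0 \<le> cut R x" "cut R x \<le> 1" "\<And>x. norm x \<le> R \<Longrightarrow> cut R x = 1" for R x
    unfolding cut_def by (auto intro!: continuous_intros)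
  have [measurable]: "cut R \<in> borel_measurable borel" for R unfolding cut_def by measurable
  note lim = tendsto_integral_compact_support[OF p q char]
  show ?thesis
  proof (rule LIMSEQ_I)
    fix r :: real assume r: "0 < r"
    let ?T = "\<lambda>n. {x :: real ^ 'd. norm x \<le> real n}"
    have "(\<lambda>n. Q.prob (?T n)) \<longlonglongrightarrow> Q.prob (\<Union>n. ?T n)"
      by (intro Q.finite_Lim_measure_incseq) (auto simp: incseq_def)
    moreover have "(\<Union>n. ?T n) = UNIV" using real_arch_simple by blast
    ultimately have "(\<lambda>n. Q.prob (?T n)) \<longlonglongrightarrow> 1" using Q.prob_space by simp
    \<comment> \<open>Missing mass \<open>r / (8 * B)\<close> costs at most \<open>r / 8\<close>
      under \<nu>. Under \<open>\<mu> n\<close> it may be twice as large and costs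
      \<open>r / 4\<close>; with the \<open>r / 4\<close> of the truncated integrals the sum stays
      below \<open>r\<close>.\<close>
    then have "\<forall>\<^sub>F n in sequentially. 1 - r / (8 * B) < Q.prob (?T n)"
      using r B by (intro order_tendstoD) auto
    then obtain R :: nat where R: "1 - r / (8 * B) < Q.prob (?T R)"
      by (auto simp: eventually_sequentially)
    have "Q.prob (?T R) = (\<integral>x. indicator (?T R) x \<partial>\<nu>)" by simp
    also have "\<dots> \<le> (\<integral>x. cut R x \<partial>\<nu>)"
      using cut(3,4,5)
      by (intro integral_mono Q.integrable_const_bound[of _ 1]) (auto split: split_indicator)
    finally have cutnu: "1 - r / (8 * B) < (\<integral>x. cut R x \<partial>\<nu>)" using R by simp
    have lcut: "(\<lambda>n. \<integral>x. cut R x \<partial>\<mu> n) \<longlonglongrightarrow> (\<integral>x. cut R x \<partial>\<nu>)"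
      by (rule lim[OF cut(1,2)])
    have lcutf: "(\<lambda>n. \<integral>x. f x * cut R x \<partial>\<mu> n) \<longlonglongrightarrow> (\<integral>x. f x * cut R x \<partial>\<nu>)"
      using cut(2) by (intro lim[of _ "real R + 1"] continuous_on_mult f cut(1)) auto
    have close: "\<bar>(\<integral>x. f x \<partial>M) - (\<integral>x. f x * cut R x \<partial>M)\<bar> \<le> B * (1 - (\<integral>x. cut R x \<partial>M))"
      if "prob_space M" "sets M = sets borel" for M
    proof -
      interpret M: prob_space M by fact
      have [measurable_cong]: "sets M = sets borel" by fact
      have i1: "integrable M f" by (rule M.integrable_const_bound[of _ B]) (auto simp: b)
      have i2: "integrable M (cut R)" by (rule M.integrable_const_bound[of _ 1]) (auto simp: cut)
      have i3: "integrable M (\<lambda>x. f x * cut R x)"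
      proof (rule M.integrable_const_bound[of _ B])
        show "AE x in M. norm (f x * cut R x) \<le> B"
          using mult_mono[OF b cut(4)[of R] less_imp_le[OF B] cut(3)[of R]] by (simp add: abs_mult cut)
      qed measurable
      have "\<bar>(\<integral>x. f x \<partial>M) - (\<integral>x. f x * cut R x \<partial>M)\<bar> = \<bar>\<integral>x. f x - f x * cut R x \<partial>M\<bar>"
        using i1 i3 by simp
      also have "\<dots> \<le> (\<integral>x. \<bar>f x - f x * cut R x\<bar> \<partial>M)" by (rule integral_abs_bound)
      also have "\<dots> \<le> (\<integral>x. B * (1 - cut R x) \<partial>M)"
      proof (rule integral_mono)
        fix x
        have "f x - f x * cut R x = f x * (1 - cut R x)" by (simp add: algebra_simps)
        then show "\<bar>f x - f x * cut R x\<bar> \<le> B * (1 - cut R x)"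
          using b[of x] cut(4)[of R x] by (auto simp: abs_mult intro!: mult_right_mono)
      qed (use i1 i2 i3 in auto)
      also have "\<dots> = B * (1 - (\<integral>x. cut R x \<partial>M))"
        using i2 by (simp add: M.prob_space)
      finally show ?thesis .
    qed
    have rB: "0 < r / (8 * B)" using r B by simp
    obtain N1 where N1: "\<And>n. n \<ge> N1 \<Longrightarrow> \<bar>(\<integral>x. cut R x \<partial>\<mu> n) - (\<integral>x. cut R x \<partial>\<nu>)\<bar> < r / (8 * B)"
      using LIMSEQ_D[OF lcut rB] by auto
    obtain N2 where N2: "\<And>n. n \<ge> N2 \<Longrightarrow> \<bar>(\<integral>x. f x * cut R x \<partial>\<mu> n) - (\<integral>x. f x * cut R x \<partial>\<nu>)\<bar> < r / 4"
      using LIMSEQ_D[OF lcutf, of "r / 4"] r by auto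
    show "\<exists>no. \<forall>n\<ge>no. norm ((\<integral>x. f x \<partial>\<mu> n) - (\<integral>x. f x \<partial>\<nu>)) < r"
    proof (intro exI[of _ "max N1 N2"] allI impI)
      fix n assume n: "max N1 N2 \<le> n"
      have "B * (1 - (\<integral>x. cut R x \<partial>\<mu> n)) \<le> B * (2 * (r / (8 * B)))"
        using N1[of n] n cutnu B by (intro mult_left_mono) (auto simp: abs_less_iff)
      moreover have "B * (1 - (\<integral>x. cut R x \<partial>\<nu>)) \<le> B * (r / (8 * B))"
        using cutnu B by (intro mult_left_mono) auto
      moreover have "B * (2 * (r / (8 * B))) = r / 4" "B * (r / (8 * B)) = r / 8"
        using B by auto
      ultimately show "norm ((\<integral>x. f x \<partial>\<mu> n) - (\<integral>x. f x \<partial>\<nu>)) < r"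
        using close[OF p, of n] close[OF q] N2[of n] n r by (simp add: abs_if split: if_splits)
    qed
  qed
qed

section \<open>Poisson processes\<close>

lemma (in prob_space) nn_integral_indep_var:
  assumes ind: "indep_var S X T Y" and h: "h \<in> borel_measurable (S \<Otimes>\<^sub>M T)"
  shows "(\<integral>\<^sup>+\<omega>. h (X \<omega>, Y \<omega>) \<partial>M) = (\<integral>\<^sup>+\<omega>. \<integral>\<^sup>+\<omega>'. h (X \<omega>, Y \<omega>') \<partial>M \<partial>M)"
proof -
  have rv [measurable]: "X \<in> M \<rightarrow>\<^sub>M S" "Y \<in> M \<rightarrow>\<^sub>M T"
    and eq: "distr M S X \<Otimes>\<^sub>M distr M T Y = distr M (S \<Otimes>\<^sub>M T) (\<lambda>x. (X x, Y x))"
    using ind by (auto simp: indep_var_distribution_eq)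
  interpret Y: prob_space "distr M T Y" by (rule prob_space_distr) fact
  note h [measurable]
  have "(\<integral>\<^sup>+\<omega>. h (X \<omega>, Y \<omega>) \<partial>M) = (\<integral>\<^sup>+p. h p \<partial>(distr M S X \<Otimes>\<^sub>M distr M T Y))"
    unfolding eq by (subst nn_integral_distr) auto
  also have "\<dots> = (\<integral>\<^sup>+x. \<integral>\<^sup>+y. h (x, y) \<partial>distr M T Y \<partial>distr M S X)"
    by (rule Y.nn_integral_fst[symmetric]) measurable
  also have "\<dots> = (\<integral>\<^sup>+\<omega>. \<integral>\<^sup>+\<omega>'. h (X \<omega>, Y \<omega>') \<partial>M \<partial>M)"
    by (subst nn_integral_distr, simp, measurable, intro nn_integral_cong, subst nn_integral_distr)
      (auto intro: measurable_Pair_compose_split)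
  finally show ?thesis .
qed

lemma nn_integral_count_space_Un:
  assumes "A \<inter> B = {}"
  shows "(\<integral>\<^sup>+x. f x \<partial>count_space (A \<union> B)) = (\<integral>\<^sup>+x. f x \<partial>count_space A) + (\<integral>\<^sup>+x. f x \<partial>count_space B)"
proof -
  have "f x * indicator (A \<union> B) x = f x * indicator A x + f x * indicator B x" for x
    using assms by (auto split: split_indicator)
  then show ?thesis
    by (simp add: nn_integral_count_space_indicator nn_integral_add)
qed

text \<open>The exponential series cancels \<open>exp (- r * x)\<close>: summed over all arrivals,
  the Erlang densities leave the constant intensity of the process.\<close>

lemma suminf_erlang_density:
  assumes r: "0 < r"
  shows "(\<Sum>k. ennreal (erlang_density k r x)) = ennreal r * indicator {0..} x"
proof (cases "x < 0")
  case True
  then show ?thesis by (simp add: erlang_density_def)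
next
  case False
  have "(\<lambda>k. (r * exp (- r * x)) * ((r * x) ^ k /\<^sub>R fact k)) sums ((r * exp (- r * x)) * exp (r * x))"
    by (intro sums_mult exp_converges)
  also have "(\<lambda>k. (r * exp (- r * x)) * ((r * x) ^ k /\<^sub>R fact k)) = (\<lambda>k. erlang_density k r x)"
    using False by (auto simp: fun_eq_iff erlang_density_def power_mult_distrib field_simps)
  also have "(r * exp (- r * x)) * exp (r * x) = r" by (simp add: exp_minus)
  finally have "(\<lambda>k. erlang_density k r x) sums r" .
  then show ?thesis
    using False r by (subst suminf_ennreal2) (auto simp: sums_iff)
qed

context prob_space
begin

lemma sum_waiting_time_eq: "(\<Sum>i\<le>k. waiting_time \<tau> i \<omega>) = \<tau> k \<omega>"
  by (induction k) (auto simp: waiting_time_def)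

lemma sum_waiting_time_eq': "\<tau> k \<omega> + (\<Sum>i\<in>{k<..k + Suc j}. waiting_time \<tau> i \<omega>) = \<tau> (k + Suc j) \<omega>"
proof -
  have "{..k + Suc j} = {..k} \<union> {k<..k + Suc j}" by auto
  then have "(\<Sum>i\<le>k + Suc j. waiting_time \<tau> i \<omega>) =
      (\<Sum>i\<le>k. waiting_time \<tau> i \<omega>) + (\<Sum>i\<in>{k<..k + Suc j}. waiting_time \<tau> i \<omega>)"
    by (simp only:) (intro sum.union_disjoint, auto)
  then show ?thesis by (simp only: sum_waiting_time_eq)
qed

context
  fixes r :: real and \<tau> :: "nat \<Rightarrow> 'a \<Rightarrow> real"
  assumes r: "0 < r" and arr: "poisson_arrivals r \<tau>"
begin

lemma arrival_measurable: "\<tau> k \<in> borel_measurable M"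
proof -
  have [measurable]: "waiting_time \<tau> k \<in> borel_measurable M" for k
    using arr by (auto simp: poisson_arrivals_def distributed_def)
  have "(\<lambda>\<omega>. \<Sum>i\<le>k. waiting_time \<tau> i \<omega>) \<in> borel_measurable M" by measurable
  then show ?thesis by (simp add: sum_waiting_time_eq)
qed

lemma arrival_distributed: "distributed M lborel (\<tau> k) (erlang_density k r)"
proof -
  have "distributed M lborel (\<lambda>\<omega>. \<Sum>i\<le>k. waiting_time \<tau> i \<omega>) (erlang_density (card {..k} - 1) r)"
    using arr r by (intro exponential_distributed_sum)
      (auto simp: poisson_arrivals_def intro: indep_vars_subset)
  then show ?thesis by (simp add: sum_waiting_time_eq)
qed

lemma arrival_increment_distributed:
  "distributed M lborel (\<lambda>\<omega>. \<Sum>i\<in>{k<..k + Suc j}. waiting_time \<tau> i \<omega>) (erlang_density j r)"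
proof -
  have "distributed M lborel (\<lambda>\<omega>. \<Sum>i\<in>{k<..k + Suc j}. waiting_time \<tau> i \<omega>)
      (erlang_density (card {k<..k + Suc j} - 1) r)"
    using arr r by (intro exponential_distributed_sum)
      (auto simp: poisson_arrivals_def intro: indep_vars_subset)
  then show ?thesis by simp
qed

lemma arrival_increment_indep:
  "indep_var borel (\<tau> k) borel (\<lambda>\<omega>. \<Sum>i\<in>{k<..k + Suc j}. waiting_time \<tau> i \<omega>)"
proof -
  have ind: "indep_vars (\<lambda>_. borel) (waiting_time \<tau>) UNIV"
    using arr by (simp add: poisson_arrivals_def)
  have "indep_var borel ((\<lambda>f. \<Sum>i\<le>k. f i) \<circ> (\<lambda>\<omega>. restrict (\<lambda>i. waiting_time \<tau> i \<omega>) {..k}))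
      borel ((\<lambda>f. \<Sum>i\<in>{k<..k + Suc j}. f i) \<circ> (\<lambda>\<omega>. restrict (\<lambda>i. waiting_time \<tau> i \<omega>) {k<..k + Suc j}))"
    by (intro indep_var_compose[OF indep_var_restrict[OF ind]]) auto
  also have "(\<lambda>f. \<Sum>i\<le>k. f i) \<circ> (\<lambda>\<omega>. restrict (\<lambda>i. waiting_time \<tau> i \<omega>) {..k}) = \<tau> k"
    by (auto simp: fun_eq_iff sum_waiting_time_eq)
  also have "(\<lambda>f. \<Sum>i\<in>{k<..k + Suc j}. f i) \<circ> (\<lambda>\<omega>. restrict (\<lambda>i. waiting_time \<tau> i \<omega>) {k<..k + Suc j})
      = (\<lambda>\<omega>. \<Sum>i\<in>{k<..k + Suc j}. waiting_time \<tau> i \<omega>)"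
    by (auto simp: fun_eq_iff)
  finally show ?thesis .
qed

text \<open>Campbell's formula. Summing the laws of the single arrivals suffices; no joint law
  enters.\<close>

lemma nn_integral_arrivals:
  assumes [measurable]: "f \<in> borel_measurable borel"
  shows "(\<integral>\<^sup>+k. \<integral>\<^sup>+\<omega>. f (\<tau> k \<omega>) \<partial>M \<partial>count_space UNIV) =
    ennreal r * (\<integral>\<^sup>+x. f x * indicator {0..} x \<partial>lborel)"
proof -
  have "(\<integral>\<^sup>+\<omega>. f (\<tau> k \<omega>) \<partial>M) = (\<integral>\<^sup>+x. ennreal (erlang_density k r x) * f x \<partial>lborel)" for k
    by (rule distributed_nn_integral[OF arrival_distributed, symmetric]) simp
  then have "(\<integral>\<^sup>+k. \<integral>\<^sup>+\<omega>. f (\<tau> k \<omega>) \<partial>M \<partial>count_space UNIV) =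
      (\<Sum>k. \<integral>\<^sup>+x. ennreal (erlang_density k r x) * f x \<partial>lborel)"
    by (simp add: nn_integral_count_space_nat)
  also have "\<dots> = (\<integral>\<^sup>+x. (\<Sum>k. ennreal (erlang_density k r x) * f x) \<partial>lborel)"
    by (rule nn_integral_suminf[symmetric]) measurable
  also have "\<dots> = (\<integral>\<^sup>+x. ennreal r * (f x * indicator {0..} x) \<partial>lborel)"
    by (simp add: suminf_erlang_density[OF r] mult_ac)
  also have "\<dots> = ennreal r * (\<integral>\<^sup>+x. f x * indicator {0..} x \<partial>lborel)"
    by (rule nn_integral_cmult) measurable
  finally show ?thesis .
qed

text \<open>The gap between two arrivals is Erlang distributed and independent of the earlier one.
  Writing the later index as \<open>k + Suc j\<close> frees both sums, and each of them collapses to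
  the intensity \<open>r\<close>.\<close>

lemma nn_integral_ordered_arrivals:
  assumes [measurable]: "h \<in> borel_measurable (borel \<Otimes>\<^sub>M borel)"
  shows "(\<integral>\<^sup>+p. \<integral>\<^sup>+\<omega>. h (\<tau> (fst p) \<omega>, \<tau> (snd p) \<omega>) \<partial>M \<partial>count_space {(k, l). k < l}) =
    ennreal (r\<^sup>2) * (\<integral>\<^sup>+x. (\<integral>\<^sup>+y. h (x, y) * indicator {x..} y \<partial>lborel) * indicator {0..} x \<partial>lborel)"
proof -
  have [measurable]: "Measurable.pred (borel \<Otimes>\<^sub>M borel) (\<lambda>x :: real \<times> real. snd x \<in> {fst x..})"
    unfolding atLeast_iff by measurable
  let ?e = "\<lambda>k x. ennreal (erlang_density k r x)"
  have bij: "bij_betw (\<lambda>p. (fst p, fst p + Suc (snd p))) UNIV {(k, l). k < l}"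
    by (rule bij_betw_byWitness[where f' = "\<lambda>p. (fst p, snd p - fst p - 1)"]) auto
  have one: "(\<integral>\<^sup>+\<omega>. h (\<tau> k \<omega>, \<tau> (k + Suc j) \<omega>) \<partial>M) =
      (\<integral>\<^sup>+x. ?e k x * (\<integral>\<^sup>+u. ?e j u * h (x, x + u) \<partial>lborel) \<partial>lborel)" for k j
  proof -
    let ?D = "\<lambda>\<omega>. \<Sum>i\<in>{k<..k + Suc j}. waiting_time \<tau> i \<omega>"
    have "(\<integral>\<^sup>+\<omega>. h (\<tau> k \<omega>, \<tau> (k + Suc j) \<omega>) \<partial>M) = (\<integral>\<^sup>+\<omega>. (\<lambda>(x, u). h (x, x + u)) (\<tau> k \<omega>, ?D \<omega>) \<partial>M)"
      by (simp only: prod.case sum_waiting_time_eq')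
    also have "\<dots> = (\<integral>\<^sup>+\<omega>. \<integral>\<^sup>+\<omega>'. (\<lambda>(x, u). h (x, x + u)) (\<tau> k \<omega>, ?D \<omega>') \<partial>M \<partial>M)"
      by (rule nn_integral_indep_var[OF arrival_increment_indep]) measurable
    also have "\<dots> = (\<integral>\<^sup>+\<omega>. \<integral>\<^sup>+u. ?e j u * h (\<tau> k \<omega>, \<tau> k \<omega> + u) \<partial>lborel \<partial>M)"
      unfolding prod.case
      by (intro nn_integral_cong distributed_nn_integral[OF arrival_increment_distributed, symmetric])
        measurable
    also have "\<dots> = (\<integral>\<^sup>+x. ?e k x * (\<integral>\<^sup>+u. ?e j u * h (x, x + u) \<partial>lborel) \<partial>lborel)"
      by (rule distributed_nn_integral[OF arrival_distributed, symmetric]) measurable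
    finally show ?thesis .
  qed
  have shift: "(\<integral>\<^sup>+u. indicator {0..} u * h (x, x + u) \<partial>lborel) = (\<integral>\<^sup>+y. h (x, y) * indicator {x..} y \<partial>lborel)" for x
    by (subst nn_integral_real_affine[where c = 1 and t = x])
      (auto intro!: nn_integral_cong split: split_indicator)
  have "(\<integral>\<^sup>+p. \<integral>\<^sup>+\<omega>. h (\<tau> (fst p) \<omega>, \<tau> (snd p) \<omega>) \<partial>M \<partial>count_space {(k, l). k < l}) =
      (\<integral>\<^sup>+p. \<integral>\<^sup>+x. ?e (fst p) x * (\<integral>\<^sup>+u. ?e (snd p) u * h (x, x + u) \<partial>lborel) \<partial>lborel \<partial>count_space UNIV)"
    by (simp add: nn_integral_bij_count_space[OF bij, symmetric] one del: add_Suc_right)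
  also have "\<dots> = (\<integral>\<^sup>+k. \<integral>\<^sup>+j. \<integral>\<^sup>+x. ?e k x * (\<integral>\<^sup>+u. ?e j u * h (x, x + u) \<partial>lborel) \<partial>lborel
      \<partial>count_space UNIV \<partial>count_space UNIV)"
    by (subst nn_integral_fst_count_space[symmetric]) simp
  also have "\<dots> = (\<integral>\<^sup>+x. (\<Sum>k. ?e k x * (\<Sum>j. \<integral>\<^sup>+u. ?e j u * h (x, x + u) \<partial>lborel)) \<partial>lborel)"
    by (simp add: nn_integral_count_space_nat nn_integral_suminf[symmetric] ennreal_suminf_cmult)
  also have "\<dots> = (\<integral>\<^sup>+x. (\<Sum>k. ?e k x) * (\<integral>\<^sup>+u. (\<Sum>j. ?e j u) * h (x, x + u) \<partial>lborel) \<partial>lborel)"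
    by (simp add: nn_integral_suminf[symmetric] ennreal_suminf_multc)
  also have "\<dots> = (\<integral>\<^sup>+x. ennreal (r\<^sup>2) * ((\<integral>\<^sup>+y. h (x, y) * indicator {x..} y \<partial>lborel) * indicator {0..} x) \<partial>lborel)"
    unfolding suminf_erlang_density[OF r] shift[symmetric] using r
    by (intro nn_integral_cong)
      (simp add: mult.assoc nn_integral_cmult power2_eq_square ennreal_mult mult_ac)
  also have "\<dots> = ennreal (r\<^sup>2) * (\<integral>\<^sup>+x. (\<integral>\<^sup>+y. h (x, y) * indicator {x..} y \<partial>lborel) * indicator {0..} x \<partial>lborel)"
    by (rule nn_integral_cmult) measurable
  finally show ?thesis .
qed

text \<open>The second factorial moment measure of a Poisson process is a product measure.\<close>

lemma nn_integral_distinct_arrivals: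
  assumes [measurable]: "h \<in> borel_measurable (borel \<Otimes>\<^sub>M borel)"
  shows "(\<integral>\<^sup>+p. \<integral>\<^sup>+\<omega>. h (\<tau> (fst p) \<omega>, \<tau> (snd p) \<omega>) \<partial>M \<partial>count_space {(k, l). k \<noteq> l}) =
    ennreal (r\<^sup>2) * (\<integral>\<^sup>+x. (\<integral>\<^sup>+y. h (x, y) * indicator {0..} y \<partial>lborel) * indicator {0..} x \<partial>lborel)"
proof -
  have [measurable]: "Measurable.pred (borel \<Otimes>\<^sub>M borel) (\<lambda>x :: real \<times> real. snd x \<in> {fst x..})"
      "Measurable.pred (borel \<Otimes>\<^sub>M borel) (\<lambda>x :: real \<times> real. snd x \<in> {0..<fst x})"
    unfolding atLeast_iff atLeastLessThan_iff by measurable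
  let ?F = "\<lambda>p. \<integral>\<^sup>+\<omega>. h (\<tau> (fst p) \<omega>, \<tau> (snd p) \<omega>) \<partial>M"
  have bij: "bij_betw prod.swap {(k, l :: nat). k < l} {(k, l). l < k}"
    by (rule bij_betw_byWitness[where f' = prod.swap]) auto
  have "{(k, l :: nat). k \<noteq> l} = {(k, l). k < l} \<union> {(k, l). l < k}" by auto
  then have "(\<integral>\<^sup>+p. ?F p \<partial>count_space {(k, l). k \<noteq> l}) =
      (\<integral>\<^sup>+p. ?F p \<partial>count_space {(k, l). k < l}) + (\<integral>\<^sup>+p. ?F p \<partial>count_space {(k, l). l < k})"
    by (simp only:) (intro nn_integral_count_space_Un, auto)
  also have "(\<integral>\<^sup>+p. ?F p \<partial>count_space {(k, l). l < k}) =
      (\<integral>\<^sup>+p. \<integral>\<^sup>+\<omega>. (h \<circ> prod.swap) (\<tau> (fst p) \<omega>, \<tau> (snd p) \<omega>) \<partial>M \<partial>count_space {(k, l). k < l})"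
    by (simp add: nn_integral_bij_count_space[OF bij, symmetric])
  also have "\<dots> = ennreal (r\<^sup>2) * (\<integral>\<^sup>+y. (\<integral>\<^sup>+x. h (x, y) * indicator {y..} x \<partial>lborel) * indicator {0..} y \<partial>lborel)"
  proof -
    have "h \<circ> prod.swap \<in> borel_measurable (borel \<Otimes>\<^sub>M borel)"
      unfolding comp_def prod.swap_def by measurable
    from nn_integral_ordered_arrivals[OF this] show ?thesis by simp
  qed
  also have "(\<integral>\<^sup>+y. (\<integral>\<^sup>+x. h (x, y) * indicator {y..} x \<partial>lborel) * indicator {0..} y \<partial>lborel) =
      (\<integral>\<^sup>+y. (\<integral>\<^sup>+x. h (x, y) * (if 0 \<le> y \<and> y \<le> x then 1 else 0) \<partial>lborel) \<partial>lborel)"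
    by (subst nn_integral_multc[symmetric]) (auto intro!: nn_integral_cong split: split_indicator)
  also have "\<dots> = (\<integral>\<^sup>+x. (\<integral>\<^sup>+y. h (x, y) * (if 0 \<le> y \<and> y \<le> x then 1 else 0) \<partial>lborel) \<partial>lborel)"
    by (rule lborel_pair.Fubini') measurable
  also have "\<dots> = (\<integral>\<^sup>+x. (\<integral>\<^sup>+y. h (x, y) * (indicator {0..<x} y) \<partial>lborel) * indicator {0..} x \<partial>lborel)"
  proof (rule nn_integral_cong)
    fix x :: real
    \<comment> \<open>Exchanging the two arrivals produces the closed region
      \<open>y \<le> x\<close>. Dropping the diagonal as a null set makes the two orders tile the
      quadrant.\<close>
    have "AE y in lborel. h (x, y) * (if 0 \<le> y \<and> y \<le> x then 1 else 0) =
        h (x, y) * indicator {0..<x} y * indicator {0..} x"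
      using AE_lborel_singleton[of x] by eventually_elim (auto split: split_indicator)
    then have "(\<integral>\<^sup>+y. h (x, y) * (if 0 \<le> y \<and> y \<le> x then 1 else 0) \<partial>lborel) =
        (\<integral>\<^sup>+y. h (x, y) * indicator {0..<x} y * indicator {0..} x \<partial>lborel)"
      by (rule nn_integral_cong_AE)
    then show "(\<integral>\<^sup>+y. h (x, y) * (if 0 \<le> y \<and> y \<le> x then 1 else 0) \<partial>lborel) =
        (\<integral>\<^sup>+y. h (x, y) * indicator {0..<x} y \<partial>lborel) * indicator {0..} x"
      by (simp add: nn_integral_multc)
  qed
  finally have "(\<integral>\<^sup>+p. ?F p \<partial>count_space {(k, l). k \<noteq> l}) =
      ennreal (r\<^sup>2) * ((\<integral>\<^sup>+x. (\<integral>\<^sup>+y. h (x, y) * indicator {x..} y \<partial>lborel) * indicator {0..} x \<partial>lborel) +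
        (\<integral>\<^sup>+x. (\<integral>\<^sup>+y. h (x, y) * indicator {0..<x} y \<partial>lborel) * indicator {0..} x \<partial>lborel))"
    by (simp add: nn_integral_ordered_arrivals distrib_left)
  also have "(\<integral>\<^sup>+x. (\<integral>\<^sup>+y. h (x, y) * indicator {x..} y \<partial>lborel) * indicator {0..} x \<partial>lborel) +
        (\<integral>\<^sup>+x. (\<integral>\<^sup>+y. h (x, y) * indicator {0..<x} y \<partial>lborel) * indicator {0..} x \<partial>lborel) =
      (\<integral>\<^sup>+x. (\<integral>\<^sup>+y. h (x, y) * indicator {0..} y \<partial>lborel) * indicator {0..} x \<partial>lborel)"
    by (subst nn_integral_add[symmetric], measurable, intro nn_integral_cong)
      (auto simp: nn_integral_add[symmetric] distrib_right[symmetric] simp flip: distrib_left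
        intro!: nn_integral_cong split: split_indicator)
  finally show ?thesis .
qed

end

end

section \<open>Moments of the weighted Yule tree\<close>

text \<open>As a node is its path read upwards, \<open>suffix\<close> is the ancestor relation
  including the node itself, and \<open>strict_suffix\<close> is proper ancestry.\<close>

lemma strict_suffix_Cons_iff: "strict_suffix w (k # v) \<longleftrightarrow> suffix w v"
  by (auto simp: strict_suffix_def suffix_Cons dest: suffix_length_le)

lemma birth_time_cong:
  "(\<And>w. strict_suffix w v \<Longrightarrow> a w = a' w) \<Longrightarrow> birth_time a v = birth_time a' v"
  by (induction v) (auto simp: strict_suffix_Cons_iff dest: suffix_order.less_imp_le)

lemma measurable_birth_time:
  "(\<And>w. strict_suffix w v \<Longrightarrow> w \<in> B) \<Longrightarrow>
    (\<lambda>a. birth_time a v) \<in> borel_measurable (PiM B (\<lambda>_. PiM UNIV (\<lambda>_. borel)))"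
proof (induction v)
  case (Cons k v)
  have "v \<in> B" using Cons.prems by (simp add: strict_suffix_Cons_iff)
  have "(\<lambda>a. birth_time a v) \<in> borel_measurable (PiM B (\<lambda>_. PiM UNIV (\<lambda>_. borel)))"
    using Cons.prems by (intro Cons.IH) (auto simp: strict_suffix_Cons_iff dest: suffix_order.less_imp_le)
  moreover have "(\<lambda>a. a v k :: real) \<in> borel_measurable (PiM B (\<lambda>_. PiM UNIV (\<lambda>_. borel)))"
    using measurable_compose[OF measurable_component_singleton[OF \<open>v \<in> B\<close>]
        measurable_component_singleton[of k UNIV "\<lambda>_. borel"]] by simp
  ultimately show ?case by (simp add: borel_measurable_add)
qed simp

lemma nn_integral_count_space_Times:
  fixes f :: "'x \<times> 'y \<Rightarrow> ennreal"
  shows "(\<integral>\<^sup>+p. f p \<partial>count_space (A \<times> B)) = (\<integral>\<^sup>+x. \<integral>\<^sup>+y. f (x, y) \<partial>count_space B \<partial>count_space A)"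
proof -
  have "(\<integral>\<^sup>+p. f p \<partial>count_space (A \<times> B)) = (\<integral>\<^sup>+p. f p * indicator (A \<times> B) p \<partial>count_space UNIV)"
    by (simp add: nn_integral_count_space_indicator)
  also have "\<dots> = (\<integral>\<^sup>+x. \<integral>\<^sup>+y. f (x, y) * indicator (A \<times> B) (x, y) \<partial>count_space UNIV \<partial>count_space UNIV)"
    by (subst nn_integral_fst_count_space[symmetric]) simp
  also have "\<dots> = (\<integral>\<^sup>+x. (\<integral>\<^sup>+y. f (x, y) * indicator B y \<partial>count_space UNIV) * indicator A x \<partial>count_space UNIV)"
    by (intro nn_integral_cong) (auto simp: indicator_times split: split_indicator)
  finally show ?thesis by (simp add: nn_integral_count_space_indicator)
qed

text \<open>The volume of the simplex of \<open>n\<close> nonnegative waiting times with sum at most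
  \<open>y\<close>. It is the expected number of descendants in generation \<open>n\<close> that a
  node of weight 1 has by age \<open>y\<close>; for \<open>n = 0\<close> it indicates that the node
  is born.\<close>

definition arrival_volume :: "nat \<Rightarrow> real \<Rightarrow> ennreal" where
  "arrival_volume n y = (if 0 \<le> y then ennreal (y ^ n / fact n) else 0)"

lemma arrival_volume_measurable [measurable]: "arrival_volume n \<in> borel_measurable borel"
  unfolding arrival_volume_def by measurable

text \<open>The simplex is sliced by one of its coordinates.\<close>

lemma nn_integral_arrival_volume:
  "(\<integral>\<^sup>+s. arrival_volume n (y - s) * indicator {0..} s \<partial>lborel) = arrival_volume (Suc n) y"
proof (cases "0 \<le> y")
  case True
  have "(\<integral>\<^sup>+s. arrival_volume n (y - s) * indicator {0..} s \<partial>lborel) =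
      (\<integral>\<^sup>+s. ennreal ((y - s) ^ n / fact n) * indicator {0..y} s \<partial>lborel)"
    by (intro nn_integral_cong) (auto simp: arrival_volume_def split: split_indicator)
  also have "\<dots> = ennreal (- ((y - y) ^ Suc n / fact (Suc n)) - - ((y - 0) ^ Suc n / fact (Suc n)))"
  proof (rule nn_integral_FTC_Icc)
    fix x
    have "((\<lambda>s. - ((y - s) ^ Suc n / fact (Suc n))) has_real_derivative
        - (real (Suc n) * (y - x) ^ n * (0 - 1) / fact (Suc n))) (at x)"
      by (intro derivative_eq_intros | simp)+
    then show "((\<lambda>s. - ((y - s) ^ Suc n / fact (Suc n))) has_real_derivative (y - x) ^ n / fact n) (at x)"
      by (simp add: field_simps del: power_Suc of_nat_Suc)
  qed (use True in auto)
  finally show ?thesis using True by (simp add: arrival_volume_def)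
next
  case False
  then show ?thesis by (auto simp: arrival_volume_def intro!: nn_integral_zero' split: split_indicator)
qed

section \<open>Combinatorics of most recent common ancestors\<close>

primrec common_suffix :: "'a list \<Rightarrow> 'a list \<Rightarrow> 'a list" where
  "common_suffix [] v = []"
| "common_suffix (k # u) v = (if suffix (k # u) v then k # u else common_suffix u v)"

lemma suffix_common_suffix: "suffix (common_suffix u v) u" "suffix (common_suffix u v) v"
  by (induction u) (auto simp: suffix_Cons)

text \<open>Together with \<open>suffix_common_suffix\<close> this characterises
  \<open>common_suffix\<close> as the meet in the ancestor order; symmetry, hidden by the recursion
  on the first argument, follows from it.\<close>

lemma common_suffix_greatest: "suffix w u \<Longrightarrow> suffix w v \<Longrightarrow> suffix w (common_suffix u v)"
  by (induction u) (auto simp: suffix_Cons)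

lemma common_suffix_commute: "common_suffix u v = common_suffix v u"
  by (intro suffix_order.antisym common_suffix_greatest suffix_common_suffix)

text \<open>The pairs of nodes that lie \<open>a\<close> and \<open>b\<close> generations below their most recent common ancestor.\<close>

definition kinship :: "nat \<Rightarrow> nat \<Rightarrow> (node \<times> node) set" where
  "kinship a b = {(u, v). length u = length (common_suffix u v) + a \<and>
     length v = length (common_suffix u v) + b}"

lemma kinship_swap: "(u, v) \<in> kinship a b \<longleftrightarrow> (v, u) \<in> kinship b a"
  by (auto simp: kinship_def common_suffix_commute)

lemma kinship_exhaust: obtains a b where "(u, v) \<in> kinship a b"
proof -
  have "length (common_suffix u v) \<le> length u" "length (common_suffix u v) \<le> length v"
    using suffix_common_suffix suffix_length_le by blast+
  then show ?thesis
    by (intro that[of "length u - length (common_suffix u v)" "length v - length (common_suffix u v)"])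
      (simp add: kinship_def)
qed

lemma kinship_unique: "(u, v) \<in> kinship a b \<Longrightarrow> (u, v) \<in> kinship a' b' \<Longrightarrow> a = a' \<and> b = b'"
  by (auto simp: kinship_def)

lemma kinship_0: "(u, v) \<in> kinship 0 b \<longleftrightarrow> suffix u v \<and> length v = length u + b"
proof -
  have "common_suffix u v = u" if "length u = length (common_suffix u v)"
  proof -
    obtain zs where "u = zs @ common_suffix u v"
      using suffix_common_suffix(1)[of u v] by (auto simp: suffix_def)
    then have "zs = []" using that by (metis length_0_conv length_append add_cancel_left_left)
    with \<open>u = zs @ common_suffix u v\<close> show ?thesis by simp
  qed
  moreover have "common_suffix u v = u" if "suffix u v"
    using that by (cases u) auto
  ultimately show ?thesis
    using suffix_common_suffix(2)[of u v] by (auto simp: kinship_def)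
qed

text \<open>Replacing \<open>u'\<close> by a child keeps the common ancestor with \<open>v\<close>,
  unless the child itself is \<open>v\<close> or an ancestor of \<open>v\<close>. Moments of pairs
  are computed along this recursion.\<close>

lemma kinship_Suc: "(u, v) \<in> kinship (Suc a) b \<longleftrightarrow>
    (\<exists>k u'. u = k # u' \<and> \<not> suffix u v \<and> (u', v) \<in> kinship a b)"
proof (cases u)
  case (Cons k u')
  have "length (common_suffix u' v) \<le> length u'"
    using suffix_common_suffix(1) by (rule suffix_length_le)
  then show ?thesis using Cons by (auto simp: kinship_def)
qed (auto simp: kinship_def)

lemma not_suffix_kinship: "(u, v) \<in> kinship (Suc a) b \<Longrightarrow> \<not> suffix u v"
  by (auto simp: kinship_Suc)

text \<open>Independence of random elements of possibly different types, for which \<open>indep_var\<close> is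
  not available.\<close>

definition (in prob_space) indep_elements ::
  "'x measure \<Rightarrow> ('a \<Rightarrow> 'x) \<Rightarrow> 'y measure \<Rightarrow> ('a \<Rightarrow> 'y) \<Rightarrow> bool" where
  "indep_elements N Y N' Z \<longleftrightarrow> Y \<in> M \<rightarrow>\<^sub>M N \<and> Z \<in> M \<rightarrow>\<^sub>M N' \<and>
    (\<forall>h\<in>borel_measurable (N \<Otimes>\<^sub>M N').
      (\<integral>\<^sup>+\<omega>. h (Y \<omega>, Z \<omega>) \<partial>M) = (\<integral>\<^sup>+\<omega>. \<integral>\<^sup>+\<omega>'. h (Y \<omega>, Z \<omega>') \<partial>M \<partial>M))"

lemma kinship_1_1: "(u, v) \<in> kinship 1 1 \<longleftrightarrow> (\<exists>k l w. u = k # w \<and> v = l # w \<and> k \<noteq> l)"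
proof
  assume "(u, v) \<in> kinship 1 1"
  then obtain k w where u: "u = k # w" "\<not> suffix u v" "suffix w v" "length v = length w + 1"
    by (auto simp: kinship_Suc kinship_0)
  then obtain zs where "v = zs @ w" "length zs = 1" by (auto simp: suffix_def)
  then obtain l where "v = l # w" by (auto simp: length_Suc_conv)
  with u show "\<exists>k l w. u = k # w \<and> v = l # w \<and> k \<noteq> l" by auto
next
  assume "\<exists>k l w. u = k # w \<and> v = l # w \<and> k \<noteq> l"
  then show "(u, v) \<in> kinship 1 1"
    by (auto simp: kinship_Suc kinship_0 suffix_Cons strict_suffix_def dest: suffix_ConsD')
qed

section \<open>Poisson reproduction inside the tree\<close>

context weighted_yule_tree
begin

definition birth :: "node \<Rightarrow> 'a \<Rightarrow> real" where
  "birth v \<omega> = birth_time (\<lambda>w k. age w k \<omega>) v"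

lemma birth_Nil [simp]: "birth [] \<omega> = 0"
  and birth_Cons: "birth (k # v) \<omega> = birth v \<omega> + age v k \<omega>"
  by (simp_all add: birth_def)

lemma mem_random_tree: "v \<in> random_tree age \<omega> t \<longleftrightarrow> birth v \<omega> \<le> t"
  by (simp add: random_tree_def tree_def birth_def)

lemma weight_pos': "0 < weight \<rho> v"
  using weight_pos by (simp add: weight_def)

lemma age_measurable [measurable]: "age v k \<in> borel_measurable M"
  using arrival_measurable[OF weight_pos' children] .

lemma birth_measurable [measurable]: "birth v \<in> borel_measurable M"
  by (induction v) (simp_all add: birth_Cons[abs_def] birth_def[of "[]", abs_def])

lemma indep_elements_ages:
  assumes g [measurable]: "g \<in> PiM B (\<lambda>_. PiM UNIV (\<lambda>_. borel)) \<rightarrow>\<^sub>M N" and w: "w \<notin> B"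
  shows "indep_elements N (\<lambda>\<omega>. g (restrict (\<lambda>v k. age v k \<omega>) B)) (PiM UNIV (\<lambda>_. borel)) (\<lambda>\<omega> k. age w k \<omega>)"
proof -
  note ind = indep_var_restrict[OF nodes_indep, of B "{w}"]
  have "(\<lambda>\<omega>. restrict (\<lambda>v k. age v k \<omega>) B) \<in> M \<rightarrow>\<^sub>M PiM B (\<lambda>_. PiM UNIV (\<lambda>_. borel))"
    using ind w by (auto dest!: indep_var_rv1)
  have w' [measurable]: "(\<lambda>f. f w) \<in> PiM {w} (\<lambda>_. PiM UNIV (\<lambda>_. borel)) \<rightarrow>\<^sub>M PiM UNIV (\<lambda>_. borel)"
    by (intro measurable_component_singleton) simp
  show ?thesis
    unfolding indep_elements_def
  proof (intro conjI ballI)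
    fix h :: "'b \<times> (nat \<Rightarrow> real) \<Rightarrow> ennreal"
    assume [measurable]: "h \<in> borel_measurable (N \<Otimes>\<^sub>M PiM UNIV (\<lambda>_. borel))"
    have "(\<lambda>p. h (g (fst p), snd p w)) \<in>
        borel_measurable (PiM B (\<lambda>_. PiM UNIV (\<lambda>_. borel)) \<Otimes>\<^sub>M PiM {w} (\<lambda>_. PiM UNIV (\<lambda>_. borel)))"
      by (rule measurable_compose[of "\<lambda>p. (g (fst p), snd p w)"]) measurable
    from nn_integral_indep_var[OF ind this] w
    show "(\<integral>\<^sup>+\<omega>. h (g (restrict (\<lambda>v k. age v k \<omega>) B), \<lambda>k. age w k \<omega>) \<partial>M) =
        (\<integral>\<^sup>+\<omega>. \<integral>\<^sup>+\<omega>'. h (g (restrict (\<lambda>v k. age v k \<omega>) B), \<lambda>k. age w k \<omega>') \<partial>M \<partial>M)"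
      by simp
  next
    show "(\<lambda>\<omega>. g (restrict (\<lambda>v k. age v k \<omega>) B)) \<in> M \<rightarrow>\<^sub>M N"
      by (rule measurable_compose[OF _ g]) fact
    show "(\<lambda>\<omega> k. age w k \<omega>) \<in> M \<rightarrow>\<^sub>M PiM UNIV (\<lambda>_. borel)"
      using nodes_indep by (simp add: indep_vars_def)
  qed
qed

text \<open>A birth time reads the reproduction of proper ancestors only. If \<open>w\<close> is no
  proper ancestor of \<open>u\<close> or \<open>v\<close>, hiding the ages at \<open>w\<close>
  changes neither birth time, and the reproduction of different nodes is independent.\<close>

lemma indep_elements_births:
  assumes "\<not> strict_suffix w u" "\<not> strict_suffix w v"
  shows "indep_elements (borel \<Otimes>\<^sub>M borel) (\<lambda>\<omega>. (birth u \<omega>, birth v \<omega>)) (PiM UNIV (\<lambda>_. borel)) (\<lambda>\<omega> k. age w k \<omega>)"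
proof -
  let ?B = "- {w}"
  have [measurable]: "(\<lambda>a. birth_time a u) \<in> borel_measurable (PiM ?B (\<lambda>_. PiM UNIV (\<lambda>_. borel)))"
      "(\<lambda>a. birth_time a v) \<in> borel_measurable (PiM ?B (\<lambda>_. PiM UNIV (\<lambda>_. borel)))"
    using assms by (auto intro!: measurable_birth_time)
  have "birth_time (restrict (\<lambda>v k. age v k \<omega>) ?B) x = birth x \<omega>" if "x = u \<or> x = v" for x \<omega>
    unfolding birth_def using assms that by (intro birth_time_cong) auto
  then show ?thesis
    using indep_elements_ages[of "\<lambda>a. (birth_time a u, birth_time a v)" ?B "borel \<Otimes>\<^sub>M borel" w] by simp
qed

text \<open>Given \<open>Y\<close>, the children of \<open>w\<close> still arrive as a Poisson
  process, so Campbell's formula applies inside the expectation.\<close>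

lemma nn_integral_children:
  assumes ind: "indep_elements N Y (PiM UNIV (\<lambda>_. borel)) (\<lambda>\<omega> k. age w k \<omega>)"
    and h [measurable]: "h \<in> borel_measurable (N \<Otimes>\<^sub>M borel)"
  shows "(\<integral>\<^sup>+k. \<integral>\<^sup>+\<omega>. h (Y \<omega>, age w k \<omega>) \<partial>M \<partial>count_space UNIV) =
    ennreal (weight \<rho> w) * (\<integral>\<^sup>+s. (\<integral>\<^sup>+\<omega>. h (Y \<omega>, s) \<partial>M) * indicator {0..} s \<partial>lborel)"
proof -
  interpret P: pair_sigma_finite M "lborel :: real measure" ..
  have Ym [measurable]: "Y \<in> M \<rightarrow>\<^sub>M N" using ind by (simp add: indep_elements_def)
  have "(\<integral>\<^sup>+\<omega>. h (Y \<omega>, age w k \<omega>) \<partial>M) = (\<integral>\<^sup>+\<omega>. \<integral>\<^sup>+\<omega>'. h (Y \<omega>, age w k \<omega>') \<partial>M \<partial>M)" for k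
    proof -
    have "(\<lambda>(y, f). h (y, f k)) \<in> borel_measurable (N \<Otimes>\<^sub>M PiM UNIV (\<lambda>_. borel))" by measurable
    with ind show ?thesis unfolding indep_elements_def by fastforce
  qed
  then have "(\<integral>\<^sup>+k. \<integral>\<^sup>+\<omega>. h (Y \<omega>, age w k \<omega>) \<partial>M \<partial>count_space UNIV) =
      (\<integral>\<^sup>+\<omega>. \<integral>\<^sup>+k. \<integral>\<^sup>+\<omega>'. h (Y \<omega>, age w k \<omega>') \<partial>M \<partial>count_space UNIV \<partial>M)"
    by (simp add: nn_integral_count_space_nn_integral)
  also have "\<dots> = (\<integral>\<^sup>+\<omega>. ennreal (weight \<rho> w) * (\<integral>\<^sup>+s. h (Y \<omega>, s) * indicator {0..} s \<partial>lborel) \<partial>M)"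
  proof (intro nn_integral_cong)
    fix \<omega> assume "\<omega> \<in> space M"
    then have [measurable]: "Y \<omega> \<in> space N" by (rule measurable_space[OF Ym])
    then show "(\<integral>\<^sup>+k. \<integral>\<^sup>+\<omega>'. h (Y \<omega>, age w k \<omega>') \<partial>M \<partial>count_space UNIV) =
        ennreal (weight \<rho> w) * (\<integral>\<^sup>+s. h (Y \<omega>, s) * indicator {0..} s \<partial>lborel)"
      by (intro nn_integral_arrivals[OF weight_pos' children]) measurable
  qed
  also have "\<dots> = ennreal (weight \<rho> w) * (\<integral>\<^sup>+\<omega>. (\<integral>\<^sup>+s. h (Y \<omega>, s) * indicator {0..} s \<partial>lborel) \<partial>M)"
    by (rule nn_integral_cmult) measurable
  also have "(\<integral>\<^sup>+\<omega>. (\<integral>\<^sup>+s. h (Y \<omega>, s) * indicator {0..} s \<partial>lborel) \<partial>M) =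
      (\<integral>\<^sup>+s. (\<integral>\<^sup>+\<omega>. h (Y \<omega>, s) * indicator {0..} s \<partial>M) \<partial>lborel)"
    by (rule P.Fubini'[symmetric]) measurable
  also have "\<dots> = (\<integral>\<^sup>+s. (\<integral>\<^sup>+\<omega>. h (Y \<omega>, s) \<partial>M) * indicator {0..} s \<partial>lborel)"
    by (intro nn_integral_cong nn_integral_multc) measurable
  finally show ?thesis .
qed

text \<open>The same conditioning for two different children, now with the product form of the
  second factorial moment.\<close>

lemma nn_integral_child_pairs:
  assumes ind: "indep_elements N Y (PiM UNIV (\<lambda>_. borel)) (\<lambda>\<omega> k. age w k \<omega>)"
    and h [measurable]: "h \<in> borel_measurable (N \<Otimes>\<^sub>M (borel \<Otimes>\<^sub>M borel))"
  shows "(\<integral>\<^sup>+p. \<integral>\<^sup>+\<omega>. h (Y \<omega>, age w (fst p) \<omega>, age w (snd p) \<omega>) \<partial>M \<partial>count_space {(k, l). k \<noteq> l}) =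
    ennreal ((weight \<rho> w)\<^sup>2) * (\<integral>\<^sup>+\<omega>. \<integral>\<^sup>+x. (\<integral>\<^sup>+y. h (Y \<omega>, x, y) * indicator {0..} y \<partial>lborel) * indicator {0..} x \<partial>lborel \<partial>M)"
proof -
  have Ym [measurable]: "Y \<in> M \<rightarrow>\<^sub>M N" using ind by (simp add: indep_elements_def)
  have "(\<integral>\<^sup>+\<omega>. h (Y \<omega>, age w k \<omega>, age w l \<omega>) \<partial>M) = (\<integral>\<^sup>+\<omega>. \<integral>\<^sup>+\<omega>'. h (Y \<omega>, age w k \<omega>', age w l \<omega>') \<partial>M \<partial>M)" for k l
    proof -
    have "(\<lambda>(y, f). h (y, f k, f l)) \<in> borel_measurable (N \<Otimes>\<^sub>M PiM UNIV (\<lambda>_. borel))" by measurable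
    with ind show ?thesis unfolding indep_elements_def by fastforce
  qed
  then have "(\<integral>\<^sup>+p. \<integral>\<^sup>+\<omega>. h (Y \<omega>, age w (fst p) \<omega>, age w (snd p) \<omega>) \<partial>M \<partial>count_space {(k, l). k \<noteq> l}) =
      (\<integral>\<^sup>+\<omega>. \<integral>\<^sup>+p. \<integral>\<^sup>+\<omega>'. h (Y \<omega>, age w (fst p) \<omega>', age w (snd p) \<omega>') \<partial>M \<partial>count_space {(k, l). k \<noteq> l} \<partial>M)"
    by (simp add: nn_integral_count_space_nn_integral)
  also have "\<dots> = (\<integral>\<^sup>+\<omega>. ennreal ((weight \<rho> w)\<^sup>2) *
      (\<integral>\<^sup>+x. (\<integral>\<^sup>+y. h (Y \<omega>, x, y) * indicator {0..} y \<partial>lborel) * indicator {0..} x \<partial>lborel) \<partial>M)"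
  proof (intro nn_integral_cong)
    fix \<omega> assume "\<omega> \<in> space M"
    then have [measurable]: "Y \<omega> \<in> space N" by (rule measurable_space[OF Ym])
    have "(\<lambda>q. h (Y \<omega>, q)) \<in> borel_measurable (borel \<Otimes>\<^sub>M borel)" by measurable
    from nn_integral_distinct_arrivals[OF weight_pos' children this]
    show "(\<integral>\<^sup>+p. \<integral>\<^sup>+\<omega>'. h (Y \<omega>, age w (fst p) \<omega>', age w (snd p) \<omega>') \<partial>M \<partial>count_space {(k, l). k \<noteq> l}) =
        ennreal ((weight \<rho> w)\<^sup>2) *
        (\<integral>\<^sup>+x. (\<integral>\<^sup>+y. h (Y \<omega>, x, y) * indicator {0..} y \<partial>lborel) * indicator {0..} x \<partial>lborel)" .
  qed
  also have "\<dots> = ennreal ((weight \<rho> w)\<^sup>2) * (\<integral>\<^sup>+\<omega>. \<integral>\<^sup>+x. (\<integral>\<^sup>+y. h (Y \<omega>, x, y) * indicator {0..} y \<partial>lborel) * indicator {0..} x \<partial>lborel \<partial>M)"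
    by (rule nn_integral_cmult) measurable
  finally show ?thesis .
qed

subsection \<open>First moments\<close>

definition generation_moment :: "nat \<Rightarrow> (real \<Rightarrow> ennreal) \<Rightarrow> ennreal" where
  "generation_moment n f =
    (\<integral>\<^sup>+v. ennreal (weight \<rho> v) * (\<integral>\<^sup>+\<omega>. f (birth v \<omega>) \<partial>M) \<partial>count_space {v. length v = n})"

lemma generation_moment_0: "generation_moment 0 f = ennreal \<rho> * f 0"
  by (simp add: generation_moment_def nn_integral_count_space_finite emeasure_space_1 weight_def)

text \<open>The weight of a node is its birth rate. Summing over the children of \<open>v\<close>
  therefore gives one integration over the waiting time and the weight of \<open>v\<close> as a
  factor, while the children themselves all have weight 1.\<close>

lemma generation_moment_Suc:
  assumes [measurable]: "f \<in> borel_measurable borel"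
  shows "generation_moment (Suc n) f =
    generation_moment n (\<lambda>x. \<integral>\<^sup>+s. f (x + s) * indicator {0..} s \<partial>lborel)"
proof -
  interpret P: pair_sigma_finite M "lborel :: real measure" ..
  have bij: "bij_betw (\<lambda>p. snd p # fst p) ({v :: node. length v = n} \<times> UNIV) {v. length v = Suc n}"
    by (rule bij_betw_byWitness[where f' = "\<lambda>v. (tl v, hd v)"])
      (auto simp: length_Suc_conv)
  have "(\<integral>\<^sup>+k. \<integral>\<^sup>+\<omega>. f (birth (k # v) \<omega>) \<partial>M \<partial>count_space UNIV) =
      ennreal (weight \<rho> v) * (\<integral>\<^sup>+\<omega>. \<integral>\<^sup>+s. f (birth v \<omega> + s) * indicator {0..} s \<partial>lborel \<partial>M)" for v
  proof -
    have "(\<integral>\<^sup>+k. \<integral>\<^sup>+\<omega>. f (birth (k # v) \<omega>) \<partial>M \<partial>count_space UNIV) =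
        ennreal (weight \<rho> v) * (\<integral>\<^sup>+s. (\<integral>\<^sup>+\<omega>. f (birth v \<omega> + s) \<partial>M) * indicator {0..} s \<partial>lborel)"
      using nn_integral_children[OF indep_elements_births[of v v v], of "\<lambda>(p, s). f (fst p + s)"]
      by (simp add: birth_Cons)
    also have "(\<integral>\<^sup>+s. (\<integral>\<^sup>+\<omega>. f (birth v \<omega> + s) \<partial>M) * indicator {0..} s \<partial>lborel) =
        (\<integral>\<^sup>+s. (\<integral>\<^sup>+\<omega>. f (birth v \<omega> + s) * indicator {0..} s \<partial>M) \<partial>lborel)"
      by (intro nn_integral_cong nn_integral_multc[symmetric]) measurable
    also have "\<dots> = (\<integral>\<^sup>+\<omega>. \<integral>\<^sup>+s. f (birth v \<omega> + s) * indicator {0..} s \<partial>lborel \<partial>M)"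
      by (rule P.Fubini') measurable
    finally show ?thesis .
  qed
  then show ?thesis
    unfolding generation_moment_def nn_integral_bij_count_space[OF bij, symmetric]
    by (subst nn_integral_count_space_Times) (simp_all add: weight_def)
qed

lemma nn_integral_generations:
  "(\<integral>\<^sup>+v. F v \<partial>count_space UNIV) = (\<Sum>n. \<integral>\<^sup>+v. F v \<partial>count_space {v :: node. length v = n})"
proof -
  have "(\<Sum>n. \<integral>\<^sup>+v. F v \<partial>count_space {v :: node. length v = n}) =
      (\<Sum>n. \<integral>\<^sup>+v. F v * indicator {v :: node. length v = n} v \<partial>count_space UNIV)"
    by (simp add: nn_integral_count_space_indicator)
  also have "\<dots> = (\<integral>\<^sup>+v. (\<Sum>n. F v * indicator {v :: node. length v = n} v) \<partial>count_space UNIV)"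
    by (rule nn_integral_suminf[symmetric]) simp
  also have "\<dots> = (\<integral>\<^sup>+v. F v \<partial>count_space UNIV)"
  proof (intro nn_integral_cong)
    fix v
    have "(\<Sum>n. F v * indicator {v :: node. length v = n} v) = (\<Sum>n\<in>{length v}. F v * indicator {v :: node. length v = n} v)"
      by (rule suminf_finite) auto
    then show "(\<Sum>n. F v * indicator {v :: node. length v = n} v) = F v" by simp
  qed
  finally show ?thesis by simp
qed

text \<open>A general \<open>m\<close> lets the induction absorb one waiting time per generation;
  the case \<open>m = 0\<close> counts births up to time \<open>t\<close>.\<close>

lemma generation_moment_arrival_volume:
  "generation_moment n (\<lambda>x. arrival_volume m (t - x)) = ennreal \<rho> * arrival_volume (m + n) t"
proof (induction n arbitrary: m)
  case (Suc n)
  then show ?case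
    by (subst generation_moment_Suc)
      (simp_all add: diff_diff_add[symmetric] nn_integral_arrival_volume)
qed (simp add: generation_moment_0)

lemma generation_moment_exp:
  assumes c: "0 < c"
  shows "generation_moment n (\<lambda>x. ennreal (exp (- (c * x)))) = ennreal (\<rho> * (1 / c) ^ n)"
proof (induction n)
  case 0
  then show ?case by (simp add: generation_moment_0)
next
  case (Suc n)
  have "(\<integral>\<^sup>+s. ennreal (exp (- (c * (x + s)))) * indicator {0..} s \<partial>lborel) =
      ennreal (1 / c) * ennreal (exp (- (c * x)))" for x
  proof -
    have "(\<integral>\<^sup>+s. ennreal (exp (- (c * (x + s)))) * indicator {0..} s \<partial>lborel) =
        ennreal (0 - (- exp (- (c * (x + 0))) / c))"
    proof (rule nn_integral_FTC_atLeast)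
      fix s
      show "((\<lambda>s. - exp (- (c * (x + s))) / c) has_real_derivative exp (- (c * (x + s)))) (at s)"
        using c by (auto intro!: derivative_eq_intros)
      show "((\<lambda>s. - exp (- (c * (x + s))) / c) \<longlongrightarrow> 0) at_top"
        using c by real_asymp
    qed auto
    then show ?thesis using c by (simp flip: ennreal_mult)
  qed
  then have "generation_moment (Suc n) (\<lambda>x. ennreal (exp (- (c * x)))) =
      ennreal (1 / c) * generation_moment n (\<lambda>x. ennreal (exp (- (c * x))))"
    by (subst generation_moment_Suc)
      (simp_all add: generation_moment_def nn_integral_cmult mult.left_commute[of _ "ennreal (1 / c)"])
  then show ?case using c weight_pos by (simp add: Suc flip: ennreal_mult)
qed

text \<open>Each generation contributes a factor \<open>1 / c\<close>, the Laplace transform of a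
  unit intensity, so the sum is a geometric series. The condition \<open>1 < c\<close> says that the
  discount beats the growth rate 1 of the tree.\<close>

lemma sum_exp_birth:
  assumes c: "1 < c"
  shows "(\<integral>\<^sup>+v. ennreal (weight \<rho> v) * (\<integral>\<^sup>+\<omega>. ennreal (exp (- (c * birth v \<omega>))) \<partial>M) \<partial>count_space UNIV) =
    ennreal (\<rho> * c / (c - 1))"
proof -
  have "(\<lambda>n. \<rho> * (1 / c) ^ n) sums (\<rho> * (1 / (1 - 1 / c)))"
    using c by (intro sums_mult geometric_sums) auto
  also have "\<rho> * (1 / (1 - 1 / c)) = \<rho> * c / (c - 1)"
    using c by (simp add: field_simps)
  finally have "(\<lambda>n. \<rho> * (1 / c) ^ n) sums (\<rho> * c / (c - 1))" .
  moreover have "(\<integral>\<^sup>+v. ennreal (weight \<rho> v) * (\<integral>\<^sup>+\<omega>. ennreal (exp (- (c * birth v \<omega>))) \<partial>M)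
      \<partial>count_space {v. length v = n}) = ennreal (\<rho> * (1 / c) ^ n)" for n
    using generation_moment_exp[of c n] c by (simp add: generation_moment_def)
  ultimately show ?thesis
    unfolding nn_integral_generations using c weight_pos
    by (simp only:) (subst suminf_ennreal2; simp add: sums_iff)
qed

lemma sum_birth_le:
  "(\<integral>\<^sup>+v. ennreal (weight \<rho> v) * emeasure M {\<omega> \<in> space M. birth v \<omega> \<le> t} \<partial>count_space {v. length v = n}) =
    ennreal \<rho> * arrival_volume n t"
proof -
  have "arrival_volume 0 (t - birth v \<omega>) = indicator {\<omega> \<in> space M. birth v \<omega> \<le> t} \<omega>" if "\<omega> \<in> space M" for v \<omega>
    using that by (auto simp: arrival_volume_def split: split_indicator)
  then have "(\<integral>\<^sup>+\<omega>. arrival_volume 0 (t - birth v \<omega>) \<partial>M) = emeasure M {\<omega> \<in> space M. birth v \<omega> \<le> t}" for v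
    by (simp cong: nn_integral_cong)
  then show ?thesis
    using generation_moment_arrival_volume[of n 0 t] by (simp add: generation_moment_def)
qed

subsection \<open>Second moments\<close>

definition pair_moment :: "nat \<Rightarrow> nat \<Rightarrow> real \<Rightarrow> real \<Rightarrow> ennreal" where
  "pair_moment a b t r = (\<integral>\<^sup>+p. ennreal (weight \<rho> (fst p) * weight \<rho> (snd p)) *
     (\<integral>\<^sup>+\<omega>. indicator {..t} (birth (fst p) \<omega>) * indicator {..r} (birth (snd p) \<omega>) \<partial>M)
     \<partial>count_space (kinship a b))"

text \<open>What \<open>pair_moment\<close> becomes when the two lines below the common ancestor
  \<open>w\<close> are treated as independent. The weight of \<open>w\<close> is squared in all
  cases: each line either starts with a birth, at a rate equal to the weight, or ends at
  \<open>w\<close> and carries the weight of \<open>w\<close> itself.\<close>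

definition ancestor_moment :: "nat \<Rightarrow> nat \<Rightarrow> real \<Rightarrow> real \<Rightarrow> ennreal" where
  "ancestor_moment a b t r = (\<integral>\<^sup>+w. ennreal ((weight \<rho> w)\<^sup>2) *
     (\<integral>\<^sup>+\<omega>. arrival_volume a (t - birth w \<omega>) * arrival_volume b (r - birth w \<omega>) \<partial>M) \<partial>count_space UNIV)"

lemma pair_moment_commute: "pair_moment a b t r = pair_moment b a r t"
proof -
  have bij: "bij_betw (\<lambda>p. (snd p, fst p)) (kinship a b) (kinship b a)"
    by (rule bij_betw_byWitness[where f' = "\<lambda>p. (snd p, fst p)"]) (auto simp: kinship_swap)
  show ?thesis
    unfolding pair_moment_def nn_integral_bij_count_space[OF bij, symmetric] fst_conv snd_conv
    by (simp only: mult.commute)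
qed

lemma ancestor_moment_commute: "ancestor_moment a b t r = ancestor_moment b a r t"
  by (simp add: ancestor_moment_def mult.commute)

text \<open>The last edge on the side of \<open>u\<close> is removed. The excluded case is
  \<open>a = 0 < b\<close>: there \<open>u\<close> is a proper ancestor of \<open>v\<close>, a child
  of \<open>u\<close> may lie on the path to \<open>v\<close>, and its age is tied to the birth of
  \<open>v\<close>. Otherwise the ages at \<open>u\<close> are independent of both births and one
  waiting time can be integrated out.\<close>

lemma pair_moment_Suc:
  assumes ab: "0 < a \<or> b = 0"
  shows "pair_moment (Suc a) b t r = (\<integral>\<^sup>+s. pair_moment a b (t - s) r * indicator {0..} s \<partial>lborel)"
proof -
  have [measurable]: "Measurable.pred (borel \<Otimes>\<^sub>M M) (\<lambda>x. birth u (snd x) \<in> {..t - fst x})" for u t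
    unfolding atMost_iff by measurable
  have ns: "\<not> suffix (k # u) v" if "(u, v) \<in> kinship a b" for k u v
  proof (cases a)
    case 0
    then have "length v = length u" using ab that by (simp add: kinship_0)
    then show ?thesis using suffix_length_le by fastforce
  next
    case (Suc a')
    then show ?thesis using that not_suffix_kinship suffix_ConsD by metis
  qed
  have bij: "bij_betw (\<lambda>p. (snd p # fst (fst p), snd (fst p))) (kinship a b \<times> UNIV) (kinship (Suc a) b)"
    by (rule bij_betw_byWitness[where f' = "\<lambda>p. ((tl (fst p), snd p), hd (fst p))"])
      (auto simp: kinship_Suc ns)
  let ?E = "\<lambda>u v t r. \<integral>\<^sup>+\<omega>. indicator {..t} (birth u \<omega>) * indicator {..r} (birth v \<omega>) \<partial>M"
  have step: "(\<integral>\<^sup>+k. ?E (k # u) v t r \<partial>count_space UNIV) =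
      ennreal (weight \<rho> u) * (\<integral>\<^sup>+s. ?E u v (t - s) r * indicator {0..} s \<partial>lborel)"
    if uv: "(u, v) \<in> kinship a b" for u v
  proof -
    \<comment> \<open>Otherwise some child of \<open>u\<close> would be \<open>v\<close> or an
      ancestor of \<open>v\<close>, against \<open>ns\<close>. So the birth of \<open>v\<close> does
      not read the ages at \<open>u\<close>.\<close>
    have "\<not> strict_suffix u v"
    proof
      assume "strict_suffix u v"
      then obtain zs where "v = zs @ u" "zs \<noteq> []" by (auto simp: strict_suffix_def suffix_def)
      then have "v = butlast zs @ last zs # u" by simp
      then have "suffix (last zs # u) v" by (auto simp: suffix_def)
      then show False using ns[OF uv] by blast
    qed
    from nn_integral_children[OF indep_elements_births[OF _ this, of u],
        of "\<lambda>(q, s). indicator {..t} (fst q + s) * indicator {..r} (snd q)"]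
    have "(\<integral>\<^sup>+k. ?E (k # u) v t r \<partial>count_space UNIV) =
        ennreal (weight \<rho> u) * (\<integral>\<^sup>+s. (\<integral>\<^sup>+\<omega>. indicator {..t} (birth u \<omega> + s) * indicator {..r} (birth v \<omega>) \<partial>M) *
          indicator {0..} s \<partial>lborel)"
      by (simp add: birth_Cons)
    moreover have "(indicator {..t} (x + s) :: ennreal) = indicator {..t - s} x" for x s
      by (auto split: split_indicator)
    ultimately show ?thesis by (simp only:)
  qed
  have "pair_moment (Suc a) b t r =
      (\<integral>\<^sup>+p. ennreal (weight \<rho> (snd p)) * (\<integral>\<^sup>+k. ?E (k # fst p) (snd p) t r \<partial>count_space UNIV) \<partial>count_space (kinship a b))"
    unfolding pair_moment_def nn_integral_bij_count_space[OF bij, symmetric]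
    by (subst nn_integral_count_space_Times) (simp add: weight_def nn_integral_cmult)
  also have "\<dots> = (\<integral>\<^sup>+p. \<integral>\<^sup>+s. ennreal (weight \<rho> (fst p) * weight \<rho> (snd p)) * ?E (fst p) (snd p) (t - s) r *
      indicator {0..} s \<partial>lborel \<partial>count_space (kinship a b))"
  proof (intro nn_integral_cong)
    fix p assume p: "p \<in> space (count_space (kinship a b))"
    let ?u = "fst p" and ?v = "snd p"
    have "(\<integral>\<^sup>+s. ennreal (weight \<rho> ?u * weight \<rho> ?v) * ?E ?u ?v (t - s) r * indicator {0..} s \<partial>lborel) =
        ennreal (weight \<rho> ?u * weight \<rho> ?v) * (\<integral>\<^sup>+s. ?E ?u ?v (t - s) r * indicator {0..} s \<partial>lborel)"
      by (simp only: mult.assoc[of "ennreal (weight \<rho> ?u * weight \<rho> ?v)"]) (rule nn_integral_cmult, measurable)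
    moreover have "(\<integral>\<^sup>+k. ?E (k # ?u) ?v t r \<partial>count_space UNIV) =
        ennreal (weight \<rho> ?u) * (\<integral>\<^sup>+s. ?E ?u ?v (t - s) r * indicator {0..} s \<partial>lborel)"
      using p by (intro step) auto
    moreover have "ennreal (weight \<rho> ?u * weight \<rho> ?v) = ennreal (weight \<rho> ?v) * ennreal (weight \<rho> ?u)"
      using weight_pos' by (subst mult.commute) (simp add: ennreal_mult less_imp_le)
    ultimately show "ennreal (weight \<rho> ?v) * (\<integral>\<^sup>+k. ?E (k # ?u) ?v t r \<partial>count_space UNIV) =
        (\<integral>\<^sup>+s. ennreal (weight \<rho> ?u * weight \<rho> ?v) * ?E ?u ?v (t - s) r * indicator {0..} s \<partial>lborel)"
      by (simp only: mult.assoc)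
  qed
  also have "\<dots> = (\<integral>\<^sup>+s. \<integral>\<^sup>+p. ennreal (weight \<rho> (fst p) * weight \<rho> (snd p)) * ?E (fst p) (snd p) (t - s) r *
      indicator {0..} s \<partial>count_space (kinship a b) \<partial>lborel)"
    by (rule nn_integral_count_space_nn_integral[symmetric]) auto
  also have "\<dots> = (\<integral>\<^sup>+s. pair_moment a b (t - s) r * indicator {0..} s \<partial>lborel)"
    unfolding pair_moment_def by (intro nn_integral_cong nn_integral_multc) simp
  finally show ?thesis .
qed

lemma ancestor_moment_Suc:
  "ancestor_moment (Suc a) b t r = (\<integral>\<^sup>+s. ancestor_moment a b (t - s) r * indicator {0..} s \<partial>lborel)"
proof -
  interpret P: pair_sigma_finite M "lborel :: real measure" ..
  let ?I = "\<lambda>w s \<omega>. arrival_volume a (t - s - birth w \<omega>) * arrival_volume b (r - birth w \<omega>)"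
  have "(\<integral>\<^sup>+s. ancestor_moment a b (t - s) r * indicator {0..} s \<partial>lborel) =
      (\<integral>\<^sup>+s. \<integral>\<^sup>+w. ennreal ((weight \<rho> w)\<^sup>2) * (\<integral>\<^sup>+\<omega>. ?I w s \<omega> \<partial>M) * indicator {0..} s \<partial>count_space UNIV \<partial>lborel)"
    unfolding ancestor_moment_def by (intro nn_integral_cong nn_integral_multc[symmetric]) simp
  also have "\<dots> = (\<integral>\<^sup>+w. \<integral>\<^sup>+s. ennreal ((weight \<rho> w)\<^sup>2) * (\<integral>\<^sup>+\<omega>. ?I w s \<omega> \<partial>M) * indicator {0..} s \<partial>lborel \<partial>count_space UNIV)"
    by (rule nn_integral_count_space_nn_integral) auto
  also have "\<dots> = (\<integral>\<^sup>+w. ennreal ((weight \<rho> w)\<^sup>2) *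
      (\<integral>\<^sup>+\<omega>. arrival_volume (Suc a) (t - birth w \<omega>) * arrival_volume b (r - birth w \<omega>) \<partial>M) \<partial>count_space UNIV)"
  proof (intro nn_integral_cong)
    fix w
    have "(\<integral>\<^sup>+\<omega>. ?I w s \<omega> * indicator {0..} s \<partial>M) = (\<integral>\<^sup>+\<omega>. ?I w s \<omega> \<partial>M) * indicator {0..} s" for s
      by (rule nn_integral_multc) measurable
    then have "(\<integral>\<^sup>+s. ennreal ((weight \<rho> w)\<^sup>2) * (\<integral>\<^sup>+\<omega>. ?I w s \<omega> \<partial>M) * indicator {0..} s \<partial>lborel) =
        ennreal ((weight \<rho> w)\<^sup>2) * (\<integral>\<^sup>+s. \<integral>\<^sup>+\<omega>. ?I w s \<omega> * indicator {0..} s \<partial>M \<partial>lborel)"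
      by (simp only: mult.assoc[of "ennreal ((weight \<rho> w)\<^sup>2)"]) (rule nn_integral_cmult, measurable)
    also have "(\<integral>\<^sup>+s. \<integral>\<^sup>+\<omega>. ?I w s \<omega> * indicator {0..} s \<partial>M \<partial>lborel) =
        (\<integral>\<^sup>+\<omega>. \<integral>\<^sup>+s. ?I w s \<omega> * indicator {0..} s \<partial>lborel \<partial>M)"
      by (rule P.Fubini') measurable
    also have "\<dots> = (\<integral>\<^sup>+\<omega>. arrival_volume (Suc a) (t - birth w \<omega>) * arrival_volume b (r - birth w \<omega>) \<partial>M)"
    proof (intro nn_integral_cong)
      fix \<omega>
      have "(\<integral>\<^sup>+s. ?I w s \<omega> * indicator {0..} s \<partial>lborel) =
          (\<integral>\<^sup>+s. arrival_volume b (r - birth w \<omega>) * (arrival_volume a ((t - birth w \<omega>) - s) * indicator {0..} s) \<partial>lborel)"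
      proof (intro nn_integral_cong)
        fix s
        have "t - s - birth w \<omega> = t - birth w \<omega> - s" by simp
        then show "?I w s \<omega> * indicator {0..} s =
            arrival_volume b (r - birth w \<omega>) * (arrival_volume a ((t - birth w \<omega>) - s) * indicator {0..} s)"
          by (simp only: mult_ac)
      qed
      also have "\<dots> = arrival_volume b (r - birth w \<omega>) *
          (\<integral>\<^sup>+s. arrival_volume a ((t - birth w \<omega>) - s) * indicator {0..} s \<partial>lborel)"
        by (rule nn_integral_cmult) measurable
      finally show "(\<integral>\<^sup>+s. ?I w s \<omega> * indicator {0..} s \<partial>lborel) =
          arrival_volume (Suc a) (t - birth w \<omega>) * arrival_volume b (r - birth w \<omega>)"
        unfolding nn_integral_arrival_volume by (simp only: mult.commute)
    qed
    finally show "(\<integral>\<^sup>+s. ennreal ((weight \<rho> w)\<^sup>2) * (\<integral>\<^sup>+\<omega>. ?I w s \<omega> \<partial>M) * indicator {0..} s \<partial>lborel) =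
        ennreal ((weight \<rho> w)\<^sup>2) *
        (\<integral>\<^sup>+\<omega>. arrival_volume (Suc a) (t - birth w \<omega>) * arrival_volume b (r - birth w \<omega>) \<partial>M)" .
  qed
  finally show ?thesis by (simp add: ancestor_moment_def)
qed

text \<open>The second base case, out of reach of \<open>pair_moment_Suc\<close>: two different
  children of one node. Here the product form of the second factorial moment makes the two ages
  integrate separately.\<close>

lemma pair_moment_1_1: "pair_moment 1 1 t r = ancestor_moment 1 1 t r"
proof -
  have bij: "bij_betw (\<lambda>p. (fst (snd p) # fst p, snd (snd p) # fst p)) (UNIV \<times> {(k, l). k \<noteq> l}) (kinship 1 1)"
    by (rule bij_betw_byWitness[where f' = "\<lambda>p. (tl (fst p), hd (fst p), hd (snd p))"])
      (auto simp: kinship_1_1[simplified])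
  have 1: "(\<integral>\<^sup>+x. indicator {..t} (z + x) * indicator {0..} x \<partial>lborel) = arrival_volume 1 (t - z)" for t z :: real
  proof -
    have "(\<integral>\<^sup>+x. indicator {..t} (z + x) * indicator {0..} x \<partial>lborel) =
        (\<integral>\<^sup>+x. arrival_volume 0 ((t - z) - x) * indicator {0..} x \<partial>lborel)"
      by (intro nn_integral_cong) (auto simp: arrival_volume_def split: split_indicator)
    then show ?thesis by (simp add: nn_integral_arrival_volume)
  qed
  have "(\<integral>\<^sup>+p. (\<integral>\<^sup>+\<omega>. indicator {..t} (birth (fst p # w) \<omega>) * indicator {..r} (birth (snd p # w) \<omega>) \<partial>M)
      \<partial>count_space {(k, l). k \<noteq> l}) =
    ennreal ((weight \<rho> w)\<^sup>2) *
     (\<integral>\<^sup>+\<omega>. arrival_volume 1 (t - birth w \<omega>) * arrival_volume 1 (r - birth w \<omega>) \<partial>M)" for w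
  proof -
    have "(\<integral>\<^sup>+p. (\<integral>\<^sup>+\<omega>. indicator {..t} (birth (fst p # w) \<omega>) * indicator {..r} (birth (snd p # w) \<omega>) \<partial>M)
        \<partial>count_space {(k, l). k \<noteq> l}) =
      ennreal ((weight \<rho> w)\<^sup>2) * (\<integral>\<^sup>+\<omega>. \<integral>\<^sup>+x. (\<integral>\<^sup>+y. indicator {..t} (birth w \<omega> + x) * indicator {..r} (birth w \<omega> + y) *
        indicator {0..} y \<partial>lborel) * indicator {0..} x \<partial>lborel \<partial>M)"
      using nn_integral_child_pairs[OF indep_elements_births[of w w w],
          of "\<lambda>(q, x, y). indicator {..t} (fst q + x) * indicator {..r} (fst q + y)"]
      by (simp add: birth_Cons)
    moreover have "(\<integral>\<^sup>+x. (\<integral>\<^sup>+y. indicator {..t} (z + x) * indicator {..r} (z + y) *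
        indicator {0..} y \<partial>lborel) * indicator {0..} x \<partial>lborel) = arrival_volume 1 (t - z) * arrival_volume 1 (r - z)" for z :: real
    proof -
      have "(\<integral>\<^sup>+x. (\<integral>\<^sup>+y. indicator {..t} (z + x) * indicator {..r} (z + y) *
          indicator {0..} y \<partial>lborel) * indicator {0..} x \<partial>lborel) =
        (\<integral>\<^sup>+x. arrival_volume 1 (r - z) * (indicator {..t} (z + x) * indicator {0..} x) \<partial>lborel)"
      proof (intro nn_integral_cong)
        fix x
        have "(\<integral>\<^sup>+y. indicator {..t} (z + x) * indicator {..r} (z + y) * indicator {0..} y \<partial>lborel) =
            indicator {..t} (z + x) * (\<integral>\<^sup>+y. indicator {..r} (z + y) * indicator {0..} y \<partial>lborel)"
          by (simp only: mult.assoc) (rule nn_integral_cmult, simp)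
        then show "(\<integral>\<^sup>+y. indicator {..t} (z + x) * indicator {..r} (z + y) * indicator {0..} y \<partial>lborel) * indicator {0..} x =
            arrival_volume 1 (r - z) * (indicator {..t} (z + x) * indicator {0..} x)"
          unfolding 1 by (simp only: mult_ac)
      qed
      also have "\<dots> = arrival_volume 1 (r - z) * (\<integral>\<^sup>+x. indicator {..t} (z + x) * indicator {0..} x \<partial>lborel)"
        by (rule nn_integral_cmult) simp
      finally show ?thesis unfolding 1 by (simp only: mult.commute)
    qed
    ultimately show ?thesis by (simp only:)
  qed
  then show ?thesis
    unfolding pair_moment_def ancestor_moment_def nn_integral_bij_count_space[OF bij, symmetric]
    by (subst nn_integral_count_space_Times) (simp add: weight_def)
qed

text \<open>Both sides obey the same recursion in the first gap, so every pair of gaps has to be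
  reached from a base case. The gaps (0, 0) lead to (a, 0), and (1, 1) leads to (Suc a, 1); the
  latter, with the roles exchanged, start the induction for (Suc a, Suc b). Symmetry supplies (0,
  b).\<close>

lemma pair_moment_eq: "pair_moment a b t r = ancestor_moment a b t r"
proof -
  have 00: "pair_moment 0 0 t r = ancestor_moment 0 0 t r" for t r
  proof -
    have bij: "bij_betw (\<lambda>w. (w, w)) UNIV (kinship 0 0)"
      by (rule bij_betw_byWitness[where f' = fst]) (auto simp: kinship_0 suffix_def)
    have "arrival_volume 0 (t - x) = indicator {..t} x" for t x
      by (auto simp: arrival_volume_def split: split_indicator)
    then show ?thesis
      unfolding pair_moment_def ancestor_moment_def nn_integral_bij_count_space[OF bij, symmetric]
      by (simp add: power2_eq_square)
  qed
  have a0: "pair_moment a 0 t r = ancestor_moment a 0 t r" for a t r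
    by (induction a arbitrary: t) (auto simp: 00 pair_moment_Suc ancestor_moment_Suc)
  have a1: "pair_moment (Suc a) 1 t r = ancestor_moment (Suc a) 1 t r" for a t r
    using pair_moment_1_1
    by (induction a arbitrary: t) (simp_all add: pair_moment_Suc[of "Suc _"] ancestor_moment_Suc[of "Suc _"])
  have ab: "pair_moment (Suc a) (Suc b) t r = ancestor_moment (Suc a) (Suc b) t r" for a b t r
  proof (induction a arbitrary: t)
    case 0
    show ?case
      using a1[of b r t] pair_moment_commute[of 1 "Suc b" t r] ancestor_moment_commute[of 1 "Suc b" t r]
      by simp
  next
    case (Suc a)
    then show ?case by (simp add: pair_moment_Suc[of "Suc _"] ancestor_moment_Suc[of "Suc _"])
  qed
  show ?thesis
    using a0[of a t r] a0[of b r t] ab[of "a - 1" "b - 1" t r] pair_moment_commute[of a b t r]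
      ancestor_moment_commute[of a b t r]
    by (cases "a = 0"; cases "b = 0") auto
qed

end

section \<open>Offsets\<close>

lemma position_cong:
  "(\<And>w. w \<noteq> [] \<Longrightarrow> suffix w v \<Longrightarrow> x w = x' w) \<Longrightarrow> position x v = position x' v"
  by (induction v) (auto simp: suffix_Cons)

lemma cnj_mult_swap: "a * cnj b = cnj (b * cnj a)"
  by (simp add: mult.commute)

lemma (in prob_space) indep_var_of_indep_set:
  fixes Y Z :: "'a \<Rightarrow> 'c :: topological_space"
  assumes ind: "indep_set (sigma_sets (space M) E) (sigma_sets (space M) G)"
    and E: "E \<subseteq> Pow (space M)" and G: "G \<subseteq> Pow (space M)"
    and Y: "Y \<in> borel_measurable (sigma (space M) E)" and Z: "Z \<in> borel_measurable (sigma (space M) G)"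
  shows "indep_var borel Y borel Z"
proof -
  have ev: "sigma_sets (space M) E \<subseteq> events" "sigma_sets (space M) G \<subseteq> events"
    using ind by (simp_all add: indep_sets2_eq)
  have s: "sets (sigma (space M) E) = sigma_sets (space M) E" "sets (sigma (space M) G) = sigma_sets (space M) G"
    using E G by simp_all
  have rv: "random_variable borel Y" "random_variable borel Z"
    using Y Z ev E G unfolding measurable_def s by auto
  have sub: "sigma_sets (space M) {f -` A \<inter> space M |A. A \<in> sets borel} \<subseteq> sigma_sets (space M) H"
    if f: "f \<in> borel_measurable (sigma (space M) H)" and H: "H \<subseteq> Pow (space M)" for f :: "'a \<Rightarrow> 'c" and H
  proof (rule sigma_sets_mono, safe)
    fix A :: "'c set" assume "A \<in> sets borel"
    then have "f -` A \<inter> space (sigma (space M) H) \<in> sets (sigma (space M) H)"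
      by (rule measurable_sets[OF f])
    then show "f -` A \<inter> space M \<in> sigma_sets (space M) H" using H by simp
  qed
  show ?thesis
    unfolding indep_var_eq
    using ind rv sub[OF Y E] sub[OF Z G] unfolding indep_sets2_eq by blast
qed

context yule_branching_random_walk
begin

definition pos :: "node \<Rightarrow> 'a \<Rightarrow> 'b" where
  "pos v \<omega> = position (\<lambda>w. X w \<omega>) v"

lemma pos_Nil [simp]: "pos [] \<omega> = 0" and pos_Cons: "pos (k # v) \<omega> = pos v \<omega> + X (k # v) \<omega>"
  by (simp_all add: pos_def)

lemma offset_measurable [measurable]: "X v \<in> borel_measurable M"
  using offsets_indep by (simp add: indep_vars_def)

lemma pos_measurable [measurable]: "pos v \<in> borel_measurable M"
  by (induction v) (simp_all add: pos_Cons[abs_def] pos_def[of "[]", abs_def])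

definition tree_events :: "'a set set" where
  "tree_events = {{\<omega> \<in> space M. v \<in> random_tree age \<omega> t} | v t. 0 \<le> t}"

definition offset_events :: "'a set set" where
  "offset_events = {X v -` B \<inter> space M | v B. B \<in> sets borel}"

lemma tree_events_Pow: "tree_events \<subseteq> Pow (space M)"
  and offset_events_Pow: "offset_events \<subseteq> Pow (space M)"
  by (auto simp: tree_events_def offset_events_def)

lemma pos_offset_measurable [measurable]: "pos v \<in> borel_measurable (sigma (space M) offset_events)"
proof -
  have [measurable]: "X v \<in> borel_measurable (sigma (space M) offset_events)" for v
  proof (rule measurableI)
    fix A :: "'b set" assume "A \<in> sets borel"
    then show "X v -` A \<inter> space (sigma (space M) offset_events) \<in> sets (sigma (space M) offset_events)"
      by (simp add: offset_events_Pow) (auto simp: offset_events_def intro!: sigma_sets.Basic)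
  qed simp
  show ?thesis
    by (induction v) (simp_all add: pos_Cons[abs_def] pos_def[of "[]", abs_def])
qed

lemma indicator_birth_tree_measurable:
  "0 \<le> t \<Longrightarrow> (\<lambda>\<omega>. indicator {..t} (birth v \<omega>) :: real) \<in> borel_measurable (sigma (space M) tree_events)"
proof -
  assume t: "0 \<le> t"
  have "{\<omega> \<in> space M. birth v \<omega> \<le> t} \<in> sets (sigma (space M) tree_events)"
    using t by (simp add: tree_events_Pow)
      (auto simp: tree_events_def mem_random_tree intro!: sigma_sets.Basic)
  then have "(\<lambda>\<omega>. indicator {\<omega> \<in> space M. birth v \<omega> \<le> t} \<omega> :: real) \<in> borel_measurable (sigma (space M) tree_events)"
    by (rule borel_measurable_indicator)
  moreover have "(\<lambda>\<omega>. indicator {..t} (birth v \<omega>) :: real) \<in> borel_measurable (sigma (space M) tree_events)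
     \<longleftrightarrow> (\<lambda>\<omega>. indicator {\<omega> \<in> space M. birth v \<omega> \<le> t} \<omega> :: real) \<in> borel_measurable (sigma (space M) tree_events)"
    by (rule measurable_cong) (auto simp: tree_events_Pow split: split_indicator)
  ultimately show ?thesis by simp
qed

text \<open>Births up to nonnegative times are events of the tree, hence independent of whatever is
  built from the offsets. The value field is left general because both complex phases and real norms
  are inserted for \<open>Z\<close>.\<close>

lemma
  fixes Z :: "'a \<Rightarrow> 'c :: {real_normed_field, banach, second_countable_topology}"
  assumes t: "0 \<le> t" "0 \<le> r"
    and Z: "Z \<in> borel_measurable (sigma (space M) offset_events)" "integrable M Z"
  shows integral_tree_offset:
    "(\<integral>\<omega>. of_real (indicator {..t} (birth u \<omega>) * indicator {..r} (birth v \<omega>)) * Z \<omega> \<partial>M) =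
      of_real (\<integral>\<omega>. indicator {..t} (birth u \<omega>) * indicator {..r} (birth v \<omega>) \<partial>M) * (\<integral>\<omega>. Z \<omega> \<partial>M)"
proof -
  let ?Y = "\<lambda>\<omega>. of_real (indicator {..t} (birth u \<omega>) * indicator {..r} (birth v \<omega>)) :: 'c"
  have "indep_var borel ?Y borel Z"
  proof (rule indep_var_of_indep_set[OF offsets_indep_tree[folded tree_events_def offset_events_def]])
    show "tree_events \<subseteq> Pow (space M)" "offset_events \<subseteq> Pow (space M)"
      by (fact tree_events_Pow offset_events_Pow)+
    have [measurable]: "(\<lambda>\<omega>. indicator {..t} (birth u \<omega>) :: real) \<in> borel_measurable (sigma (space M) tree_events)"
      "(\<lambda>\<omega>. indicator {..r} (birth v \<omega>) :: real) \<in> borel_measurable (sigma (space M) tree_events)"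
      using t by (auto intro: indicator_birth_tree_measurable)
    show "?Y \<in> borel_measurable (sigma (space M) tree_events)"
      by measurable
  qed fact
  moreover have "integrable M ?Y"
    by (rule integrable_const_bound[of _ 1]) (auto simp: indicator_def)
  moreover have "(\<integral>\<omega>. ?Y \<omega> \<partial>M) = of_real (\<integral>\<omega>. indicator {..t} (birth u \<omega>) * indicator {..r} (birth v \<omega>) \<partial>M)"
    by (rule integral_bounded_linear[OF bounded_linear_of_real])
      (rule integrable_const_bound[of _ 1], auto simp: indicator_def)
  ultimately show ?thesis
    using Z(2) by (simp only: indep_var_lebesgue_integral)
qed

end

locale real_branching_random_walk = yule_branching_random_walk M \<rho> age X D
  for M :: "'a measure" and \<rho> :: real and age :: "node \<Rightarrow> nat \<Rightarrow> 'a \<Rightarrow> real"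
    and X :: "node \<Rightarrow> 'a \<Rightarrow> real" and D :: "real measure"
begin

text \<open>Frequency 1 is no restriction: other frequencies, and the passage from vectors to
  numbers, are absorbed into the offsets by a projection.\<close>

abbreviation "\<phi> \<equiv> char D 1"

lemma expectation_iexp_offset: "(\<integral>\<omega>. iexp (X v \<omega>) \<partial>M) = \<phi>"
  unfolding char_def offsets_law[of v, symmetric] by (subst integral_distr) auto

text \<open>The offset of \<open>k # u\<close> occurs neither in the position of \<open>u\<close>
  nor in that of \<open>v\<close>, so its phase splits off as an independent factor.\<close>

lemma expectation_iexp_Cons:
  assumes "\<not> suffix (k # u) v"
  shows "(\<integral>\<omega>. iexp (pos (k # u) \<omega>) * cnj (iexp (pos v \<omega>)) \<partial>M) =
    \<phi> * (\<integral>\<omega>. iexp (pos u \<omega>) * cnj (iexp (pos v \<omega>)) \<partial>M)"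
proof -
  let ?B = "- {k # u}"
  let ?g = "\<lambda>x. iexp (position x u) * cnj (iexp (position x v))"
  have pm: "(\<lambda>x. position x w) \<in> borel_measurable (PiM ?B (\<lambda>_. borel :: real measure))"
    if "\<not> suffix (k # u) w" for w
    using that
  proof (induction w)
    case (Cons l w)
    have "(\<lambda>x. x (l # w)) \<in> borel_measurable (PiM ?B (\<lambda>_. borel :: real measure))"
      using Cons.prems by (intro measurable_component_singleton) auto
    then show ?case using Cons by (auto simp: suffix_Cons intro!: borel_measurable_add)
  qed simp
  have ns: "\<not> suffix (k # u) u" using suffix_length_le by fastforce
  note [measurable] = pm[OF assms] pm[OF ns]
  have [measurable]: "cnj \<in> borel_measurable borel"
    by (intro borel_measurable_continuous_onI continuous_intros)
  have "indep_var borel (?g \<circ> (\<lambda>\<omega>. restrict (\<lambda>w. X w \<omega>) ?B)) borel ((\<lambda>x. iexp (x (k # u))) \<circ> (\<lambda>\<omega>. restrict (\<lambda>w. X w \<omega>) {k # u}))"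
    by (intro indep_var_compose[OF indep_var_restrict[OF offsets_indep]]) auto
  moreover have "position (restrict (\<lambda>w. X w \<omega>) ?B) w = pos w \<omega>" if "w = u \<or> w = v" for w \<omega>
    unfolding pos_def using assms ns that by (intro position_cong) auto
  ultimately have ind: "indep_var borel (\<lambda>\<omega>. iexp (pos u \<omega>) * cnj (iexp (pos v \<omega>))) borel (\<lambda>\<omega>. iexp (X (k # u) \<omega>))"
    by (simp add: comp_def)
  have "integrable M (\<lambda>\<omega>. iexp (pos u \<omega>) * cnj (iexp (pos v \<omega>)))" "integrable M (\<lambda>\<omega>. iexp (X (k # u) \<omega>))"
    by (auto intro!: integrable_const_bound[of _ 1] simp: norm_mult)
  from indep_var_lebesgue_integral[OF ind this] show ?thesis
    by (simp add: expectation_iexp_offset pos_Cons exp_add distrib_left mult_ac)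
qed

lemma expectation_iexp_kinship:
  assumes "(u, v) \<in> kinship a b"
  shows "(\<integral>\<omega>. iexp (pos u \<omega>) * cnj (iexp (pos v \<omega>)) \<partial>M) = \<phi> ^ a * cnj \<phi> ^ b"
proof -
  \<comment> \<open>The value \<open>c\<close> at gap 0 is left open because the recursion runs
    twice: first down the side of \<open>v\<close> to the diagonal, where the value is 1, and then,
    after conjugation, down the side of \<open>u\<close>.\<close>
  have step: "(\<integral>\<omega>. iexp (pos u \<omega>) * cnj (iexp (pos v \<omega>)) \<partial>M) = \<phi> ^ a * c"
    if "(u, v) \<in> kinship a b"
      and "\<And>u. (u, v) \<in> kinship 0 b \<Longrightarrow> (\<integral>\<omega>. iexp (pos u \<omega>) * cnj (iexp (pos v \<omega>)) \<partial>M) = c"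
    for a b c u v
    using that
  proof (induction a arbitrary: u)
    case (Suc a)
    then obtain k u' where u: "u = k # u'" "\<not> suffix (k # u') v" "(u', v) \<in> kinship a b"
      by (auto simp: kinship_Suc)
    show ?case
      unfolding u(1) expectation_iexp_Cons[OF u(2)] by (subst Suc.IH[OF u(3) Suc.prems(2)]) auto
  qed simp
  have diag: "(\<integral>\<omega>. iexp (pos u \<omega>) * cnj (iexp (pos u \<omega>)) \<partial>M) = 1" for u
    by (simp add: complex_norm_square[symmetric] prob_space)
  have 0: "(\<integral>\<omega>. iexp (pos u \<omega>) * cnj (iexp (pos v \<omega>)) \<partial>M) = cnj \<phi> ^ b"
    if "(u, v) \<in> kinship 0 b" for u v b
  proof -
    have "(\<integral>\<omega>. iexp (pos v \<omega>) * cnj (iexp (pos u \<omega>)) \<partial>M) = \<phi> ^ b * 1"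
    proof (rule step[of _ _ _ 0])
      show "(v, u) \<in> kinship b 0" using that by (simp add: kinship_swap)
      fix v assume "(v, u) \<in> kinship 0 0"
      then have "v = u" by (auto simp: kinship_0 suffix_def)
      then show "(\<integral>\<omega>. iexp (pos v \<omega>) * cnj (iexp (pos u \<omega>)) \<partial>M) = 1" using diag by simp
    qed
    moreover have "(\<integral>\<omega>. iexp (pos u \<omega>) * cnj (iexp (pos v \<omega>)) \<partial>M) =
        cnj (\<integral>\<omega>. iexp (pos v \<omega>) * cnj (iexp (pos u \<omega>)) \<partial>M)"
      by (rule trans[OF Bochner_Integration.integral_cong[OF refl cnj_mult_swap] Bochner_Integration.integral_cnj])
    ultimately show ?thesis by (simp only: complex_cnj_power mult_1_right)
  qed
  show ?thesis by (rule step[OF assms]) (rule 0)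
qed

end

section \<open>From pairs of nodes to the birth of their common ancestor\<close>

context weighted_yule_tree
begin

text \<open>The intensity measure of the birth times, with squared weights. The expected number of births
  grows like \<open>exp t\<close>, so any discount rate above 1 makes it finite.\<close>

definition ancestor_law :: "real measure" where
  "ancestor_law = distr (density (count_space UNIV \<Otimes>\<^sub>M M)
     (\<lambda>p. ennreal ((weight \<rho> (fst p))\<^sup>2 * exp (- (5 / 4 * birth (fst p) (snd p)))))) borel
     (\<lambda>p. birth (fst p) (snd p))"

lemma birth_pair_measurable [measurable]:
  "(\<lambda>p. birth (fst p) (snd p)) \<in> borel_measurable (count_space UNIV \<Otimes>\<^sub>M M)"
  by (rule measurable_pair_measure_countable1) auto

lemma weight_pair_measurable [measurable]:
  "(\<lambda>p. weight \<rho> (fst p)) \<in> borel_measurable (count_space UNIV \<Otimes>\<^sub>M M)"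
  by (rule measurable_compose[OF measurable_fst]) simp

lemma sets_ancestor_law [measurable_cong, simp]: "sets ancestor_law = sets borel"
  by (simp add: ancestor_law_def)

lemma space_ancestor_law [simp]: "space ancestor_law = UNIV"
  by (simp add: ancestor_law_def)

lemma nn_integral_ancestor_law:
  assumes [measurable]: "f \<in> borel_measurable borel"
  shows "(\<integral>\<^sup>+x. f x \<partial>ancestor_law) = (\<integral>\<^sup>+w. ennreal ((weight \<rho> w)\<^sup>2) *
    (\<integral>\<^sup>+\<omega>. ennreal (exp (- (5 / 4 * birth w \<omega>))) * f (birth w \<omega>) \<partial>M) \<partial>count_space UNIV)"
proof -
  have "(\<integral>\<^sup>+x. f x \<partial>ancestor_law) = (\<integral>\<^sup>+p. ennreal ((weight \<rho> (fst p))\<^sup>2 * exp (- (5 / 4 * birth (fst p) (snd p)))) *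
      f (birth (fst p) (snd p)) \<partial>(count_space UNIV \<Otimes>\<^sub>M M))"
    unfolding ancestor_law_def by (subst nn_integral_distr) (auto simp: nn_integral_density)
  also have "\<dots> = (\<integral>\<^sup>+w. \<integral>\<^sup>+\<omega>. ennreal ((weight \<rho> w)\<^sup>2 * exp (- (5 / 4 * birth w \<omega>))) * f (birth w \<omega>) \<partial>M \<partial>count_space UNIV)"
    by (subst nn_integral_fst[symmetric]) auto
  also have "\<dots> = (\<integral>\<^sup>+w. ennreal ((weight \<rho> w)\<^sup>2) *
      (\<integral>\<^sup>+\<omega>. ennreal (exp (- (5 / 4 * birth w \<omega>))) * f (birth w \<omega>) \<partial>M) \<partial>count_space UNIV)"
    by (intro nn_integral_cong) (simp add: ennreal_mult mult.assoc nn_integral_cmult)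
  finally show ?thesis .
qed

text \<open>The factor \<open>\<rho> + 1\<close> exceeds both possible weights; it reduces squared
  weights to weights, for which the discounted sum is known.\<close>

lemma weight_square_le: "(weight \<rho> w)\<^sup>2 \<le> (\<rho> + 1) * weight \<rho> w"
  using weight_pos by (simp add: weight_def power2_eq_square)

lemma ennreal_weight_square_le: "ennreal ((weight \<rho> w)\<^sup>2) \<le> ennreal (\<rho> + 1) * ennreal (weight \<rho> w)"
  using weight_pos weight_pos'[of w] weight_square_le[of w]
  by (subst ennreal_mult[symmetric]) (auto intro!: ennreal_leI simp: less_imp_le)

text \<open>\<open>ancestor_law\<close> already carries the discount 5/4, so
  \<open>c - 5 / 4\<close> brings the total rate to \<open>c\<close>.\<close>

lemma nn_integral_ancestor_law_le:
  assumes "1 < c"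
  shows "(\<integral>\<^sup>+x. ennreal (exp (- ((c - 5 / 4) * x))) \<partial>ancestor_law) \<le> ennreal ((\<rho> + 1) * (\<rho> * c / (c - 1)))"
proof -
  have "(\<integral>\<^sup>+x. ennreal (exp (- ((c - 5 / 4) * x))) \<partial>ancestor_law) =
      (\<integral>\<^sup>+w. ennreal ((weight \<rho> w)\<^sup>2) * (\<integral>\<^sup>+\<omega>. ennreal (exp (- (c * birth w \<omega>))) \<partial>M) \<partial>count_space UNIV)"
    by (subst nn_integral_ancestor_law)
      (auto simp: ennreal_mult[symmetric] exp_add[symmetric] algebra_simps)
  also have "\<dots> \<le> (\<integral>\<^sup>+w. ennreal (\<rho> + 1) * (ennreal (weight \<rho> w) * (\<integral>\<^sup>+\<omega>. ennreal (exp (- (c * birth w \<omega>))) \<partial>M)) \<partial>count_space UNIV)"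
    unfolding mult.assoc[symmetric]
    by (intro nn_integral_mono mult_right_mono ennreal_weight_square_le) simp
  also have "\<dots> = ennreal (\<rho> + 1) * ennreal (\<rho> * c / (c - 1))"
    using assms by (subst nn_integral_cmult) (auto simp: sum_exp_birth)
  also have "\<dots> = ennreal ((\<rho> + 1) * (\<rho> * c / (c - 1)))"
    using weight_pos assms by (intro ennreal_mult[symmetric]) auto
  finally show ?thesis .
qed

text \<open>For \<rho> = 1 the squared weights are the weights, and the exact value survives. It
  yields the constant 2 in the second moment of the normalized weight.\<close>

lemma nn_integral_ancestor_law_unit:
  assumes "\<rho> = 1" "1 < c"
  shows "(\<integral>\<^sup>+x. ennreal (exp (- ((c - 5 / 4) * x))) \<partial>ancestor_law) = ennreal (c / (c - 1))"
proof -
  have w: "weight \<rho> v = 1" for v using assms by (simp add: weight_def)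
  have "(\<integral>\<^sup>+x. ennreal (exp (- ((c - 5 / 4) * x))) \<partial>ancestor_law) =
      (\<integral>\<^sup>+w. ennreal (weight \<rho> w) * (\<integral>\<^sup>+\<omega>. ennreal (exp (- (c * birth w \<omega>))) \<partial>M) \<partial>count_space UNIV)"
    by (subst nn_integral_ancestor_law)
      (auto simp: w ennreal_mult[symmetric] exp_add[symmetric] algebra_simps)
  then show ?thesis using sum_exp_birth[OF assms(2)] assms by simp
qed

lemma finite_measure_ancestor_law: "finite_measure ancestor_law"
proof
  have "emeasure ancestor_law (space ancestor_law) = (\<integral>\<^sup>+x. ennreal (exp (- ((5 / 4 - 5 / 4) * x))) \<partial>ancestor_law)"
    by simp
  also have "\<dots> \<le> ennreal ((\<rho> + 1) * (\<rho> * (5 / 4) / (5 / 4 - 1)))"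
    by (rule nn_integral_ancestor_law_le) simp
  finally show "emeasure ancestor_law (space ancestor_law) \<noteq> \<infinity>"
    by (auto simp: top_unique)
qed

lemma ancestor_moment_eq:
  "ancestor_moment a b t r =
    (\<integral>\<^sup>+x. ennreal (exp (5 / 4 * x)) * (arrival_volume a (t - x) * arrival_volume b (r - x)) \<partial>ancestor_law)"
proof -
  have "ennreal (exp (- (5 / 4 * x))) * (ennreal (exp (5 / 4 * x)) * y) = y" for x y
    by (simp add: mult.assoc[symmetric] ennreal_mult[symmetric] exp_add[symmetric])
  then show ?thesis
    unfolding ancestor_moment_def by (subst nn_integral_ancestor_law) auto
qed

text \<open>Any two nodes have a common ancestor, at worst the root, so the two generation gaps
  exist; they are unique, and the choice is only notational.\<close>

definition kin :: "node \<times> node \<Rightarrow> nat \<times> nat" where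
  "kin p = (SOME q. p \<in> kinship (fst q) (snd q))"

lemma mem_kinship: "p \<in> kinship (fst (kin p)) (snd (kin p))"
  unfolding kin_def by (rule someI_ex) (metis fst_conv kinship_exhaust snd_conv surj_pair)

lemma kin_eq_iff: "kin p = q \<longleftrightarrow> p \<in> kinship (fst q) (snd q)"
  using mem_kinship[of p] kinship_unique[of "fst p" "snd p"] by (auto simp: prod_eq_iff)

definition pair_weight :: "real \<Rightarrow> real \<Rightarrow> node \<times> node \<Rightarrow> real" where
  "pair_weight t r p = weight \<rho> (fst p) * weight \<rho> (snd p) *
     (\<integral>\<omega>. indicator {..t} (birth (fst p) \<omega>) * indicator {..r} (birth (snd p) \<omega>) \<partial>M)"

lemma pair_weight_nonneg: "0 \<le> pair_weight t r p"
  using weight_pos' by (auto simp: pair_weight_def less_imp_le intro!: mult_nonneg_nonneg integral_nonneg_AE)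

lemma integrable_indicator_births:
  "integrable M (\<lambda>\<omega>. indicator {..t} (birth u \<omega>) * indicator {..r} (birth v \<omega>) :: real)"
  by (rule integrable_const_bound[of _ 1]) (auto simp: indicator_def)

lemma ennreal_pair_weight:
  "ennreal (pair_weight t r p) = ennreal (weight \<rho> (fst p) * weight \<rho> (snd p)) *
     (\<integral>\<^sup>+\<omega>. indicator {..t} (birth (fst p) \<omega>) * indicator {..r} (birth (snd p) \<omega>) \<partial>M)"
proof -
  have "(\<integral>\<^sup>+\<omega>. indicator {..t} (birth (fst p) \<omega>) * indicator {..r} (birth (snd p) \<omega>) \<partial>M) =
      (\<integral>\<^sup>+\<omega>. ennreal (indicator {..t} (birth (fst p) \<omega>) * indicator {..r} (birth (snd p) \<omega>)) \<partial>M)"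
    by (intro nn_integral_cong) (auto split: split_indicator)
  also have "\<dots> = ennreal (\<integral>\<omega>. indicator {..t} (birth (fst p) \<omega>) * indicator {..r} (birth (snd p) \<omega>) \<partial>M)"
    by (rule nn_integral_eq_integral[OF integrable_indicator_births]) simp
  finally show ?thesis
    using weight_pos' by (simp add: pair_weight_def ennreal_mult less_imp_le integral_nonneg_AE)
qed

text \<open>At a point (a, b) the two masses are \<open>pair_moment a b t r\<close> and
  \<open>ancestor_moment a b t r\<close>. As an equality of measures the identity can be integrated
  against complex functions of the two gaps.\<close>

lemma distr_kin:
  "distr (density (count_space UNIV) (\<lambda>p. ennreal (pair_weight t r p))) (count_space UNIV) kin =
   distr (density (ancestor_law \<Otimes>\<^sub>M count_space UNIV)
     (\<lambda>z. ennreal (exp (5 / 4 * fst z)) *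
       (arrival_volume (fst (snd z)) (t - fst z) * arrival_volume (snd (snd z)) (r - fst z))))
     (count_space UNIV) snd" (is "?L = distr (density ?P ?d) _ _")
proof (rule measure_eqI_countable[where A = UNIV])
  interpret A: finite_measure ancestor_law by (rule finite_measure_ancestor_law)
  interpret C: sigma_finite_measure "count_space UNIV :: (nat \<times> nat) measure"
    by (rule sigma_finite_measure_count_space)
  interpret P: pair_sigma_finite ancestor_law "count_space UNIV :: (nat \<times> nat) measure" ..
  have dm [measurable]: "?d \<in> borel_measurable ?P"
    by (rule measurable_compose_countable'[where I = UNIV and g = snd]) auto
  fix q :: "nat \<times> nat"
  have "emeasure ?L {q} = (\<integral>\<^sup>+p. ennreal (pair_weight t r p) * indicator (kin -` {q}) p \<partial>count_space UNIV)"
    by (subst emeasure_distr) (auto simp: emeasure_density)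
  also have "\<dots> = pair_moment (fst q) (snd q) t r"
    unfolding pair_moment_def ennreal_pair_weight[symmetric]
    by (simp add: nn_integral_count_space_indicator kin_eq_iff vimage_def)
  also have "\<dots> = (\<integral>\<^sup>+x. ?d (x, q) \<partial>ancestor_law)"
    unfolding pair_moment_eq ancestor_moment_eq by simp
  also have "\<dots> = (\<integral>\<^sup>+x. \<integral>\<^sup>+q'. ?d (x, q') * indicator {q} q' \<partial>count_space UNIV \<partial>ancestor_law)"
    by (intro nn_integral_cong) (subst nn_integral_indicator_finite, auto)
  also have "\<dots> = (\<integral>\<^sup>+z. ?d z * indicator {q} (snd z) \<partial>?P)"
  proof -
    have "(\<lambda>z. ?d z * indicator {q} (snd z)) \<in> borel_measurable ?P"
      by (rule borel_measurable_times_ennreal[OF dm measurable_compose[OF measurable_snd]]) simp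
    from C.nn_integral_fst[OF this] show ?thesis by simp
  qed
  also have "\<dots> = emeasure (distr (density ?P ?d) (count_space UNIV) snd) {q}"
    by (subst emeasure_distr) (auto simp: emeasure_density intro!: nn_integral_cong split: split_indicator)
  finally show "emeasure ?L {q} = emeasure (distr (density ?P ?d) (count_space UNIV) snd) {q}" .
qed auto

end

section \<open>Sums as integrals over countable index sets\<close>

lemma integrable_count_space_finite_support:
  fixes f :: "'x \<Rightarrow> 'y :: {banach, second_countable_topology}"
  assumes "finite A" and "\<And>x. x \<notin> A \<Longrightarrow> f x = 0"
  shows "integrable (count_space UNIV) f"
proof -
  have "Infinite_Set_Sum.abs_summable_on f A" using assms(1) by simp
  then have "integrable (count_space UNIV) (\<lambda>x. indicator A x *\<^sub>R f x)"
    by (simp add: abs_summable_on_altdef set_integrable_def)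
  moreover have "(\<lambda>x. indicator A x *\<^sub>R f x) = f"
    using assms(2) by (auto split: split_indicator)
  ultimately show ?thesis by simp
qed

lemma borel_measurable_nn_integral_countable:
  fixes f :: "'i :: countable \<Rightarrow> 'x \<Rightarrow> ennreal"
  assumes [measurable]: "\<And>i. f i \<in> borel_measurable N"
  shows "(\<lambda>x. \<integral>\<^sup>+i. f i x \<partial>count_space UNIV) \<in> borel_measurable N"
proof -
  interpret sigma_finite_measure "count_space UNIV :: 'i measure"
    by (rule sigma_finite_measure_count_space)
  have "(\<lambda>z. f (snd z) (fst z)) \<in> borel_measurable (N \<Otimes>\<^sub>M count_space UNIV)"
    by (rule measurable_compose_countable'[where I = UNIV and g = snd]) auto
  then show ?thesis by (intro borel_measurable_nn_integral) (simp add: split_beta')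
qed

lemma integral_count_space_product:
  fixes f :: "'x :: countable \<Rightarrow> complex" and g :: "'y :: countable \<Rightarrow> complex"
  assumes f: "integrable (count_space UNIV) f" and g: "integrable (count_space UNIV) g"
  shows "integrable (count_space UNIV) (\<lambda>p. f (fst p) * g (snd p))"
    and "(\<integral>p. f (fst p) * g (snd p) \<partial>count_space UNIV) = (\<integral>x. f x \<partial>count_space UNIV) * (\<integral>y. g y \<partial>count_space UNIV)"
proof -
  interpret X: sigma_finite_measure "count_space UNIV :: 'x measure"
    by (rule sigma_finite_measure_count_space)
  interpret Y: sigma_finite_measure "count_space UNIV :: 'y measure"
    by (rule sigma_finite_measure_count_space)
  interpret P: pair_sigma_finite "count_space UNIV :: 'x measure" "count_space UNIV :: 'y measure" ..
  have eq: "(count_space UNIV :: ('x \<times> 'y) measure) = count_space UNIV \<Otimes>\<^sub>M count_space UNIV"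
    by (simp add: pair_measure_countable)
  have int: "integrable (count_space UNIV \<Otimes>\<^sub>M count_space UNIV) (\<lambda>p. f (fst p) * g (snd p))"
    using f g by (intro P.Fubini_integrable) (auto simp: norm_mult)
  then show "integrable (count_space UNIV) (\<lambda>p. f (fst p) * g (snd p))" by (simp add: eq)
  show "(\<integral>p. f (fst p) * g (snd p) \<partial>count_space UNIV) = (\<integral>x. f x \<partial>count_space UNIV) * (\<integral>y. g y \<partial>count_space UNIV)"
    unfolding eq by (subst P.integral_fst'[OF int, symmetric]) simp
qed

lemma suminf_arrival_volume: "(\<Sum>n. arrival_volume n y) = (if 0 \<le> y then ennreal (exp y) else 0)"
proof -
  have "(\<lambda>n. y ^ n / fact n) sums exp y"
    using exp_converges[of y] by (simp add: divide_inverse mult.commute scaleR_conv_of_real)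
  then show ?thesis by (auto simp: arrival_volume_def suminf_ennreal2 sums_iff)
qed

text \<open>Weighting generation \<open>n\<close> by \<open>z ^ n\<close> turns the simplex volumes
  into the exponential series.\<close>

lemma has_integral_arrival_volume:
  fixes z :: complex
  shows "integrable (count_space UNIV) (\<lambda>n. enn2real (arrival_volume n y) *\<^sub>R z ^ n)"
    and "(\<integral>n. enn2real (arrival_volume n y) *\<^sub>R z ^ n \<partial>count_space UNIV) = (if 0 \<le> y then exp (z * of_real y) else 0)"
proof -
  have eq: "enn2real (arrival_volume n y) *\<^sub>R z ^ n = (if 0 \<le> y then (z * of_real y) ^ n /\<^sub>R fact n else 0)" for n
    by (simp add: arrival_volume_def enn2real_ennreal scaleR_conv_of_real power_mult_distrib field_simps)
  have "summable (\<lambda>n. norm ((z * of_real y) ^ n /\<^sub>R fact n))" by (rule summable_norm_exp)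
  then have "summable (\<lambda>n. norm (enn2real (arrival_volume n y) *\<^sub>R z ^ n))"
    unfolding eq by (cases "0 \<le> y") auto
  then show int: "integrable (count_space UNIV) (\<lambda>n. enn2real (arrival_volume n y) *\<^sub>R z ^ n)"
    by (simp only: integrable_count_space_nat_iff)
  have "(\<lambda>n. enn2real (arrival_volume n y) *\<^sub>R z ^ n) sums (if 0 \<le> y then exp (z * of_real y) else 0)"
    unfolding eq using exp_converges[of "z * of_real y"] by auto
  then show "(\<integral>n. enn2real (arrival_volume n y) *\<^sub>R z ^ n \<partial>count_space UNIV) = (if 0 \<le> y then exp (z * of_real y) else 0)"
    using sums_integral_count_space_nat[OF int] sums_unique2 by blast
qed

section \<open>Finiteness of the tree and of the sums over pairs\<close>

context weighted_yule_tree
begin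

lemma expected_total_weight:
  "(\<integral>\<^sup>+v. ennreal (weight \<rho> v) * emeasure M {\<omega> \<in> space M. birth v \<omega> \<le> t} \<partial>count_space UNIV) =
    (if 0 \<le> t then ennreal (\<rho> * exp t) else 0)"
  unfolding nn_integral_generations sum_birth_le using weight_pos
  by (auto simp: suminf_arrival_volume ennreal_mult)

text \<open>The expected total weight is finite, hence so is the weight almost surely, and each node
  contributes at least \<open>min 1 \<rho>\<close>. As trees increase in time, integer times suffice
  and one null set serves all \<open>t\<close>.\<close>

lemma AE_finite_tree: "AE \<omega> in M. \<forall>t. finite {v. birth v \<omega> \<le> t}"
proof -
  have "AE \<omega> in M. finite {v. birth v \<omega> \<le> real n}" for n :: nat
  proof -
    let ?S = "\<lambda>\<omega>. \<integral>\<^sup>+v. ennreal (weight \<rho> v) * indicator {..real n} (birth v \<omega>) \<partial>count_space UNIV"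
    have "(\<integral>\<^sup>+\<omega>. ?S \<omega> \<partial>M) = (\<integral>\<^sup>+v. \<integral>\<^sup>+\<omega>. ennreal (weight \<rho> v) * indicator {..real n} (birth v \<omega>) \<partial>M \<partial>count_space UNIV)"
      by (rule nn_integral_count_space_nn_integral) auto
    also have "\<dots> = (\<integral>\<^sup>+v. ennreal (weight \<rho> v) * emeasure M {\<omega> \<in> space M. birth v \<omega> \<le> real n} \<partial>count_space UNIV)"
    proof (intro nn_integral_cong)
      fix v
      have "(\<integral>\<^sup>+\<omega>. ennreal (weight \<rho> v) * indicator {..real n} (birth v \<omega>) \<partial>M) =
          (\<integral>\<^sup>+\<omega>. ennreal (weight \<rho> v) * indicator {\<omega> \<in> space M. birth v \<omega> \<le> real n} \<omega> \<partial>M)"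
        by (intro nn_integral_cong) (auto split: split_indicator)
      then show "(\<integral>\<^sup>+\<omega>. ennreal (weight \<rho> v) * indicator {..real n} (birth v \<omega>) \<partial>M) =
          ennreal (weight \<rho> v) * emeasure M {\<omega> \<in> space M. birth v \<omega> \<le> real n}"
        by (simp add: nn_integral_cmult)
    qed
    finally have "(\<integral>\<^sup>+\<omega>. ?S \<omega> \<partial>M) \<noteq> \<infinity>" by (simp add: expected_total_weight)
    then have "AE \<omega> in M. ?S \<omega> \<noteq> \<infinity>"
      by (intro nn_integral_PInf_AE borel_measurable_nn_integral_countable) auto
    then show ?thesis
    proof eventually_elim
      case (elim \<omega>)
      define c where "c = min 1 \<rho>"
      have c: "0 < c" "c \<le> weight \<rho> v" for v using weight_pos by (auto simp: c_def weight_def)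
      show ?case
      proof (rule ccontr)
        assume inf: "infinite {v. birth v \<omega> \<le> real n}"
        have "(\<integral>\<^sup>+v. ennreal c * indicator {v. birth v \<omega> \<le> real n} v \<partial>count_space UNIV) \<le> ?S \<omega>"
          by (intro nn_integral_mono) (auto split: split_indicator intro: ennreal_leI c)
        moreover have "(\<integral>\<^sup>+v. ennreal c * indicator {v. birth v \<omega> \<le> real n} v \<partial>count_space UNIV) = \<infinity>"
          using inf c(1) by (simp add: nn_integral_cmult ennreal_mult_eq_top_iff)
        ultimately show False using elim by (simp add: top_unique)
      qed
    qed
  qed
  then have "AE \<omega> in M. \<forall>n. finite {v. birth v \<omega> \<le> real n}" by (simp add: AE_all_countable)
  then show ?thesis
  proof eventually_elim
    case (elim \<omega>)
    show ?case
    proof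
      fix t :: real
      obtain n :: nat where "t \<le> real n" using real_arch_simple by blast
      then have "{v. birth v \<omega> \<le> t} \<subseteq> {v. birth v \<omega> \<le> real n}" by auto
      then show "finite {v. birth v \<omega> \<le> t}" using elim finite_subset by blast
    qed
  qed
qed

lemma nn_integral_pair_weight:
  "(\<integral>\<^sup>+p. ennreal (pair_weight t r p) \<partial>count_space UNIV) =
    (\<integral>\<^sup>+x. ennreal (exp (5 / 4 * x)) * ((if x \<le> t then ennreal (exp (t - x)) else 0) * (if x \<le> r then ennreal (exp (r - x)) else 0)) \<partial>ancestor_law)"
proof -
  interpret A: finite_measure ancestor_law by (rule finite_measure_ancestor_law)
  interpret C: sigma_finite_measure "count_space UNIV :: (nat \<times> nat) measure"
    by (rule sigma_finite_measure_count_space)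
  let ?P = "ancestor_law \<Otimes>\<^sub>M (count_space UNIV :: (nat \<times> nat) measure)"
  let ?d = "\<lambda>z. ennreal (exp (5 / 4 * fst z)) *
       (arrival_volume (fst (snd z)) (t - fst z) * arrival_volume (snd (snd z)) (r - fst z))"
  have dm: "?d \<in> borel_measurable ?P"
    by (rule measurable_compose_countable'[where I = UNIV and g = snd]) auto
  have "(\<integral>\<^sup>+p. ennreal (pair_weight t r p) \<partial>count_space UNIV) =
      emeasure (distr (density (count_space UNIV) (\<lambda>p. ennreal (pair_weight t r p))) (count_space UNIV) kin) UNIV"
    by (simp add: emeasure_distr emeasure_density)
  also have "\<dots> = (\<integral>\<^sup>+z. ?d z \<partial>?P)"
  proof -
    have "emeasure (distr (density ?P ?d) (count_space UNIV) snd) UNIV = emeasure (density ?P ?d) (space ?P)"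
      by (subst emeasure_distr) auto
    also have "\<dots> = (\<integral>\<^sup>+z. ?d z * indicator (space ?P) z \<partial>?P)"
      by (rule emeasure_density[OF dm sets.top])
    also have "\<dots> = (\<integral>\<^sup>+z. ?d z \<partial>?P)"
      by (intro nn_integral_cong) simp
    finally show ?thesis unfolding distr_kin .
  qed
  also have "\<dots> = (\<integral>\<^sup>+x. \<integral>\<^sup>+q. ?d (x, q) \<partial>count_space UNIV \<partial>ancestor_law)"
    by (rule C.nn_integral_fst[OF dm, symmetric])
  also have "\<dots> = (\<integral>\<^sup>+x. ennreal (exp (5 / 4 * x)) * ((if x \<le> t then ennreal (exp (t - x)) else 0) * (if x \<le> r then ennreal (exp (r - x)) else 0)) \<partial>ancestor_law)"
  proof (intro nn_integral_cong)
    fix x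
    have "(\<integral>\<^sup>+q. ?d (x, q) \<partial>count_space UNIV) = (\<integral>\<^sup>+a. \<integral>\<^sup>+b. ?d (x, (a, b)) \<partial>count_space UNIV \<partial>count_space UNIV)"
      by (rule nn_integral_fst_count_space[symmetric])
    also have "\<dots> = ennreal (exp (5 / 4 * x)) * ((\<Sum>a. arrival_volume a (t - x)) * (\<Sum>b. arrival_volume b (r - x)))"
      by (simp add: nn_integral_cmult nn_integral_multc nn_integral_count_space_nat[symmetric])
    finally show "(\<integral>\<^sup>+q. ?d (x, q) \<partial>count_space UNIV) =
        ennreal (exp (5 / 4 * x)) * ((if x \<le> t then ennreal (exp (t - x)) else 0) * (if x \<le> r then ennreal (exp (r - x)) else 0))"
      by (simp add: suminf_arrival_volume)
  qed
  finally show ?thesis .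
qed

lemma nn_integral_pair_weight_finite: "(\<integral>\<^sup>+p. ennreal (pair_weight t r p) \<partial>count_space UNIV) < \<infinity>"
proof -
  \<comment> \<open>The exponents add up to
    \<open>5/4 * x + (t - x) + (r - x) = t + r - (2 - 5/4) * x\<close>, which is the discount bound
    with \<open>c = 2\<close>.\<close>
  have "(\<integral>\<^sup>+p. ennreal (pair_weight t r p) \<partial>count_space UNIV) \<le>
      (\<integral>\<^sup>+x. ennreal (exp (t + r)) * ennreal (exp (- ((2 - 5 / 4) * x))) \<partial>ancestor_law)"
    unfolding nn_integral_pair_weight
    by (intro nn_integral_mono) (auto simp: ennreal_mult[symmetric] exp_add[symmetric] algebra_simps)
  also have "\<dots> = ennreal (exp (t + r)) * (\<integral>\<^sup>+x. ennreal (exp (- ((2 - 5 / 4) * x))) \<partial>ancestor_law)"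
    by (rule nn_integral_cmult) simp
  also have "\<dots> < \<infinity>"
    using le_less_trans[OF nn_integral_ancestor_law_le[of 2]] by (simp add: ennreal_mult_less_top)
  finally show ?thesis .
qed

end

section \<open>The second moment of the exponential martingale\<close>

context real_branching_random_walk
begin

text \<open>Written as an integral over all nodes, it is measurable by parametric integration,
  whereas the index set of the finite sum is random. If the tree is infinite, a null event, the
  integral takes its default value 0.\<close>

definition node_sum :: "real \<Rightarrow> 'a \<Rightarrow> complex" where
  "node_sum t \<omega> = (\<integral>v. of_real (weight \<rho> v * indicator {..t} (birth v \<omega>)) * iexp (pos v \<omega>) \<partial>count_space UNIV)"

lemma node_sum_measurable [measurable]: "node_sum t \<in> borel_measurable M"
proof -
  interpret C: sigma_finite_measure "count_space UNIV :: node measure"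
    by (rule sigma_finite_measure_count_space)
  have "(\<lambda>z. of_real (weight \<rho> (snd z) * indicator {..t} (birth (snd z) (fst z))) * iexp (pos (snd z) (fst z)))
      \<in> borel_measurable (M \<Otimes>\<^sub>M count_space UNIV)"
    by (rule measurable_compose_countable'[where I = UNIV and g = snd]) auto
  then show ?thesis
    unfolding node_sum_def[abs_def] by (intro C.borel_measurable_lebesgue_integral) (simp add: split_beta')
qed

definition pair_term :: "real \<Rightarrow> real \<Rightarrow> 'a \<Rightarrow> node \<times> node \<Rightarrow> complex" where
  "pair_term t r \<omega> p = of_real (weight \<rho> (fst p) * weight \<rho> (snd p)) *
     (of_real (indicator {..t} (birth (fst p) \<omega>) * indicator {..r} (birth (snd p) \<omega>)) *
      (iexp (pos (fst p) \<omega>) * cnj (iexp (pos (snd p) \<omega>))))"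

lemma cnj_measurable [measurable]: "cnj \<in> borel_measurable borel"
  by (intro borel_measurable_continuous_onI continuous_intros)

text \<open>The phases have modulus 1, so after taking norms only the pair weights remain.\<close>

lemma integrable_pair_term:
  "integrable (M \<Otimes>\<^sub>M count_space UNIV) (\<lambda>(\<omega>, p). pair_term t r \<omega> p)"
proof (rule integrableI_bounded)
  interpret C: sigma_finite_measure "count_space UNIV :: (node \<times> node) measure"
    by (rule sigma_finite_measure_count_space)
  interpret P: pair_sigma_finite M "count_space UNIV :: (node \<times> node) measure" ..
  show m: "(\<lambda>(\<omega>, p). pair_term t r \<omega> p) \<in> borel_measurable (M \<Otimes>\<^sub>M count_space UNIV)"
    unfolding split_beta'
    by (rule measurable_compose_countable'[where I = UNIV and g = snd]) (auto simp: pair_term_def)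
  have "(\<integral>\<^sup>+z. ennreal (norm (case z of (\<omega>, p) \<Rightarrow> pair_term t r \<omega> p)) \<partial>(M \<Otimes>\<^sub>M count_space UNIV)) =
      (\<integral>\<^sup>+p. \<integral>\<^sup>+\<omega>. ennreal (norm (pair_term t r \<omega> p)) \<partial>M \<partial>count_space UNIV)"
    using m by (subst P.nn_integral_snd[symmetric]) auto
  also have "\<dots> = (\<integral>\<^sup>+p. ennreal (pair_weight t r p) \<partial>count_space UNIV)"
  proof (intro nn_integral_cong)
    fix p
    have "norm (pair_term t r \<omega> p) = weight \<rho> (fst p) * weight \<rho> (snd p) *
        (indicator {..t} (birth (fst p) \<omega>) * indicator {..r} (birth (snd p) \<omega>))" for \<omega>
      using weight_pos' by (simp add: pair_term_def norm_mult less_imp_le)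
    then have "(\<integral>\<^sup>+\<omega>. ennreal (norm (pair_term t r \<omega> p)) \<partial>M) =
        (\<integral>\<^sup>+\<omega>. ennreal (weight \<rho> (fst p) * weight \<rho> (snd p)) * (indicator {..t} (birth (fst p) \<omega>) * indicator {..r} (birth (snd p) \<omega>)) \<partial>M)"
      using weight_pos' by (intro nn_integral_cong) (auto split: split_indicator)
    then show "(\<integral>\<^sup>+\<omega>. ennreal (norm (pair_term t r \<omega> p)) \<partial>M) = ennreal (pair_weight t r p)"
      unfolding ennreal_pair_weight by (simp add: nn_integral_cmult)
  qed
  also have "\<dots> < \<infinity>" by (rule nn_integral_pair_weight_finite)
  finally show "(\<integral>\<^sup>+z. ennreal (norm (case z of (\<omega>, p) \<Rightarrow> pair_term t r \<omega> p)) \<partial>(M \<Otimes>\<^sub>M count_space UNIV)) < \<infinity>" .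
qed

text \<open>Tree and offsets are independent, and the expected phase depends on the pair only
  through its two generation gaps.\<close>

lemma expectation_pair_term:
  assumes t: "0 \<le> t" "0 \<le> r"
  shows "(\<integral>\<omega>. pair_term t r \<omega> p \<partial>M) = pair_weight t r p *\<^sub>R (\<phi> ^ fst (kin p) * cnj \<phi> ^ snd (kin p))"
proof -
  let ?Z = "\<lambda>\<omega>. iexp (pos (fst p) \<omega>) * cnj (iexp (pos (snd p) \<omega>))"
  have "?Z \<in> borel_measurable (sigma (space M) offset_events)" by measurable
  moreover have "integrable M ?Z" by (rule integrable_const_bound[of _ 1]) (auto simp: norm_mult)
  moreover have "(\<integral>\<omega>. ?Z \<omega> \<partial>M) = \<phi> ^ fst (kin p) * cnj \<phi> ^ snd (kin p)"
    using mem_kinship[of p] by (intro expectation_iexp_kinship) simp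
  ultimately show ?thesis
    unfolding pair_term_def pair_weight_def
    by (simp add: integral_tree_offset[OF t] scaleR_conv_of_real mult.assoc del: of_real_mult)
      (simp add: mult.assoc)
qed

lemma AE_node_sum_product:
  "AE \<omega> in M. node_sum t \<omega> * cnj (node_sum r \<omega>) = (\<integral>p. pair_term t r \<omega> p \<partial>count_space UNIV)"
  using AE_finite_tree
proof eventually_elim
  case (elim \<omega>)
  have int: "integrable (count_space UNIV) (\<lambda>v. of_real (weight \<rho> v * indicator {..t} (birth v \<omega>)) * iexp (pos v \<omega>))" for t
  proof -
    have "finite {v. birth v \<omega> \<le> t}" using elim by blast
    then show ?thesis
      by (intro integrable_count_space_finite_support[of "{v. birth v \<omega> \<le> t}"]) auto
  qed
  have intc: "integrable (count_space UNIV) (\<lambda>v. cnj (of_real (weight \<rho> v * indicator {..r} (birth v \<omega>)) * iexp (pos v \<omega>)))"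
    using int[of r] by (rule integrable_cnj)
  have "node_sum t \<omega> * cnj (node_sum r \<omega>) =
      (\<integral>p. (of_real (weight \<rho> (fst p) * indicator {..t} (birth (fst p) \<omega>)) * iexp (pos (fst p) \<omega>)) *
        cnj (of_real (weight \<rho> (snd p) * indicator {..r} (birth (snd p) \<omega>)) * iexp (pos (snd p) \<omega>)) \<partial>count_space UNIV)"
    unfolding integral_count_space_product(2)[OF int intc] node_sum_def by (simp only: Bochner_Integration.integral_cnj)
  then show ?case
    unfolding pair_term_def by (simp add: mult_ac)
qed

text \<open>The expected node sum, by time \<open>t\<close>, over the progeny of a node of weight 1
  born at time \<open>x\<close> and placed at the origin.\<close>

definition discount :: "real \<Rightarrow> real \<Rightarrow> complex" where
  "discount t x = (if x \<le> t then exp (\<phi> * of_real (t - x)) else 0)"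

lemma norm_\<phi>: "norm \<phi> \<le> 1"
  using real_distribution.cmod_char_le_1[of D 1] offsets_law[of "[]"]
  by (metis offset_measurable prob_space_axioms real_distribution_distr)

text \<open>The product of two node sums is a sum over pairs whose expectation depends on the gaps
  below the common ancestor. For an ancestor born at \<open>x\<close>, the sum over the gaps splits
  into one factor per line of descent.\<close>

lemma second_moment:
  assumes t: "0 \<le> t" "0 \<le> r"
  shows "integrable M (\<lambda>\<omega>. node_sum t \<omega> * cnj (node_sum r \<omega>))"
    and "integrable ancestor_law (\<lambda>x. exp (5 / 4 * x) *\<^sub>R (discount t x * cnj (discount r x)))"
    and "(\<integral>\<omega>. node_sum t \<omega> * cnj (node_sum r \<omega>) \<partial>M) =
      (\<integral>x. exp (5 / 4 * x) *\<^sub>R (discount t x * cnj (discount r x)) \<partial>ancestor_law)"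
proof -
  interpret A: finite_measure ancestor_law by (rule finite_measure_ancestor_law)
  interpret C: sigma_finite_measure "count_space UNIV :: (nat \<times> nat) measure"
    by (rule sigma_finite_measure_count_space)
  interpret C': sigma_finite_measure "count_space UNIV :: (node \<times> node) measure"
    by (rule sigma_finite_measure_count_space)
  interpret P: pair_sigma_finite ancestor_law "count_space UNIV :: (nat \<times> nat) measure" ..
  interpret P': pair_sigma_finite M "count_space UNIV :: (node \<times> node) measure" ..
  let ?P = "ancestor_law \<Otimes>\<^sub>M (count_space UNIV :: (nat \<times> nat) measure)"
  define d where "d z = exp (5 / 4 * fst z) *
      (enn2real (arrival_volume (fst (snd z)) (t - fst z)) * enn2real (arrival_volume (snd (snd z)) (r - fst z)))"
    for z :: "real \<times> nat \<times> nat"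
  have d0: "0 \<le> d z" for z by (simp add: d_def)
  have dm [measurable]: "d \<in> borel_measurable ?P"
    unfolding d_def[abs_def] by (rule measurable_compose_countable'[where I = UNIV and g = snd]) auto
  have av: "arrival_volume n y = ennreal (enn2real (arrival_volume n y))" for n y
    by (simp add: arrival_volume_def)
  have de: "ennreal (exp (5 / 4 * fst z)) *
      (arrival_volume (fst (snd z)) (t - fst z) * arrival_volume (snd (snd z)) (r - fst z)) = ennreal (d z)" for z
    unfolding d_def
    by (subst (1 2) av) (simp add: ennreal_mult)
  have dk: "distr (density (count_space UNIV) (\<lambda>p. ennreal (pair_weight t r p))) (count_space UNIV) kin =
      distr (density ?P (\<lambda>z. ennreal (d z))) (count_space UNIV) snd"
    using distr_kin[of t r] unfolding de .
  have dfin: "(\<integral>\<^sup>+z. ennreal (d z) \<partial>?P) < \<infinity>"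
  proof -
    have "(\<integral>\<^sup>+z. ennreal (d z) \<partial>?P) = emeasure (distr (density ?P (\<lambda>z. ennreal (d z))) (count_space UNIV) snd) UNIV"
      by (subst emeasure_distr) (auto simp: emeasure_density intro!: nn_integral_cong)
    also have "\<dots> = (\<integral>\<^sup>+p. ennreal (pair_weight t r p) \<partial>count_space UNIV)"
      unfolding dk[symmetric] by (simp add: emeasure_distr emeasure_density)
    finally show ?thesis using nn_integral_pair_weight_finite[of t r] by simp
  qed
  define f where "f q = \<phi> ^ fst q * cnj \<phi> ^ snd q" for q :: "nat \<times> nat"
  have f1: "norm (f q) \<le> 1" for q
    using norm_\<phi> by (auto simp: f_def norm_mult norm_power intro!: mult_le_one power_le_one)
  have fm [measurable]: "(\<lambda>z. f (snd z)) \<in> borel_measurable ?P"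
    by (rule measurable_compose[OF measurable_snd]) simp
  have int: "integrable ?P (\<lambda>z. d z *\<^sub>R f (snd z))"
  proof (rule integrableI_bounded)
    have "(\<integral>\<^sup>+z. ennreal (norm (d z *\<^sub>R f (snd z))) \<partial>?P) \<le> (\<integral>\<^sup>+z. ennreal (d z) \<partial>?P)"
      using d0 f1 by (intro nn_integral_mono ennreal_leI) (auto intro: mult_left_le)
    then show "(\<integral>\<^sup>+z. ennreal (norm (d z *\<^sub>R f (snd z))) \<partial>?P) < \<infinity>"
      using dfin by (rule le_less_trans)
  qed measurable
  \<comment> \<open>With the birth time of the common ancestor fixed, the double sum over the gaps
    is a product of two exponential series.\<close>
  have inner: "(\<integral>q. d (x, q) *\<^sub>R f q \<partial>count_space UNIV) = exp (5 / 4 * x) *\<^sub>R (discount t x * cnj (discount r x))" for x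
  proof -
    let ?a = "\<lambda>n. enn2real (arrival_volume n (t - x)) *\<^sub>R \<phi> ^ n"
    let ?b = "\<lambda>n. enn2real (arrival_volume n (r - x)) *\<^sub>R cnj \<phi> ^ n"
    have "(\<integral>q. d (x, q) *\<^sub>R f q \<partial>count_space UNIV) =
        (\<integral>q. exp (5 / 4 * x) *\<^sub>R (?a (fst q) * ?b (snd q)) \<partial>count_space UNIV)"
      by (rule Bochner_Integration.integral_cong) (simp_all add: d_def f_def scaleR_conv_of_real mult_ac)
    also have "\<dots> = exp (5 / 4 * x) *\<^sub>R (\<integral>q. ?a (fst q) * ?b (snd q) \<partial>count_space UNIV)"
      by (intro integral_bounded_linear[OF bounded_linear_scaleR_right] integral_count_space_product(1)
          has_integral_arrival_volume(1))
    also have "(\<integral>q. ?a (fst q) * ?b (snd q) \<partial>count_space UNIV) =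
        (\<integral>n. ?a n \<partial>count_space UNIV) * (\<integral>n. ?b n \<partial>count_space UNIV)"
      by (rule integral_count_space_product(2)) (rule has_integral_arrival_volume(1))+
    also have "\<dots> = discount t x * cnj (discount r x)"
      unfolding has_integral_arrival_volume(2) by (simp add: discount_def exp_cnj)
    finally show ?thesis .
  qed
  show "integrable ancestor_law (\<lambda>x. exp (5 / 4 * x) *\<^sub>R (discount t x * cnj (discount r x)))"
    using P.integrable_fst'[OF int] by (simp add: inner)
  note ip = integrable_pair_term[of t r]
  have ae: "AE \<omega> in M. (\<integral>p. pair_term t r \<omega> p \<partial>count_space UNIV) = node_sum t \<omega> * cnj (node_sum r \<omega>)"
    using AE_node_sum_product[of t r] by eventually_elim simp
  have nsm: "node_sum t \<in> borel_measurable M" for t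
    by (rule node_sum_measurable)
  have "integrable M (\<lambda>\<omega>. \<integral>p. pair_term t r \<omega> p \<partial>count_space UNIV)"
    using P'.integrable_fst[OF ip] .
  then show "integrable M (\<lambda>\<omega>. node_sum t \<omega> * cnj (node_sum r \<omega>))"
    using nsm ae by (subst integrable_cong_AE[OF _ _ ae, symmetric]) auto
  have "(\<integral>\<omega>. node_sum t \<omega> * cnj (node_sum r \<omega>) \<partial>M) = (\<integral>\<omega>. \<integral>p. pair_term t r \<omega> p \<partial>count_space UNIV \<partial>M)"
    using nsm ae P'.integrable_fst[OF ip] by (intro integral_cong_AE) auto
  also have "\<dots> = (\<integral>p. \<integral>\<omega>. pair_term t r \<omega> p \<partial>M \<partial>count_space UNIV)"
    by (rule P'.Fubini_integral[OF ip, symmetric])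
  \<comment> \<open>From here on the pair enters through \<open>kin\<close> alone, so the measure on
    pairs may be replaced by its image, which \<open>distr_kin\<close> rewrites in terms of the
    birth time of the common ancestor.\<close>
  also have "\<dots> = (\<integral>p. pair_weight t r p *\<^sub>R f (kin p) \<partial>count_space UNIV)"
    by (simp add: expectation_pair_term[OF t] f_def)
  also have "\<dots> = (\<integral>p. f (kin p) \<partial>density (count_space UNIV) (\<lambda>p. ennreal (pair_weight t r p)))"
    by (subst integral_density) (auto simp: pair_weight_nonneg)
  also have "\<dots> = (\<integral>q. f q \<partial>distr (density (count_space UNIV) (\<lambda>p. ennreal (pair_weight t r p))) (count_space UNIV) kin)"
    by (subst integral_distr) auto
  also have "\<dots> = (\<integral>z. f (snd z) \<partial>density ?P (\<lambda>z. ennreal (d z)))"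
    unfolding dk by (subst integral_distr) auto
  also have "\<dots> = (\<integral>z. d z *\<^sub>R f (snd z) \<partial>?P)"
    by (subst integral_density) (auto simp: d0)
  also have "\<dots> = (\<integral>x. \<integral>q. d (x, q) *\<^sub>R f q \<partial>count_space UNIV \<partial>ancestor_law)"
    using P.integral_fst'[OF int] by simp
  finally show "(\<integral>\<omega>. node_sum t \<omega> * cnj (node_sum r \<omega>) \<partial>M) =
      (\<integral>x. exp (5 / 4 * x) *\<^sub>R (discount t x * cnj (discount r x)) \<partial>ancestor_law)"
    unfolding inner .
qed

definition martingale :: "real \<Rightarrow> 'a \<Rightarrow> complex" where
  "martingale t \<omega> = exp (- \<phi> * of_real t) * node_sum t \<omega>"

lemma martingale_measurable [measurable]: "martingale t \<in> borel_measurable M"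
  unfolding martingale_def[abs_def] by measurable

text \<open>After normalization the factor involving \<open>t\<close> cancels and only the cut-off
  at \<open>t\<close> is left. An increment of the martingale therefore sees only common ancestors
  born between the two times.\<close>

definition decay :: "real \<Rightarrow> real \<Rightarrow> complex" where
  "decay t x = (if x \<le> t then exp (- \<phi> * of_real x) else 0)"

lemma martingale_moment:
  assumes t: "0 \<le> t" "0 \<le> r"
  shows "integrable M (\<lambda>\<omega>. martingale t \<omega> * cnj (martingale r \<omega>))"
    and "integrable ancestor_law (\<lambda>x. exp (5 / 4 * x) *\<^sub>R (decay t x * cnj (decay r x)))"
    and "(\<integral>\<omega>. martingale t \<omega> * cnj (martingale r \<omega>) \<partial>M) =
      (\<integral>x. exp (5 / 4 * x) *\<^sub>R (decay t x * cnj (decay r x)) \<partial>ancestor_law)"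
proof -
  let ?c = "exp (- \<phi> * of_real t) * cnj (exp (- \<phi> * of_real r))"
  have dd: "decay t x = exp (- \<phi> * of_real t) * discount t x" for t x
    by (simp add: decay_def discount_def exp_add[symmetric] algebra_simps)
  have m: "martingale t \<omega> * cnj (martingale r \<omega>) = ?c * (node_sum t \<omega> * cnj (node_sum r \<omega>))" for \<omega>
    by (simp add: martingale_def mult_ac)
  have a: "exp (5 / 4 * x) *\<^sub>R (decay t x * cnj (decay r x)) = ?c * (exp (5 / 4 * x) *\<^sub>R (discount t x * cnj (discount r x)))" for x
    by (simp add: dd scaleR_conv_of_real mult_ac)
  show "integrable M (\<lambda>\<omega>. martingale t \<omega> * cnj (martingale r \<omega>))"
    unfolding m by (intro integrable_mult_right second_moment t)
  show "integrable ancestor_law (\<lambda>x. exp (5 / 4 * x) *\<^sub>R (decay t x * cnj (decay r x)))"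
    unfolding a by (intro integrable_mult_right second_moment t)
  show "(\<integral>\<omega>. martingale t \<omega> * cnj (martingale r \<omega>) \<partial>M) =
      (\<integral>x. exp (5 / 4 * x) *\<^sub>R (decay t x * cnj (decay r x)) \<partial>ancestor_law)"
    unfolding m a by (simp only: integral_mult_right_zero second_moment(3)[OF t])
qed

text \<open>The second-moment formula is sesquilinear, so it passes to the increment with
  \<open>decay t - decay r\<close> in place of \<open>decay\<close>. This difference is supported on
  births in the interval from \<open>r\<close> to \<open>t\<close>, where the integrand is
  exponentially small.\<close>

lemma martingale_increment:
  assumes r: "0 \<le> r" "r \<le> t" and \<phi>: "3 / 4 \<le> Re \<phi>"
  shows "(\<integral>\<^sup>+\<omega>. ennreal ((norm (martingale t \<omega> - martingale r \<omega>))\<^sup>2) \<partial>M) \<le>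
    ennreal (measure ancestor_law UNIV * exp (- (r / 4)))"
proof -
  interpret A: finite_measure ancestor_law by (rule finite_measure_ancestor_law)
  have t: "0 \<le> t" using r by simp
  note mm = martingale_moment
  let ?m = "martingale"
  let ?q = "\<lambda>s u \<omega>. ?m s \<omega> * cnj (?m u \<omega>)"
  let ?g = "\<lambda>s u x. exp (5 / 4 * x) *\<^sub>R (decay s x * cnj (decay u x))"
  \<comment> \<open>The square is expanded into four products because the moment formula is
    available for products of two values.\<close>
  have sq: "of_real ((norm (?m t \<omega> - ?m r \<omega>))\<^sup>2) = ?q t t \<omega> - ?q t r \<omega> - (?q r t \<omega> - ?q r r \<omega>)" for \<omega>
    by (simp add: complex_norm_square algebra_simps del: of_real_power)
  have sq': "of_real (exp (5 / 4 * x) * (norm (decay t x - decay r x))\<^sup>2) = ?g t t x - ?g t r x - (?g r t x - ?g r r x)" for x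
    unfolding of_real_mult complex_norm_square scaleR_conv_of_real by (simp add: algebra_simps)
  note I = mm(1)[OF t t] mm(1)[OF t r(1)] mm(1)[OF r(1) t] mm(1)[OF r(1) r(1)]
  note J = mm(2)[OF t t] mm(2)[OF t r(1)] mm(2)[OF r(1) t] mm(2)[OF r(1) r(1)]
  have i1: "integrable M (\<lambda>\<omega>. complex_of_real ((norm (?m t \<omega> - ?m r \<omega>))\<^sup>2))"
    unfolding sq by (intro Bochner_Integration.integrable_diff I)
  have i2: "integrable ancestor_law (\<lambda>x. complex_of_real (exp (5 / 4 * x) * (norm (decay t x - decay r x))\<^sup>2))"
    unfolding sq' by (intro Bochner_Integration.integrable_diff J)
  have "complex_of_real (\<integral>\<omega>. (norm (?m t \<omega> - ?m r \<omega>))\<^sup>2 \<partial>M) = (\<integral>\<omega>. of_real ((norm (?m t \<omega> - ?m r \<omega>))\<^sup>2) \<partial>M)"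
    by (simp del: of_real_power)
  also have "\<dots> = (\<integral>x. of_real (exp (5 / 4 * x) * (norm (decay t x - decay r x))\<^sup>2) \<partial>ancestor_law)"
    unfolding sq sq' using I J
    by (simp add: mm(3)[OF t t] mm(3)[OF t r(1)] mm(3)[OF r(1) t] mm(3)[OF r(1) r(1)] del: integral_scaleR_right)
  also have "\<dots> = complex_of_real (\<integral>x. exp (5 / 4 * x) * (norm (decay t x - decay r x))\<^sup>2 \<partial>ancestor_law)"
    by (simp del: of_real_mult)
  finally have eq: "(\<integral>\<omega>. (norm (?m t \<omega> - ?m r \<omega>))\<^sup>2 \<partial>M) =
      (\<integral>x. exp (5 / 4 * x) * (norm (decay t x - decay r x))\<^sup>2 \<partial>ancestor_law)"
    by (simp only: of_real_eq_iff)
  have "(\<integral>\<^sup>+\<omega>. ennreal ((norm (?m t \<omega> - ?m r \<omega>))\<^sup>2) \<partial>M) = ennreal (\<integral>\<omega>. (norm (?m t \<omega> - ?m r \<omega>))\<^sup>2 \<partial>M)"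
    using i1 by (intro nn_integral_eq_integral) (simp_all only: complex_of_real_integrable_eq, simp)
  also have "\<dots> \<le> ennreal (\<integral>x. exp (- (r / 4)) \<partial>ancestor_law)"
    unfolding eq
  proof (intro ennreal_leI integral_mono)
    show "integrable ancestor_law (\<lambda>x. exp (5 / 4 * x) * (norm (decay t x - decay r x))\<^sup>2)"
      using i2 by (simp only: complex_of_real_integrable_eq)
    fix x
    show "exp (5 / 4 * x) * (norm (decay t x - decay r x))\<^sup>2 \<le> exp (- (r / 4))"
    proof (cases "r < x \<and> x \<le> t")
      case True
      then have "norm (decay t x - decay r x) = exp (- (Re \<phi> * x))" by (simp add: decay_def)
      then have "exp (5 / 4 * x) * (norm (decay t x - decay r x))\<^sup>2 = exp (5 / 4 * x - 2 * Re \<phi> * x)"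
        by (simp add: power2_eq_square exp_add[symmetric])
      also have "\<dots> \<le> exp (- (r / 4))"
      proof -
        \<comment> \<open>The exponent is thus at most \<open>5/4 * x - 3/2 * x = - x / 4\<close>,
          and \<open>x\<close> exceeds \<open>r\<close>.\<close>
        have "3 / 4 * x \<le> Re \<phi> * x" using \<phi> True r by (intro mult_right_mono) auto
        then show ?thesis using True by simp
      qed
      finally show ?thesis .
    next
      case False
      then have "decay t x - decay r x = 0" using r by (auto simp: decay_def)
      then show ?thesis by simp
    qed
  qed auto
  finally show ?thesis by (simp add: mult.commute)
qed

end

section \<open>The total weight of the tree\<close>

text \<open>Borel-Cantelli in integrated form: by monotone convergence the expected sum from
  \<open>N\<close> on is finite, so the sum is finite almost surely.\<close>

lemma (in prob_space) AE_tendsto_zero_of_summable: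
  fixes Y :: "nat \<Rightarrow> 'a \<Rightarrow> real"
  assumes [measurable]: "\<And>n. Y n \<in> borel_measurable M"
    and bound: "\<forall>\<^sub>F n in sequentially. (\<integral>\<^sup>+\<omega>. ennreal \<bar>Y n \<omega>\<bar> \<partial>M) \<le> ennreal (b n)"
    and b: "summable b" "\<And>n. 0 \<le> b n"
  shows "AE \<omega> in M. summable (\<lambda>n. \<bar>Y n \<omega>\<bar>)"
proof -
  obtain N where N: "\<And>n. (\<integral>\<^sup>+\<omega>. ennreal \<bar>Y (n + N) \<omega>\<bar> \<partial>M) \<le> ennreal (b (n + N))"
    using bound unfolding eventually_sequentially by (metis le_add2)
  have "(\<integral>\<^sup>+\<omega>. (\<Sum>n. ennreal \<bar>Y (n + N) \<omega>\<bar>) \<partial>M) = (\<Sum>n. \<integral>\<^sup>+\<omega>. ennreal \<bar>Y (n + N) \<omega>\<bar> \<partial>M)"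
    by (rule nn_integral_suminf) measurable
  also have "\<dots> \<le> (\<Sum>n. ennreal (b (n + N)))"
    by (intro suminf_le N) auto
  also have "\<dots> = ennreal (\<Sum>n. b (n + N))"
    using b by (intro suminf_ennreal2) (auto simp: summable_iff_shift)
  finally have "(\<integral>\<^sup>+\<omega>. (\<Sum>n. ennreal \<bar>Y (n + N) \<omega>\<bar>) \<partial>M) \<noteq> \<infinity>"
    by (auto simp: top_unique)
  then have "AE \<omega> in M. (\<Sum>n. ennreal \<bar>Y (n + N) \<omega>\<bar>) \<noteq> \<infinity>"
    by (rule nn_integral_PInf_AE[rotated]) measurable
  then show ?thesis
  proof eventually_elim
    case (elim \<omega>)
    then have "summable (\<lambda>n. \<bar>Y (n + N) \<omega>\<bar>)" by (intro summable_suminf_not_top) auto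
    then show ?case using summable_iff_shift[of "\<lambda>n. \<bar>Y n \<omega>\<bar>" N] by blast
  qed
qed

lemma lebesgue_integral_count_space_finite_support':
  fixes f :: "'x \<Rightarrow> 'y :: {banach, second_countable_topology}"
  assumes "finite A" and "\<And>x. x \<notin> A \<Longrightarrow> f x = 0"
  shows "(\<integral>x. f x \<partial>count_space UNIV) = (\<Sum>x\<in>A. f x)"
proof -
  have sub: "{x. f x \<noteq> 0} \<subseteq> A" using assms(2) by auto
  have "(\<integral>x. f x \<partial>count_space UNIV) = (\<Sum>x | x \<in> UNIV \<and> f x \<noteq> 0. f x)"
    using finite_subset[OF sub assms(1)] by (intro lebesgue_integral_count_space_finite_support) simp
  also have "\<dots> = (\<Sum>x\<in>A. f x)"
    using assms sub by (intro sum.mono_neutral_left) auto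
  finally show ?thesis .
qed

text \<open>With zero offsets all phases are 1 and the node sum is the total weight, so the moment
  bounds for the weight become instances of those for the walk. The independence requirements hold
  because constants generate only trivial events.\<close>

lemma yule_branching_random_walk_zero:
  assumes "weighted_yule_tree M \<rho> age"
  shows "real_branching_random_walk M \<rho> age (\<lambda>_ _. 0) (return borel 0)"
proof -
  interpret weighted_yule_tree M \<rho> age by fact
  have iv: "indep_vars (\<lambda>_. borel) (\<lambda>(_ :: node) (_ :: 'a). 0 :: real) UNIV"
    unfolding indep_vars_def2 indep_sets_def
  proof (intro conjI ballI allI impI)
    show "{(\<lambda>_. 0 :: real) -` A \<inter> space M |A. A \<in> sets borel} \<subseteq> events"
      by (auto intro!: measurable_sets)
  next
    fix J :: "node set" and A
    assume J: "J \<noteq> {}" "finite J" and A: "A \<in> Pi J (\<lambda>i. {(\<lambda>_. 0 :: real) -` A \<inter> space M |A. A \<in> sets borel})"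
    have A01: "A j = {} \<or> A j = space M" if "j \<in> J" for j
    proof -
      obtain B where "A j = (\<lambda>_. 0 :: real) -` B \<inter> space M" using A \<open>j \<in> J\<close> by blast
      then show ?thesis by (cases "0 \<in> B") auto
    qed
    show "prob (\<Inter>j\<in>J. A j) = (\<Prod>j\<in>J. prob (A j))"
    proof (cases "\<exists>j\<in>J. A j = {}")
      case True
      then have "(\<Inter>j\<in>J. A j) = {}" by auto
      moreover have "(\<Prod>j\<in>J. prob (A j)) = 0" using True J(2) by (metis measure_empty prod_zero)
      ultimately show ?thesis by simp
    next
      case False
      then have "\<And>j. j \<in> J \<Longrightarrow> A j = space M" using A01 by blast
      then show ?thesis using J by (simp add: prob_space)
    qed
  qed simp
  have set: "indep_set (sigma_sets (space M) {{\<omega> \<in> space M. v \<in> random_tree age \<omega> t} | v t. 0 \<le> t})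
      (sigma_sets (space M) {(\<lambda>_. 0 :: real) -` B \<inter> space M | (v :: node) B. B \<in> sets borel})"
  proof -
    have sub: "{(\<lambda>_. 0 :: real) -` B \<inter> space M | (v :: node) B. B \<in> sets borel} \<subseteq> {{}, space M}"
      by auto
    have triv: "sigma_sets (space M) {(\<lambda>_. 0 :: real) -` B \<inter> space M | (v :: node) B. B \<in> sets borel} \<subseteq> {{}, space M}"
      using sigma_sets_mono'[OF sub, of "space M"]
      unfolding sigma_algebra.sigma_sets_eq[OF sigma_algebra_trivial[of "space M"]] .
    have ev: "sigma_sets (space M) {{\<omega> \<in> space M. v \<in> random_tree age \<omega> t} | v t. 0 \<le> t} \<subseteq> events"
    proof (rule sets.sigma_sets_subset, safe)
      fix v t show "{\<omega> \<in> space M. v \<in> random_tree age \<omega> t} \<in> events"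
        unfolding mem_random_tree by measurable
    qed
    have "indep_set A B" if "A \<subseteq> events" "B \<subseteq> {{}, space M}" for A B
      unfolding indep_sets2_eq
    proof (intro conjI ballI)
      fix a b assume "a \<in> A" "b \<in> B"
      then have "a \<in> events" "b = {} \<or> b = space M" using that by auto
      moreover from this(1) have "a \<inter> space M = a" using sets.sets_into_space by blast
      ultimately show "prob (a \<inter> b) = prob a * prob b" by (auto simp: prob_space)
    qed (use that in auto)
    from this[OF ev triv] show ?thesis .
  qed
  show ?thesis
  proof (intro real_branching_random_walk.intro yule_branching_random_walk.intro assms
      yule_branching_random_walk_axioms.intro)
    show "distr M borel (\<lambda>_. 0 :: real) = return borel 0"
      by (rule measure_eqI) (auto simp: emeasure_distr emeasure_space_1 split: split_indicator)
  qed (use iv set in auto)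
qed

context real_branching_random_walk
begin

lemma node_sum_eq_sum:
  assumes "finite (random_tree age \<omega> t)"
  shows "node_sum t \<omega> = (\<Sum>v\<in>random_tree age \<omega> t. of_real (weight \<rho> v) * iexp (pos v \<omega>))"
proof -
  have "node_sum t \<omega> = (\<Sum>v\<in>random_tree age \<omega> t. of_real (weight \<rho> v * indicator {..t} (birth v \<omega>)) * iexp (pos v \<omega>))"
    unfolding node_sum_def using assms
    by (intro lebesgue_integral_count_space_finite_support')
      (auto simp: mem_random_tree)
  also have "\<dots> = (\<Sum>v\<in>random_tree age \<omega> t. of_real (weight \<rho> v) * iexp (pos v \<omega>))"
    by (intro sum.cong) (auto simp: mem_random_tree)
  finally show ?thesis .
qed

end

context weighted_yule_tree
begin

lemma AE_finite_random_tree: "AE \<omega> in M. \<forall>t. finite (random_tree age \<omega> t)"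
  using AE_finite_tree by (simp add: random_tree_def tree_def birth_def)

lemma random_tree_mono: "s \<le> t \<Longrightarrow> random_tree age \<omega> s \<subseteq> random_tree age \<omega> t"
  by (auto simp: mem_random_tree)

definition normalized_weight :: "real \<Rightarrow> 'a \<Rightarrow> real" where
  "normalized_weight t \<omega> = exp (- t) * total_weight \<rho> (random_tree age \<omega> t)"

lemma total_weight_nonneg: "0 \<le> total_weight \<rho> A"
  using weight_pos' by (auto simp: total_weight_def less_imp_le intro: sum_nonneg)

lemma normalized_weight_nonneg: "0 \<le> normalized_weight t \<omega>"
  by (simp add: normalized_weight_def total_weight_nonneg)

lemma total_weight_mono: "finite B \<Longrightarrow> A \<subseteq> B \<Longrightarrow> total_weight \<rho> A \<le> total_weight \<rho> B"
  using weight_pos' by (auto simp: total_weight_def less_imp_le intro: sum_mono2)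

text \<open>For an infinite tree both sides are 0 by default, the sum over an infinite set and the
  integral of a nonintegrable function. The identity thus holds everywhere and yields
  measurability.\<close>

lemma total_weight_eq_integral:
  "total_weight \<rho> (random_tree age \<omega> t) = (\<integral>v. weight \<rho> v * indicator {..t} (birth v \<omega>) \<partial>count_space UNIV)"
proof (cases "finite (random_tree age \<omega> t)")
  case True
  have "(\<integral>v. weight \<rho> v * indicator {..t} (birth v \<omega>) \<partial>count_space UNIV) =
      (\<Sum>v\<in>random_tree age \<omega> t. weight \<rho> v * indicator {..t} (birth v \<omega>))"
    using True by (intro lebesgue_integral_count_space_finite_support') (auto simp: mem_random_tree)
  also have "\<dots> = total_weight \<rho> (random_tree age \<omega> t)"
    unfolding total_weight_def by (intro sum.cong) (auto simp: mem_random_tree)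
  finally show ?thesis by simp
next
  case False
  have "\<not> integrable (count_space UNIV) (\<lambda>v. weight \<rho> v * indicator {..t} (birth v \<omega>))"
  proof
    assume "integrable (count_space UNIV) (\<lambda>v. weight \<rho> v * indicator {..t} (birth v \<omega>))"
    then have "(\<integral>\<^sup>+v. ennreal (norm (weight \<rho> v * indicator {..t} (birth v \<omega>))) \<partial>count_space UNIV) < \<infinity>"
      by (simp add: integrable_iff_bounded)
    moreover have "(\<integral>\<^sup>+v. ennreal (min 1 \<rho>) * indicator (random_tree age \<omega> t) v \<partial>count_space UNIV) \<le>
        (\<integral>\<^sup>+v. ennreal (norm (weight \<rho> v * indicator {..t} (birth v \<omega>))) \<partial>count_space UNIV)"
      by (intro nn_integral_mono) (auto simp: mem_random_tree weight_def split: split_indicator intro!: ennreal_leI)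
    moreover have "(\<integral>\<^sup>+v. ennreal (min 1 \<rho>) * indicator (random_tree age \<omega> t) v \<partial>count_space UNIV) = \<infinity>"
      using False weight_pos by (simp add: nn_integral_cmult ennreal_mult_eq_top_iff)
    ultimately show False by simp
  qed
  then show ?thesis using False by (simp add: total_weight_def not_integrable_integral_eq)
qed

lemma normalized_weight_measurable [measurable]: "normalized_weight t \<in> borel_measurable M"
proof -
  interpret C: sigma_finite_measure "count_space UNIV :: node measure"
    by (rule sigma_finite_measure_count_space)
  have "(\<lambda>z. weight \<rho> (snd z) * indicator {..t} (birth (snd z) (fst z)))
      \<in> borel_measurable (M \<Otimes>\<^sub>M count_space UNIV)"
    by (rule measurable_compose_countable'[where I = UNIV and g = snd]) auto
  then have [measurable]: "(\<lambda>\<omega>. \<integral>v. weight \<rho> v * indicator {..t} (birth v \<omega>) \<partial>count_space UNIV) \<in> borel_measurable M"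
    by (intro C.borel_measurable_lebesgue_integral) (simp add: split_beta')
  show ?thesis unfolding normalized_weight_def[abs_def] total_weight_eq_integral by measurable
qed

text \<open>Both bounds come from the walk with zero offsets, whose characteristic function is
  1.\<close>

lemma
  shows normalized_weight_increment: "0 \<le> r \<Longrightarrow> r \<le> t \<Longrightarrow>
      (\<integral>\<^sup>+\<omega>. ennreal ((normalized_weight t \<omega> - normalized_weight r \<omega>)\<^sup>2) \<partial>M) \<le>
        ennreal (measure ancestor_law UNIV * exp (- (r / 4)))"
    and normalized_weight_second_moment: "\<rho> = 1 \<Longrightarrow> 0 \<le> t \<Longrightarrow>
      (\<integral>\<^sup>+\<omega>. ennreal ((normalized_weight t \<omega>)\<^sup>2) \<partial>M) \<le> 2"
proof -
  interpret Z: real_branching_random_walk M \<rho> age "\<lambda>_ _. 0" "return borel 0"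
    by (rule yule_branching_random_walk_zero) standard
  have \<phi>: "char (return borel 0) 1 = 1"
    by (simp add: char_def integral_return)
  have pos: "Z.pos v \<omega> = 0" for v \<omega>
    by (induction v) (auto simp: Z.pos_Cons)
  have eq: "AE \<omega> in M. Z.martingale t \<omega> = of_real (normalized_weight t \<omega>)" for t
    using AE_finite_random_tree
  proof eventually_elim
    case (elim \<omega>)
    then have "Z.node_sum t \<omega> = of_real (total_weight \<rho> (random_tree age \<omega> t))"
      by (simp add: Z.node_sum_eq_sum pos total_weight_def)
    then show ?case
      by (simp add: Z.martingale_def \<phi> normalized_weight_def exp_of_real flip: of_real_minus)
  qed
  show "(\<integral>\<^sup>+\<omega>. ennreal ((normalized_weight t \<omega> - normalized_weight r \<omega>)\<^sup>2) \<partial>M) \<le>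
      ennreal (measure ancestor_law UNIV * exp (- (r / 4)))" if "0 \<le> r" "r \<le> t"
  proof -
    have "(\<integral>\<^sup>+\<omega>. ennreal ((normalized_weight t \<omega> - normalized_weight r \<omega>)\<^sup>2) \<partial>M) =
        (\<integral>\<^sup>+\<omega>. ennreal ((norm (Z.martingale t \<omega> - Z.martingale r \<omega>))\<^sup>2) \<partial>M)"
    proof (rule nn_integral_cong_AE)
      show "AE \<omega> in M. ennreal ((normalized_weight t \<omega> - normalized_weight r \<omega>)\<^sup>2) =
          ennreal ((norm (Z.martingale t \<omega> - Z.martingale r \<omega>))\<^sup>2)"
        using eq[of t] eq[of r] by eventually_elim (simp flip: of_real_diff)
    qed
    also have "\<dots> \<le> ennreal (measure ancestor_law UNIV * exp (- (r / 4)))"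
      using that by (intro Z.martingale_increment) (simp_all add: \<phi>)
    finally show ?thesis .
  qed
  show "(\<integral>\<^sup>+\<omega>. ennreal ((normalized_weight t \<omega>)\<^sup>2) \<partial>M) \<le> 2" if \<rho>: "\<rho> = 1" and t: "0 \<le> t"
  proof -
    have sq: "of_real ((norm z)\<^sup>2) = z * cnj z" for z by (simp only: complex_norm_square)
    have int: "integrable M (\<lambda>\<omega>. (norm (Z.martingale t \<omega>))\<^sup>2)"
      using Z.martingale_moment(1)[OF t t] unfolding sq[symmetric] by (simp only: complex_of_real_integrable_eq)
    have int': "integrable ancestor_law (\<lambda>x. exp (5 / 4 * x) * (norm (Z.decay t x))\<^sup>2)"
      using Z.martingale_moment(2)[OF t t] unfolding sq[symmetric] scaleR_conv_of_real of_real_mult[symmetric]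
      by (simp only: complex_of_real_integrable_eq)
    have eq': "(\<integral>\<omega>. (norm (Z.martingale t \<omega>))\<^sup>2 \<partial>M) = (\<integral>x. exp (5 / 4 * x) * (norm (Z.decay t x))\<^sup>2 \<partial>ancestor_law)"
      using Z.martingale_moment(3)[OF t t]
      unfolding sq[symmetric] scaleR_conv_of_real of_real_mult[symmetric] integral_complex_of_real
      by (simp only: of_real_eq_iff)
    have "(\<integral>\<^sup>+\<omega>. ennreal ((normalized_weight t \<omega>)\<^sup>2) \<partial>M) = (\<integral>\<^sup>+\<omega>. ennreal ((norm (Z.martingale t \<omega>))\<^sup>2) \<partial>M)"
    proof (rule nn_integral_cong_AE)
      show "AE \<omega> in M. ennreal ((normalized_weight t \<omega>)\<^sup>2) = ennreal ((norm (Z.martingale t \<omega>))\<^sup>2)"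
        using eq[of t] by eventually_elim simp
    qed
    also have "\<dots> = ennreal (\<integral>x. exp (5 / 4 * x) * (norm (Z.decay t x))\<^sup>2 \<partial>ancestor_law)"
      using int unfolding eq'[symmetric] by (intro nn_integral_eq_integral) auto
    also have "\<dots> = (\<integral>\<^sup>+x. ennreal (exp (5 / 4 * x) * (norm (Z.decay t x))\<^sup>2) \<partial>ancestor_law)"
      using int' by (intro nn_integral_eq_integral[symmetric]) auto
    \<comment> \<open>Dropping the cut-off at \<open>t\<close> leaves the total discount
      \<open>c = 2\<close>, and \<open>c / (c - 1)\<close> is then 2.\<close>
    also have "\<dots> \<le> (\<integral>\<^sup>+x. ennreal (exp (- ((2 - 5 / 4) * x))) \<partial>ancestor_law)"
      by (intro nn_integral_mono ennreal_leI)
        (auto simp: Z.decay_def \<phi> power2_eq_square exp_add[symmetric])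
    also have "\<dots> = 2" by (subst nn_integral_ancestor_law_unit[OF \<rho>]) auto
    finally show ?thesis .
  qed
qed

text \<open>The mean does not change with \<open>t\<close>; together with the bounded second moment
  it prevents the weight from vanishing in the limit with probability 1 when \<rho> = 1.\<close>

lemma nn_integral_normalized_weight:
  assumes t: "0 \<le> t"
  shows "(\<integral>\<^sup>+\<omega>. ennreal (normalized_weight t \<omega>) \<partial>M) = ennreal \<rho>"
proof -
  have "(\<integral>\<^sup>+\<omega>. ennreal (normalized_weight t \<omega>) \<partial>M) =
      (\<integral>\<^sup>+\<omega>. ennreal (exp (- t)) * (\<integral>\<^sup>+v. ennreal (weight \<rho> v) * indicator {\<omega> \<in> space M. birth v \<omega> \<le> t} \<omega> \<partial>count_space UNIV) \<partial>M)"
  proof (rule nn_integral_cong_AE)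
    show "AE \<omega> in M. ennreal (normalized_weight t \<omega>) =
        ennreal (exp (- t)) * (\<integral>\<^sup>+v. ennreal (weight \<rho> v) * indicator {\<omega> \<in> space M. birth v \<omega> \<le> t} \<omega> \<partial>count_space UNIV)"
      using AE_finite_random_tree AE_space
    proof eventually_elim
      case (elim \<omega>)
      have "(\<integral>\<^sup>+v. ennreal (weight \<rho> v) * indicator {\<omega> \<in> space M. birth v \<omega> \<le> t} \<omega> \<partial>count_space UNIV) =
          (\<integral>\<^sup>+v. ennreal (weight \<rho> v) * indicator (random_tree age \<omega> t) v \<partial>count_space UNIV)"
        using elim by (intro nn_integral_cong) (auto simp: mem_random_tree split: split_indicator)
      also have "\<dots> = (\<Sum>v\<in>random_tree age \<omega> t. ennreal (weight \<rho> v))"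
        using elim by (subst nn_integral_indicator_finite) auto
      also have "\<dots> = ennreal (total_weight \<rho> (random_tree age \<omega> t))"
        using weight_pos' by (simp add: total_weight_def sum_ennreal less_imp_le)
      finally show ?case by (simp add: normalized_weight_def ennreal_mult total_weight_nonneg)
    qed
  qed
  also have "\<dots> = ennreal (exp (- t)) * (\<integral>\<^sup>+\<omega>. (\<integral>\<^sup>+v. ennreal (weight \<rho> v) * indicator {\<omega> \<in> space M. birth v \<omega> \<le> t} \<omega> \<partial>count_space UNIV) \<partial>M)"
    by (rule nn_integral_cmult) (rule borel_measurable_nn_integral_countable, measurable)
  also have "(\<integral>\<^sup>+\<omega>. (\<integral>\<^sup>+v. ennreal (weight \<rho> v) * indicator {\<omega> \<in> space M. birth v \<omega> \<le> t} \<omega> \<partial>count_space UNIV) \<partial>M) =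
      (\<integral>\<^sup>+v. (\<integral>\<^sup>+\<omega>. ennreal (weight \<rho> v) * indicator {\<omega> \<in> space M. birth v \<omega> \<le> t} \<omega> \<partial>M) \<partial>count_space UNIV)"
    by (rule nn_integral_count_space_nn_integral) auto
  also have "\<dots> = ennreal (\<rho> * exp t)"
    using expected_total_weight[of t] t by (simp add: nn_integral_cmult)
  also have "ennreal (exp (- t)) * ennreal (\<rho> * exp t) = ennreal \<rho>"
    using weight_pos by (subst ennreal_mult[symmetric]) (auto simp: exp_minus field_simps)
  finally show ?thesis .
qed

end

text \<open>Only countable quantifiers are left, which makes convergence to 0 a measurable
  condition.\<close>

lemma tendsto_zero_iff_nat:
  fixes X :: "nat \<Rightarrow> 'z :: real_normed_vector"
  shows "(X \<longlonglongrightarrow> 0) \<longleftrightarrow> (\<forall>k :: nat. \<exists>N. \<forall>n\<ge>N. norm (X n) < 1 / (real k + 1))"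
proof
  assume X: "X \<longlonglongrightarrow> 0"
  show "\<forall>k :: nat. \<exists>N. \<forall>n\<ge>N. norm (X n) < 1 / (real k + 1)"
  proof
    fix k :: nat
    show "\<exists>N. \<forall>n\<ge>N. norm (X n) < 1 / (real k + 1)"
      using LIMSEQ_D[OF X, of "1 / (real k + 1)"] by simp
  qed
next
  assume *: "\<forall>k :: nat. \<exists>N. \<forall>n\<ge>N. norm (X n) < 1 / (real k + 1)"
  show "X \<longlonglongrightarrow> 0"
  proof (rule LIMSEQ_I)
    fix e :: real assume "0 < e"
    then obtain k :: nat where k: "inverse (real (Suc k)) < e" using reals_Archimedean by blast
    obtain N where "\<forall>n\<ge>N. norm (X n) < 1 / (real k + 1)" using * by blast
    with k show "\<exists>no. \<forall>n\<ge>no. norm (X n - 0) < e"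
      by (intro exI[of _ N]) (auto simp: inverse_eq_divide add.commute intro: less_trans)
  qed
qed

lemma summable_exp_neg: "0 < c \<Longrightarrow> summable (\<lambda>n. exp (- (c * real n)))"
  using summable_geometric[of "exp (- c)"] by (simp add: exp_of_nat_mult[symmetric] mult.commute)

section \<open>Convergence and positivity of the normalized weight\<close>

context weighted_yule_tree
begin

lemma AE_convergent_normalized_weight: "AE \<omega> in M. convergent (\<lambda>n. normalized_weight (real n) \<omega>)"
proof -
  define C where "C = measure ancestor_law UNIV"
  have C: "0 \<le> C" by (simp add: C_def)
  let ?Y = "\<lambda>n \<omega>. normalized_weight (real (Suc n)) \<omega> - normalized_weight (real n) \<omega>"
  have "AE \<omega> in M. summable (\<lambda>n. \<bar>?Y n \<omega>\<bar>)"
  proof (rule AE_tendsto_zero_of_summable)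
    show "\<forall>\<^sub>F n in sequentially. (\<integral>\<^sup>+\<omega>. ennreal \<bar>?Y n \<omega>\<bar> \<partial>M) \<le> ennreal ((1 + C) * exp (- (1 / 8 * real n)))"
    proof (rule always_eventually, rule allI)
      fix n
      \<comment> \<open>Either the increment is at most \<open>exp (- n / 8)\<close>, or it is at
        most \<open>exp (n / 8)\<close> times its square. As the mean square is of order
        \<open>exp (- n / 4)\<close>, the rate 1/8 balances the two terms.\<close>
      let ?e = "exp (real n / 8)"
      have "(\<integral>\<^sup>+\<omega>. ennreal \<bar>?Y n \<omega>\<bar> \<partial>M) \<le> (\<integral>\<^sup>+\<omega>. ennreal (exp (- (real n / 8))) + ennreal ?e * ennreal ((?Y n \<omega>)\<^sup>2) \<partial>M)"
      proof (intro nn_integral_mono)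
        fix \<omega>
        let ?y = "\<bar>?Y n \<omega>\<bar>"
        have "?y \<le> exp (- (real n / 8)) + ?e * ?y\<^sup>2"
        proof (cases "?y \<le> exp (- (real n / 8))")
          case True
          then show ?thesis by (simp add: add_increasing2)
        next
          case False
          then have "?e * exp (- (real n / 8)) * ?y \<le> ?e * ?y * ?y" by (intro mult_right_mono mult_left_mono) auto
          then have "?y \<le> ?e * ?y\<^sup>2" by (simp add: exp_minus power2_eq_square mult.assoc)
          then show ?thesis using exp_gt_zero[of "- (real n / 8)"] by linarith
        qed
        then show "ennreal ?y \<le> ennreal (exp (- (real n / 8))) + ennreal ?e * ennreal ((?Y n \<omega>)\<^sup>2)"
          by (simp add: ennreal_mult[symmetric] ennreal_plus[symmetric] ennreal_leI del: ennreal_plus)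
      qed
      also have "\<dots> = ennreal (exp (- (real n / 8))) + ennreal ?e * (\<integral>\<^sup>+\<omega>. ennreal ((?Y n \<omega>)\<^sup>2) \<partial>M)"
        by (subst nn_integral_add) (auto simp: nn_integral_cmult emeasure_space_1)
      also have "\<dots> \<le> ennreal (exp (- (real n / 8))) + ennreal ?e * ennreal (C * exp (- (real n / 4)))"
        unfolding C_def by (intro add_left_mono mult_left_mono normalized_weight_increment) auto
      also have "\<dots> = ennreal ((1 + C) * exp (- (1 / 8 * real n)))"
      proof -
        have "?e * (C * exp (- (real n / 4))) = C * exp (- (real n / 8))"
          by (simp add: exp_add[symmetric] mult.left_commute)
        then show ?thesis
          using C by (simp add: ennreal_mult[symmetric] ennreal_plus[symmetric] distrib_right del: ennreal_plus)
      qed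
      finally show "(\<integral>\<^sup>+\<omega>. ennreal \<bar>?Y n \<omega>\<bar> \<partial>M) \<le> ennreal ((1 + C) * exp (- (1 / 8 * real n)))" .
    qed
    show "summable (\<lambda>n. (1 + C) * exp (- (1 / 8 * real n)))"
      by (intro summable_mult summable_exp_neg) simp
  qed (use C in auto)
  then show ?thesis
  proof eventually_elim
    case (elim \<omega>)
    then have "summable (\<lambda>n. ?Y n \<omega>)" by (rule summable_rabs_cancel)
    then have "convergent (\<lambda>n. \<Sum>i<n. ?Y i \<omega>)" by (simp add: summable_iff_convergent)
    moreover have "(\<Sum>i<n. ?Y i \<omega>) = normalized_weight (real n) \<omega> - normalized_weight 0 \<omega>" for n
      using sum_lessThan_telescope[of "\<lambda>n. normalized_weight (real n) \<omega>" n] by simp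
    ultimately have "convergent (\<lambda>n. normalized_weight (real n) \<omega> - normalized_weight 0 \<omega>)" by simp
    then have "convergent (\<lambda>n. (normalized_weight (real n) \<omega> - normalized_weight 0 \<omega>) + normalized_weight 0 \<omega>)"
      by (intro convergent_add convergent_const)
    then show ?case by simp
  qed
qed

text \<open>Mean 1 and second moment at most 2 give a mean squared distance to 2 of at most 2 - 4 +
  4 = 2. Where the weight tends to 0 this squared distance tends to 4, so Fatou bounds the
  probability by 2 / 4. The centre 2 is the one that optimises this estimate.\<close>

lemma prob_normalized_weight_tendsto_zero:
  assumes \<rho>: "\<rho> = 1"
  shows "prob {\<omega> \<in> space M. (\<lambda>n. normalized_weight (real n) \<omega>) \<longlonglongrightarrow> 0} \<le> 1 / 2"
proof -
  let ?W = "\<lambda>n \<omega>. normalized_weight (real n) \<omega>"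
  let ?N = "{\<omega> \<in> space M. (\<lambda>n. ?W n \<omega>) \<longlonglongrightarrow> 0}"
  have [measurable]: "?N \<in> events" unfolding tendsto_zero_iff_nat by measurable
  have sq: "(\<integral>\<^sup>+\<omega>. ennreal ((?W n \<omega> - 2)\<^sup>2) \<partial>M) \<le> 2" for n
  proof -
    have e1: "(\<integral>\<^sup>+\<omega>. ennreal (?W n \<omega>) \<partial>M) = 1"
      using nn_integral_normalized_weight[of "real n"] \<rho> by (metis ennreal_1 of_nat_0_le_iff)
    have i1: "integrable M (?W n)"
      by (rule integrableI_nonneg) (auto simp: e1 normalized_weight_nonneg)
    have "ennreal (\<integral>\<omega>. ?W n \<omega> \<partial>M) = 1"
      unfolding e1[symmetric] using i1 by (intro nn_integral_eq_integral[symmetric]) (auto simp: normalized_weight_nonneg)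
    then have E1: "(\<integral>\<omega>. ?W n \<omega> \<partial>M) = 1" by (simp add: ennreal_eq_1)
    have e2: "(\<integral>\<^sup>+\<omega>. ennreal ((?W n \<omega>)\<^sup>2) \<partial>M) \<le> 2"
      using \<rho> by (intro normalized_weight_second_moment) auto
    then have i2: "integrable M (\<lambda>\<omega>. (?W n \<omega>)\<^sup>2)"
      by (intro integrableI_nonneg) (auto intro: le_less_trans)
    have "ennreal (\<integral>\<omega>. (?W n \<omega>)\<^sup>2 \<partial>M) \<le> 2"
      using e2 i2 by (subst nn_integral_eq_integral[symmetric]) auto
    then have E2: "(\<integral>\<omega>. (?W n \<omega>)\<^sup>2 \<partial>M) \<le> 2"
      by (metis ennreal_le_iff ennreal_numeral zero_le_numeral)
    have eq: "(?W n \<omega> - 2)\<^sup>2 = (?W n \<omega>)\<^sup>2 - 4 * ?W n \<omega> + 4" for \<omega>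
      by (simp add: power2_eq_square algebra_simps)
    have "(\<integral>\<omega>. (?W n \<omega> - 2)\<^sup>2 \<partial>M) = (\<integral>\<omega>. (?W n \<omega>)\<^sup>2 \<partial>M) - 4 * (\<integral>\<omega>. ?W n \<omega> \<partial>M) + 4"
      unfolding eq using i1 i2 by (simp add: prob_space)
    then have "(\<integral>\<omega>. (?W n \<omega> - 2)\<^sup>2 \<partial>M) \<le> 2" using E1 E2 by simp
    moreover have "integrable M (\<lambda>\<omega>. (?W n \<omega> - 2)\<^sup>2)" unfolding eq using i1 i2 by auto
    ultimately show ?thesis
      by (subst nn_integral_eq_integral) (auto simp: ennreal_leI simp flip: ennreal_numeral)
  qed
  have "4 * emeasure M ?N = (\<integral>\<^sup>+\<omega>. 4 * indicator ?N \<omega> \<partial>M)" by (simp add: nn_integral_cmult)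
  also have "\<dots> \<le> (\<integral>\<^sup>+\<omega>. liminf (\<lambda>n. ennreal ((?W n \<omega> - 2)\<^sup>2)) \<partial>M)"
  proof (intro nn_integral_mono)
    fix \<omega> assume "\<omega> \<in> space M"
    show "4 * indicator ?N \<omega> \<le> liminf (\<lambda>n. ennreal ((?W n \<omega> - 2)\<^sup>2))"
    proof (cases "\<omega> \<in> ?N")
      case True
      then have "(\<lambda>n. ennreal ((?W n \<omega> - 2)\<^sup>2)) \<longlonglongrightarrow> ennreal ((0 - 2)\<^sup>2)"
        by (intro tendsto_ennrealI tendsto_intros) auto
      then have "liminf (\<lambda>n. ennreal ((?W n \<omega> - 2)\<^sup>2)) = 4"
        by (simp add: lim_imp_Liminf)
      then show ?thesis using True by simp
    qed simp
  qed
  also have "\<dots> \<le> liminf (\<lambda>n. \<integral>\<^sup>+\<omega>. ennreal ((?W n \<omega> - 2)\<^sup>2) \<partial>M)"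
    by (rule nn_integral_liminf) measurable
  also have "\<dots> \<le> 2"
    using sq by (intro order_trans[OF Liminf_le_Limsup] Limsup_bounded) auto
  finally have "ennreal (4 * prob ?N) \<le> ennreal 2"
    by (simp add: emeasure_eq_measure ennreal_mult)
  then have "4 * prob ?N \<le> 2" by (subst (asm) ennreal_le_iff) auto
  then show ?thesis by simp
qed

text \<open>Paths are read upwards, so appending \<open>[k]\<close> at the end grafts a tree onto
  child \<open>k\<close> of the root. None of the grafted nodes is the root, and all of them have
  weight 1.\<close>

lemma subtree: "weighted_yule_tree M 1 (\<lambda>v. age (v @ [k]))"
proof unfold_locales
  show "poisson_arrivals (weight 1 v) (age (v @ [k]))" for v
    using children[of "v @ [k]"] by (simp add: weight_def)
  have "indep_vars (\<lambda>v. PiM {v @ [k]} (\<lambda>_. PiM UNIV (\<lambda>_. borel)))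
      (\<lambda>v \<omega>. restrict (\<lambda>w l. age w l \<omega>) {v @ [k]}) UNIV"
    by (rule indep_vars_restrict[OF nodes_indep]) (auto simp: disjoint_family_on_def)
  then have "indep_vars (\<lambda>_. PiM UNIV (\<lambda>_. borel))
      (\<lambda>v \<omega>. (\<lambda>f. f (v @ [k])) (restrict (\<lambda>w l. age w l \<omega>) {v @ [k]})) UNIV"
    by (rule indep_vars_compose2) (rule measurable_component_singleton, simp)
  then show "indep_vars (\<lambda>_. PiM UNIV (\<lambda>_. borel)) (\<lambda>v \<omega> l. age (v @ [k]) l \<omega>) UNIV" by simp
qed simp

lemma birth_subtree:
  "birth (v @ [k]) \<omega> = age [] k \<omega> + weighted_yule_tree.birth (\<lambda>v. age (v @ [k])) v \<omega>"
proof -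
  interpret S: weighted_yule_tree M 1 "\<lambda>v. age (v @ [k])" by (rule subtree)
  show ?thesis
    by (induction v) (simp_all add: birth_Cons S.birth_Cons birth_Cons[of k "[]", simplified])
qed

text \<open>The vanishing of the limit in subtree \<open>k\<close> as a predicate of ages alone, so
  that it can be read off from the restriction of the ages to that subtree and independence of
  disjoint sets of nodes applies.\<close>

definition limit_zero :: "nat \<Rightarrow> (node \<Rightarrow> nat \<Rightarrow> real) \<Rightarrow> bool" where
  "limit_zero k a \<longleftrightarrow> (\<lambda>n. exp (- real n) * (\<integral>v. indicator {..real n} (birth_time (\<lambda>w. a (w @ [k])) v) \<partial>count_space UNIV)) \<longlonglongrightarrow> 0"

lemma measurable_limit_zero:
  "Measurable.pred (PiM {v @ [k] | v. True} (\<lambda>_. PiM UNIV (\<lambda>_. borel))) (limit_zero k)"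
proof -
  let ?P = "PiM {v @ [k] | v. True} (\<lambda>_. PiM UNIV (\<lambda>_. borel)) :: (node \<Rightarrow> nat \<Rightarrow> real) measure"
  interpret C: sigma_finite_measure "count_space UNIV :: node measure"
    by (rule sigma_finite_measure_count_space)
  have b: "(\<lambda>a. birth_time (\<lambda>w. a (w @ [k])) v) \<in> borel_measurable ?P" for v
  proof -
    have "(\<lambda>a. \<lambda>w\<in>UNIV. a (w @ [k])) \<in> ?P \<rightarrow>\<^sub>M PiM UNIV (\<lambda>_. PiM UNIV (\<lambda>_. borel))"
      by (rule measurable_restrict) (rule measurable_component_singleton, auto)
    from measurable_compose[OF this measurable_birth_time[of v UNIV]] show ?thesis
      by (simp add: restrict_def)
  qed
  have "(\<lambda>z. indicator {..real n} (birth_time (\<lambda>w. fst z (w @ [k])) (snd z)) :: real) \<in> borel_measurable (?P \<Otimes>\<^sub>M count_space UNIV)" for n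
  proof (rule measurable_compose_countable'[where I = UNIV and g = snd])
    fix v
    have [measurable]: "(\<lambda>z. birth_time (\<lambda>w. fst z (w @ [k])) v) \<in> borel_measurable (?P \<Otimes>\<^sub>M count_space UNIV)"
      by (rule measurable_compose[OF measurable_fst b])
    show "(\<lambda>z. indicator {..real n} (birth_time (\<lambda>w. fst z (w @ [k])) v) :: real) \<in> borel_measurable (?P \<Otimes>\<^sub>M count_space UNIV)"
      by measurable
  qed auto
  then have [measurable]: "(\<lambda>a. \<integral>v. indicator {..real n} (birth_time (\<lambda>w. a (w @ [k])) v) \<partial>count_space UNIV :: real) \<in> borel_measurable ?P" for n
    by (intro C.borel_measurable_lebesgue_integral) (simp add: split_beta')
  show ?thesis unfolding limit_zero_def tendsto_zero_iff_nat by measurable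
qed

lemma limit_zero_iff:
  "limit_zero k (restrict (\<lambda>v l. age v l \<omega>) {v @ [k] | v. True}) \<longleftrightarrow>
    (\<lambda>n. weighted_yule_tree.normalized_weight 1 (\<lambda>v. age (v @ [k])) (real n) \<omega>) \<longlonglongrightarrow> 0"
proof -
  interpret S: weighted_yule_tree M 1 "\<lambda>v. age (v @ [k])" by (rule subtree)
  have w: "weight 1 v = 1" for v by (simp add: weight_def)
  show ?thesis
    unfolding limit_zero_def S.normalized_weight_def S.total_weight_eq_integral
    by (simp add: w S.birth_def)
qed

text \<open>The subtrees of the root's children are independent, and each has a positive limit with
  probability at least a half.\<close>

lemma AE_subtree_limit:
  "AE \<omega> in M. \<exists>k. \<not> (\<lambda>n. weighted_yule_tree.normalized_weight 1 (\<lambda>v. age (v @ [k])) (real n) \<omega>) \<longlonglongrightarrow> 0"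
proof -
  let ?N = "\<lambda>k. {\<omega> \<in> space M. (\<lambda>n. weighted_yule_tree.normalized_weight 1 (\<lambda>v. age (v @ [k])) (real n) \<omega>) \<longlonglongrightarrow> 0}"
  have half: "prob (?N k) \<le> 1 / 2" for k
    using weighted_yule_tree.prob_normalized_weight_tendsto_zero[OF subtree] by simp
  \<comment> \<open>Different \<open>k\<close> give disjoint sets of nodes, \<open>k\<close> being
    the last entry of each path.\<close>
  have "indep_vars (\<lambda>k. PiM {v @ [k] | v. True} (\<lambda>_. PiM UNIV (\<lambda>_. borel)))
      (\<lambda>k \<omega>. restrict (\<lambda>v l. age v l \<omega>) {v @ [k] | v. True}) (UNIV :: nat set)"
    by (rule indep_vars_restrict[OF nodes_indep]) (auto simp: disjoint_family_on_def)
  from indep_eventsI_indep_vars[OF this, of limit_zero]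
  have "indep_events (\<lambda>k. {\<omega> \<in> space M. limit_zero k (restrict (\<lambda>v l. age v l \<omega>) {v @ [k] | v. True})}) UNIV"
    using measurable_limit_zero by (simp add: pred_def)
  then have ind: "indep_events ?N UNIV" unfolding limit_zero_iff .
  then have [measurable]: "?N k \<in> events" for k by (auto simp: indep_events_def)
  let ?I = "\<Inter>k. ?N k"
  have "prob ?I \<le> (1 / 2) ^ m" for m
  proof (cases "m = 0")
    case False
    have "prob ?I \<le> prob (\<Inter>k\<in>{..<m}. ?N k)"
      using False by (intro finite_measure_mono) (auto intro!: sets.finite_INT)
    also have "\<dots> = (\<Prod>k<m. prob (?N k))"
      using ind False unfolding indep_events_def by (auto simp: lessThan_empty_iff)
    also have "\<dots> \<le> (\<Prod>k<m. 1 / 2)" by (intro prod_mono conjI half measure_nonneg)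
    finally show ?thesis by simp
  qed simp
  moreover have "(\<lambda>m. (1 / 2 :: real) ^ m) \<longlonglongrightarrow> 0" by (rule LIMSEQ_realpow_zero) auto
  ultimately have "prob ?I \<le> 0" by (intro LIMSEQ_le_const) auto
  then have "prob ?I = 0" using measure_nonneg[of M ?I] by linarith
  then have "AE \<omega> in M. \<omega> \<notin> ?I"
    by (intro AE_not_in) (auto simp: null_sets_def emeasure_eq_measure)
  then show ?thesis using AE_space by eventually_elim auto
qed

text \<open>The tree contains a subtree with positive limit, delayed by the birth time
  \<open>a\<close> of its root; the delay costs the factor \<open>exp (- a)\<close>.\<close>

lemma AE_normalized_weight_lower_bound:
  "AE \<omega> in M. \<exists>c>0. \<forall>\<^sub>F t in at_top. c \<le> normalized_weight t \<omega>"
proof -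
  have "AE \<omega> in M. \<forall>k. convergent (\<lambda>n. weighted_yule_tree.normalized_weight 1 (\<lambda>v. age (v @ [k])) (real n) \<omega>)"
    unfolding AE_all_countable using weighted_yule_tree.AE_convergent_normalized_weight[OF subtree] by blast
  then show ?thesis
    using AE_subtree_limit AE_finite_random_tree
  proof eventually_elim
    case (elim \<omega>)
    then obtain k where k: "\<not> (\<lambda>n. weighted_yule_tree.normalized_weight 1 (\<lambda>v. age (v @ [k])) (real n) \<omega>) \<longlonglongrightarrow> 0"
      by blast
    interpret S: weighted_yule_tree M 1 "\<lambda>v. age (v @ [k])" by (rule subtree)
    let ?S = "\<lambda>t. random_tree (\<lambda>v. age (v @ [k])) \<omega> t"
    obtain L where L: "(\<lambda>n. S.normalized_weight (real n) \<omega>) \<longlonglongrightarrow> L"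
      using elim(1) by (auto simp: convergent_def)
    have "0 \<le> L" by (rule LIMSEQ_le_const[OF L]) (auto simp: S.normalized_weight_nonneg)
    moreover have "L \<noteq> 0" using k L by auto
    ultimately have "0 < L" by simp
    then have "\<forall>\<^sub>F n in sequentially. L / 2 < S.normalized_weight (real n) \<omega>"
      by (intro order_tendstoD[OF L]) simp
    then obtain n0 where n0: "\<And>n. n \<ge> n0 \<Longrightarrow> L / 2 < S.normalized_weight (real n) \<omega>"
      by (auto simp: eventually_sequentially)
    define a where "a = age [] k \<omega>"
    have sub: "(\<lambda>v. v @ [k]) ` ?S (t - a) \<subseteq> random_tree age \<omega> t" for t
      by (auto simp: mem_random_tree S.mem_random_tree birth_subtree a_def)
    show ?case
    proof (intro exI[of _ "exp (- (a + 1)) * (L / 2)"] conjI)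
      show "\<forall>\<^sub>F t in at_top. exp (- (a + 1)) * (L / 2) \<le> normalized_weight t \<omega>"
        using eventually_ge_at_top[of "a + real n0"]
      proof eventually_elim
        case (elim t)
        \<comment> \<open>The weight of the subtree is controlled at integers only. Rounding the age
          \<open>t - a\<close> down costs at most a factor \<open>exp 1\<close>, which is the 1 in
          \<open>exp (- (a + 1))\<close>.\<close>
        define n where "n = nat \<lfloor>t - a\<rfloor>"
        have n: "n0 \<le> n" "real n \<le> t - a" "t - a \<le> real n + 1"
          using elim unfolding n_def by linarith+
        have fin: "finite (random_tree age \<omega> t)" using \<open>\<forall>t. finite (random_tree age \<omega> t)\<close> by blast
        have finS: "finite (?S (t - a))"
          using finite_subset[OF sub fin] by (rule finite_imageD) (auto simp: inj_on_def)
        have "exp (- (a + 1)) * (L / 2) \<le> exp (real n - t) * (L / 2)"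
          using n \<open>0 < L\<close> by (intro mult_right_mono) auto
        also have "\<dots> \<le> exp (real n - t) * S.normalized_weight (real n) \<omega>"
          using n0[OF n(1)] by (intro mult_left_mono) auto
        also have "\<dots> = exp (- t) * total_weight 1 (?S (real n))"
          by (simp add: S.normalized_weight_def exp_diff exp_minus field_simps)
        also have "\<dots> \<le> exp (- t) * total_weight 1 (?S (t - a))"
          using n finS by (intro mult_left_mono S.total_weight_mono S.random_tree_mono) auto
        also have "total_weight 1 (?S (t - a)) = total_weight \<rho> ((\<lambda>v. v @ [k]) ` ?S (t - a))"
          unfolding total_weight_def by (subst sum.reindex) (auto simp: inj_on_def weight_def)
        also have "exp (- t) * \<dots> \<le> normalized_weight t \<omega>"
          unfolding normalized_weight_def by (intro mult_left_mono total_weight_mono fin sub) auto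
        finally show ?case .
      qed
    qed (use \<open>0 < L\<close> in auto)
  qed
qed

end

section \<open>Second-order expansion of characteristic functions\<close>

text \<open>The Taylor remainder is bounded by the smaller of a quadratic and a cubic term. The
  cubic one tends to 0 with \<open>u n\<close>, the quadratic one is an integrable majorant, so two
  moments suffice.\<close>

lemma (in real_distribution) char_second_order:
  assumes i2: "integrable M (\<lambda>x. x\<^sup>2)" and u: "u \<longlonglongrightarrow> 0" "\<And>n. u n \<noteq> 0"
  shows "(\<lambda>n. (char M (u n) - (1 + \<i> * u n * expectation (\<lambda>x. x) - (u n)\<^sup>2 * expectation (\<lambda>x. x\<^sup>2) / 2)) / (u n)\<^sup>2)
    \<longlonglongrightarrow> 0"
proof -
  have i1: "integrable M (\<lambda>x. x)"
    by (rule square_integrable_imp_integrable[OF _ i2]) simp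
  have int: "integrable M (\<lambda>x. x ^ k)" if "k \<le> 2" for k
    using that i1 i2 by (cases k; cases "k - 1") (auto simp: numeral_2_eq_2)
  let ?E = "\<lambda>n. expectation (\<lambda>x. min (6 * x\<^sup>2) (\<bar>u n\<bar> * \<bar>x\<bar> ^ 3))"
  have "?E \<longlonglongrightarrow> expectation (\<lambda>x. 0)"
  proof (rule integral_dominated_convergence[where w = "\<lambda>x. 6 * x\<^sup>2"])
    show "AE x in M. (\<lambda>n. min (6 * x\<^sup>2) (\<bar>u n\<bar> * \<bar>x\<bar> ^ 3)) \<longlonglongrightarrow> 0"
    proof (rule AE_I2)
      fix x
      have "(\<lambda>n. min (6 * x\<^sup>2) (\<bar>u n\<bar> * \<bar>x\<bar> ^ 3)) \<longlonglongrightarrow> min (6 * x\<^sup>2) (\<bar>0\<bar> * \<bar>x\<bar> ^ 3)"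
        by (intro tendsto_intros u)
      then show "(\<lambda>n. min (6 * x\<^sup>2) (\<bar>u n\<bar> * \<bar>x\<bar> ^ 3)) \<longlonglongrightarrow> 0" by simp
    qed
  qed (use i2 in auto)
  then have lim: "(\<lambda>n. ?E n / 6) \<longlonglongrightarrow> 0" by (auto intro: tendsto_eq_intros)
  show ?thesis
  proof (rule Lim_null_comparison[OF _ lim], rule always_eventually, rule allI)
    fix n
    have sum3: "(\<Sum>k\<le>2. f k) = f 0 + f 1 + f 2" for f :: "nat \<Rightarrow> complex"
      by (simp add: numeral_2_eq_2)
    have "(\<Sum>k\<le>2. ((\<i> * u n) ^ k / fact k) * expectation (\<lambda>x. x ^ k)) =
        1 + \<i> * u n * expectation (\<lambda>x. x) - (u n)\<^sup>2 * expectation (\<lambda>x. x\<^sup>2) / 2"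
      unfolding sum3 using prob_space by (simp add: power_mult_distrib)
    moreover have "expectation (\<lambda>x. min (2 * \<bar>x\<bar>\<^sup>2 * real (Suc 2)) (\<bar>u n\<bar> * \<bar>x\<bar> ^ Suc 2)) = ?E n"
      by (simp add: numeral_3_eq_3 numeral_2_eq_2 mult.commute)
    ultimately have "cmod (char M (u n) - (1 + \<i> * u n * expectation (\<lambda>x. x) - (u n)\<^sup>2 * expectation (\<lambda>x. x\<^sup>2) / 2))
        \<le> \<bar>u n\<bar>\<^sup>2 / fact (Suc 2) * ?E n"
      using char_approx2[of 2 "u n", OF int] by simp
    then show "norm ((char M (u n) - (1 + \<i> * u n * expectation (\<lambda>x. x) - (u n)\<^sup>2 * expectation (\<lambda>x. x\<^sup>2) / 2)) / (u n)\<^sup>2) \<le> ?E n / 6"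
      using u(2)[of n] by (simp add: norm_divide norm_power divide_simps fact_numeral mult_ac)
  qed
qed

text \<open>The characteristic function of the compound Poisson law with intensity \<open>t\<close>, centred and
  scaled.\<close>

lemma (in real_distribution) compound_poisson_limit:
  assumes i2: "integrable M (\<lambda>x. x\<^sup>2)" and t: "filterlim t at_top sequentially" "\<And>n. 0 < t n"
  shows "(\<lambda>n. exp (of_real (t n) * (char M (1 / sqrt (t n)) - 1) - \<i> * of_real (sqrt (t n) * expectation (\<lambda>x. x))))
    \<longlonglongrightarrow> of_real (exp (- expectation (\<lambda>x. x\<^sup>2) / 2))"
proof -
  let ?m = "expectation (\<lambda>x. x)" and ?s = "expectation (\<lambda>x. x\<^sup>2)"
  let ?u = "\<lambda>n. 1 / sqrt (t n)"
  have u0: "?u \<longlonglongrightarrow> 0"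
    using t(1) by (intro tendsto_divide_0[OF tendsto_const] filterlim_at_top_imp_at_infinity
        filterlim_compose[OF sqrt_at_top])
  have un: "?u n \<noteq> 0" for n using t(2)[of n] by simp
  \<comment> \<open>As \<open>?u n\<close> is \<open>1 / sqrt (t n)\<close>, the factor
    \<open>t n\<close> is division by its square. The centring cancels the linear Taylor term, and
    the quadratic one becomes a constant.\<close>
  have "of_real (t n) * (char M (?u n) - 1) - \<i> * of_real (sqrt (t n) * ?m) =
      (char M (?u n) - (1 + \<i> * ?u n * ?m - (?u n)\<^sup>2 * ?s / 2)) / (?u n)\<^sup>2 - of_real (?s / 2)" for n
  proof -
    define r where "r = sqrt (t n)"
    have r: "0 < r" "t n = r\<^sup>2" using t(2)[of n] by (auto simp: r_def)
    show ?thesis unfolding r(2) real_sqrt_abs using r(1)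
      by (simp add: field_simps power2_eq_square)
  qed
  then have eq: "exp (of_real (t n) * (char M (?u n) - 1) - \<i> * of_real (sqrt (t n) * ?m)) =
      exp ((char M (?u n) - (1 + \<i> * ?u n * ?m - (?u n)\<^sup>2 * ?s / 2)) / (?u n)\<^sup>2 - of_real (?s / 2))" for n
    by (simp only:)
  have "(\<lambda>n. exp ((char M (?u n) - (1 + \<i> * ?u n * ?m - (?u n)\<^sup>2 * ?s / 2)) / (?u n)\<^sup>2 - of_real (?s / 2)))
      \<longlonglongrightarrow> exp (0 - of_real (?s / 2))"
    by (intro tendsto_exp tendsto_diff tendsto_const char_second_order[OF i2 u0 un])
  then show ?thesis unfolding eq by (simp add: exp_of_real[symmetric])
qed

section \<open>The time grid\<close>

text \<open>Any positive power makes \<open>exp (- grid n / 4)\<close> summable. The exponent 1/4 is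
  small enough that the mesh tends to 0 and that \<open>1 / sqrt (grid n)\<close> changes by order
  n^(-9/8) per step, which compensates the cubic factor of order n^(3/4) paid for the
  spread.\<close>

definition grid :: "nat \<Rightarrow> real" where "grid n = (real n + 1) powr (1 / 4)"

text \<open>Still a positive power, so the increment bound at this time is summable, but its cube is
  of order n^(3/32), below n^(4/32), the order of \<open>sqrt (grid n)\<close>. It is rounded to an
  integer because the almost sure facts about weight and spread are obtained at integer
  times.\<close>

definition early :: "nat \<Rightarrow> nat" where "early n = nat \<lfloor>(real n + 1) powr (1 / 32)\<rfloor>"

lemma early_bounds: "real (early n) \<le> (real n + 1) powr (1 / 32)" "(real n + 1) powr (1 / 32) - 1 \<le> real (early n)"
  unfolding early_def by (auto intro: of_nat_floor)

lemma grid_ge_1: "1 \<le> grid n" unfolding grid_def by (rule ge_one_powr_ge_zero) auto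

lemma grid_mono: "m \<le> n \<Longrightarrow> grid m \<le> grid n" unfolding grid_def by (rule powr_mono2) auto

lemma early_le_grid: "real (early n) \<le> grid n"
proof -
  have "(real n + 1) powr (1 / 32) \<le> (real n + 1) powr (1 / 4)" by (rule powr_mono) auto
  then show ?thesis using early_bounds(1)[of n] unfolding grid_def by linarith
qed

lemma filterlim_grid: "filterlim grid at_top sequentially"
  unfolding grid_def by real_asymp

lemma filterlim_early: "filterlim early at_top sequentially"
proof -
  have "filterlim (\<lambda>n. (real n + 1) powr (1 / 32) - 1) at_top sequentially" by real_asymp
  then have "filterlim (\<lambda>n. real (early n)) at_top sequentially"
    by (rule filterlim_at_top_mono) (simp add: early_bounds)
  then show ?thesis by (simp add: filterlim_sequentially_iff_filterlim_real)
qed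

lemma summable_exp_grid: "summable (\<lambda>n. exp (- (grid n / 4)))"
proof (rule summable_comparison_test_bigo)
  show "summable (\<lambda>n. norm (1 / real n ^ 2))" using inverse_power_summable[of 2] by (simp add: field_simps)
  show "(\<lambda>n. exp (- (grid n / 4))) \<in> O(\<lambda>n. 1 / real n ^ 2)" unfolding grid_def by real_asymp
qed

lemma summable_exp_early: "summable (\<lambda>n. exp (- (real (early n) / 4)))"
proof (rule summable_comparison_test')
  \<comment> \<open>The constant \<open>exp (1 / 4)\<close> pays for rounding the early time down by
    at most 1.\<close>
  show "summable (\<lambda>n. exp (1 / 4) * exp (- ((real n + 1) powr (1 / 32) / 4)))"
  proof (rule summable_mult, rule summable_comparison_test_bigo)
    show "summable (\<lambda>n. norm (1 / real n ^ 2))" using inverse_power_summable[of 2] by (simp add: field_simps)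
    show "(\<lambda>n. exp (- ((real n + 1) powr (1 / 32) / 4))) \<in> O(\<lambda>n. 1 / real n ^ 2)" by real_asymp
  qed
  show "norm (exp (- (real (early n) / 4))) \<le> exp (1 / 4) * exp (- ((real n + 1) powr (1 / 32) / 4))" for n
    using early_bounds(2)[of n] by (simp add: exp_add[symmetric])
qed

lemma early_cube_over_sqrt_grid: "(\<lambda>n. (real (early n) + 1) ^ 3 / sqrt (grid n)) \<longlonglongrightarrow> 0"
proof (rule tendsto_sandwich[where f = "\<lambda>_. 0"])
  show "(\<lambda>n. ((real n + 1) powr (1 / 32) + 1) ^ 3 / sqrt ((real n + 1) powr (1 / 4))) \<longlonglongrightarrow> 0" by real_asymp
  show "\<forall>\<^sub>F n in sequentially. (real (early n) + 1) ^ 3 / sqrt (grid n) \<le>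
      ((real n + 1) powr (1 / 32) + 1) ^ 3 / sqrt ((real n + 1) powr (1 / 4))"
    unfolding grid_def using early_bounds(1)
    by (intro always_eventually allI divide_right_mono power_mono) auto
  show "\<forall>\<^sub>F n in sequentially. 0 \<le> (real (early n) + 1) ^ 3 / sqrt (grid n)"
    using order_trans[OF zero_le_one grid_ge_1] by (intro always_eventually allI divide_nonneg_nonneg) simp_all
qed simp

section \<open>Projections of the offsets\<close>

context yule_branching_random_walk
begin

lemma sets_offset_law [measurable_cong, simp]: "sets D = sets borel"
  using offsets_law[of "[]"] by (metis sets_distr)

lemma prob_space_offset_law: "prob_space D"
  using offsets_law[of "[]"] prob_space_distr[OF offset_measurable] by metis

lemma projection:
  assumes [measurable]: "h \<in> borel_measurable borel"
  shows "real_branching_random_walk M \<rho> age (\<lambda>v \<omega>. h (X v \<omega>)) (distr D borel h)"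
proof (intro real_branching_random_walk.intro yule_branching_random_walk.intro
    yule_branching_random_walk_axioms.intro)
  show "weighted_yule_tree M \<rho> age" by standard
  show "indep_vars (\<lambda>_. borel) (\<lambda>v \<omega>. h (X v \<omega>)) UNIV"
    by (rule indep_vars_compose2[OF offsets_indep]) simp
  show "distr M borel (\<lambda>\<omega>. h (X v \<omega>)) = distr D borel h" for v
    unfolding offsets_law[of v, symmetric] by (subst distr_distr) (auto simp: comp_def)
  have sub: "{(\<lambda>\<omega>. h (X v \<omega>)) -` B \<inter> space M |v B. B \<in> sets borel} \<subseteq> {X v -` B \<inter> space M |v B. B \<in> sets borel}"
  proof safe
    fix v and B :: "real set" assume "B \<in> sets borel"
    then have "h -` B \<in> sets borel" using measurable_sets[of h borel borel B] assms by simp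
    moreover have "(\<lambda>\<omega>. h (X v \<omega>)) -` B = X v -` (h -` B)" by auto
    ultimately show "\<exists>v' B'. (\<lambda>\<omega>. h (X v \<omega>)) -` B \<inter> space M = X v' -` B' \<inter> space M \<and> B' \<in> sets borel"
      by blast
  qed
  show "indep_set (sigma_sets (space M) {{\<omega> \<in> space M. v \<in> random_tree age \<omega> t} |v t. 0 \<le> t})
      (sigma_sets (space M) {(\<lambda>\<omega>. h (X v \<omega>)) -` B \<inter> space M |v B. B \<in> sets borel})"
    using offsets_indep_tree sigma_sets_mono'[OF sub] unfolding indep_sets2_eq by blast
qed

definition node_char :: "'b \<Rightarrow> real \<Rightarrow> real \<Rightarrow> 'a \<Rightarrow> complex" where
  "node_char s c t \<omega> = (\<integral>v. of_real (weight \<rho> v * indicator {..t} (birth v \<omega>)) * iexp (c * (s \<bullet> pos v \<omega>)) \<partial>count_space UNIV)"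

lemma node_char_eq_sum:
  assumes "finite (random_tree age \<omega> t)"
  shows "node_char s c t \<omega> = (\<Sum>v\<in>random_tree age \<omega> t. of_real (weight \<rho> v) * iexp (c * (s \<bullet> pos v \<omega>)))"
proof -
  have "node_char s c t \<omega> = (\<Sum>v\<in>random_tree age \<omega> t. of_real (weight \<rho> v * indicator {..t} (birth v \<omega>)) * iexp (c * (s \<bullet> pos v \<omega>)))"
    unfolding node_char_def using assms
    by (intro lebesgue_integral_count_space_finite_support') (auto simp: mem_random_tree)
  also have "\<dots> = (\<Sum>v\<in>random_tree age \<omega> t. of_real (weight \<rho> v) * iexp (c * (s \<bullet> pos v \<omega>)))"
    by (intro sum.cong) (auto simp: mem_random_tree)
  finally show ?thesis .
qed

definition offset_char :: "'b \<Rightarrow> real \<Rightarrow> complex" where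
  "offset_char s c = char (distr D borel (\<lambda>x. s \<bullet> x)) c"

text \<open>The frequency is moved into the offsets: the real walk with offsets
  \<open>c * (s \<bullet> X v)\<close> has this node sum at frequency 1, and its increment bound
  carries a constant that involves neither \<open>s\<close> nor \<open>c\<close>.\<close>

lemma node_char_measurable [measurable]: "node_char s c t \<in> borel_measurable M"
  and node_char_increment: "0 \<le> r \<Longrightarrow> r \<le> t \<Longrightarrow> 3 / 4 \<le> Re (offset_char s c) \<Longrightarrow>
    (\<integral>\<^sup>+\<omega>. ennreal ((norm (exp (- offset_char s c * of_real t) * node_char s c t \<omega> -
      exp (- offset_char s c * of_real r) * node_char s c r \<omega>))\<^sup>2) \<partial>M) \<le>
    ennreal (measure ancestor_law UNIV * exp (- (r / 4)))"
proof -
  interpret P: real_branching_random_walk M \<rho> age "\<lambda>v \<omega>. c * (s \<bullet> X v \<omega>)" "distr D borel (\<lambda>x. c * (s \<bullet> x))"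
    by (rule projection) simp
  have pos: "P.pos v \<omega> = c * (s \<bullet> pos v \<omega>)" for v \<omega>
    by (induction v) (simp_all add: P.pos_Cons pos_Cons inner_add_right distrib_left)
  have ns: "P.node_sum t = node_char s c t" for t
    by (simp add: fun_eq_iff P.node_sum_def node_char_def pos)
  have ph: "char (distr D borel (\<lambda>x. c * (s \<bullet> x))) 1 = offset_char s c"
    unfolding offset_char_def char_def by (simp add: integral_distr)
  show "node_char s c t \<in> borel_measurable M"
    using P.node_sum_measurable[of t] by (simp add: ns)
  show "0 \<le> r \<Longrightarrow> r \<le> t \<Longrightarrow> 3 / 4 \<le> Re (offset_char s c) \<Longrightarrow>
    (\<integral>\<^sup>+\<omega>. ennreal ((norm (exp (- offset_char s c * of_real t) * node_char s c t \<omega> -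
      exp (- offset_char s c * of_real r) * node_char s c r \<omega>))\<^sup>2) \<partial>M) \<le>
    ennreal (measure ancestor_law UNIV * exp (- (r / 4)))"
    using P.martingale_increment[of r t] by (simp only: P.martingale_def[abs_def] ns ph)
qed

section \<open>The spread of the positions\<close>

definition spread :: "real \<Rightarrow> 'a \<Rightarrow> real" where
  "spread t \<omega> = exp (- t) * (\<Sum>v\<in>random_tree age \<omega> t. weight \<rho> v * norm (pos v \<omega>))"

lemma spread_nonneg: "0 \<le> spread t \<omega>"
  using weight_pos' by (auto simp: spread_def less_imp_le intro!: mult_nonneg_nonneg sum_nonneg)

lemma
  assumes D: "integrable D norm"
  shows integrable_pos: "integrable M (\<lambda>\<omega>. norm (pos v \<omega>))"
    and expectation_norm_pos: "(\<integral>\<omega>. norm (pos v \<omega>) \<partial>M) \<le> real (length v) * (\<integral>x. norm x \<partial>D)"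
proof -
  have "integrable M (\<lambda>\<omega>. norm (pos v \<omega>)) \<and> (\<integral>\<omega>. norm (pos v \<omega>) \<partial>M) \<le> real (length v) * (\<integral>x. norm x \<partial>D)"
  proof (induction v)
    case (Cons k v)
    have X: "integrable M (\<lambda>\<omega>. norm (X (k # v) \<omega>))" "(\<integral>\<omega>. norm (X (k # v) \<omega>) \<partial>M) = (\<integral>x. norm x \<partial>D)"
      using D unfolding offsets_law[of "k # v", symmetric]
      by (auto simp: integrable_distr_eq integral_distr)
    have le: "norm (pos (k # v) \<omega>) \<le> norm (pos v \<omega>) + norm (X (k # v) \<omega>)" for \<omega>
      by (simp add: pos_Cons norm_triangle_ineq)
    have i: "integrable M (\<lambda>\<omega>. norm (pos v \<omega>) + norm (X (k # v) \<omega>))"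
      using Cons X by auto
    have "integrable M (\<lambda>\<omega>. norm (pos (k # v) \<omega>))"
      by (rule Bochner_Integration.integrable_bound[OF i]) (use le in \<open>auto intro!: AE_I2\<close>)
    moreover from this have "(\<integral>\<omega>. norm (pos (k # v) \<omega>) \<partial>M) \<le> (\<integral>\<omega>. norm (pos v \<omega>) + norm (X (k # v) \<omega>) \<partial>M)"
      using i le by (intro integral_mono)
    ultimately show ?case using Cons X by (simp add: distrib_right)
  qed simp
  then show "integrable M (\<lambda>\<omega>. norm (pos v \<omega>))"
    "(\<integral>\<omega>. norm (pos v \<omega>) \<partial>M) \<le> real (length v) * (\<integral>x. norm x \<partial>D)" by auto
qed

text \<open>A node in generation \<open>n\<close> has mean distance at most \<open>n\<close> times
  that of one offset, and that generation has expected weight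
  \<open>\<rho> * t ^ n / fact n\<close>. Summing \<open>n * t ^ n / fact n\<close> gives
  \<open>t * exp t\<close>.\<close>

lemma nn_integral_spread:
  assumes D: "integrable D norm" and t: "0 \<le> t"
  shows "(\<integral>\<^sup>+\<omega>. \<integral>\<^sup>+v. ennreal (weight \<rho> v * indicator {..t} (birth v \<omega>) * norm (pos v \<omega>)) \<partial>count_space UNIV \<partial>M)
    \<le> ennreal ((\<integral>x. norm x \<partial>D) * \<rho> * (t * exp t))"
proof -
  define K where "K = (\<integral>x. norm x \<partial>D)"
  have K: "0 \<le> K" by (simp add: K_def)
  have one: "(\<integral>\<^sup>+\<omega>. ennreal (weight \<rho> v * indicator {..t} (birth v \<omega>) * norm (pos v \<omega>)) \<partial>M) \<le>
      ennreal (real (length v) * K) * (ennreal (weight \<rho> v) * emeasure M {\<omega> \<in> space M. birth v \<omega> \<le> t})" for v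
  proof -
    have ip: "integrable M (\<lambda>\<omega>. norm (pos v \<omega>))" by (rule integrable_pos[OF D])
    have i: "integrable M (\<lambda>\<omega>. indicator {..t} (birth v \<omega>) * norm (pos v \<omega>))"
      by (rule Bochner_Integration.integrable_bound[OF ip]) (auto simp: indicator_def intro!: AE_I2)
    have ii: "indicator {..t} x * indicator {..t} x = (indicator {..t} x :: real)" for x :: real
      by (auto split: split_indicator)
    have "(\<lambda>\<omega>. norm (pos v \<omega>)) \<in> borel_measurable (sigma (space M) offset_events)" by measurable
    from integral_tree_offset[OF t t this ip, of v v]
    have "(\<integral>\<omega>. indicator {..t} (birth v \<omega>) * norm (pos v \<omega>) \<partial>M) =
        (\<integral>\<omega>. indicator {..t} (birth v \<omega>) \<partial>M) * (\<integral>\<omega>. norm (pos v \<omega>) \<partial>M)"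
      by (simp only: of_real_eq_id id_apply ii)
    also have "(\<integral>\<omega>. indicator {..t} (birth v \<omega>) \<partial>M) =
        (\<integral>\<omega>. indicator {\<omega> \<in> space M. birth v \<omega> \<le> t} \<omega> \<partial>M)"
      by (intro Bochner_Integration.integral_cong) (auto split: split_indicator)
    also have "\<dots> = prob {\<omega> \<in> space M. birth v \<omega> \<le> t}" by simp
    finally have eq: "(\<integral>\<omega>. indicator {..t} (birth v \<omega>) * norm (pos v \<omega>) \<partial>M) =
        prob {\<omega> \<in> space M. birth v \<omega> \<le> t} * (\<integral>\<omega>. norm (pos v \<omega>) \<partial>M)" .
    have "(\<integral>\<^sup>+\<omega>. ennreal (weight \<rho> v * indicator {..t} (birth v \<omega>) * norm (pos v \<omega>)) \<partial>M) =
        (\<integral>\<^sup>+\<omega>. ennreal (weight \<rho> v) * ennreal (indicator {..t} (birth v \<omega>) * norm (pos v \<omega>)) \<partial>M)"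
      using weight_pos'[of v] by (intro nn_integral_cong) (simp add: ennreal_mult mult.assoc)
    also have "\<dots> = ennreal (weight \<rho> v) * ennreal (\<integral>\<omega>. indicator {..t} (birth v \<omega>) * norm (pos v \<omega>) \<partial>M)"
      using i by (subst nn_integral_cmult) (auto simp: nn_integral_eq_integral)
    also have "\<dots> \<le> ennreal (weight \<rho> v) * ennreal (prob {\<omega> \<in> space M. birth v \<omega> \<le> t} * (real (length v) * K))"
      unfolding eq K_def by (intro mult_left_mono ennreal_leI expectation_norm_pos[OF D]) auto
    also have "\<dots> = ennreal (real (length v) * K) * (ennreal (weight \<rho> v) * emeasure M {\<omega> \<in> space M. birth v \<omega> \<le> t})"
      using K by (simp add: emeasure_eq_measure ennreal_mult mult_ac)
    finally show ?thesis .
  qed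
  have sums: "(\<lambda>n. real n * K * (\<rho> * (t ^ n / fact n))) sums (K * \<rho> * (t * exp t))"
  proof -
    have "(\<lambda>n. t ^ n / fact n) sums exp t"
      using exp_converges[of t] by (simp add: divide_inverse mult.commute scaleR_conv_of_real)
    then have "(\<lambda>n. K * \<rho> * (t * (t ^ n / fact n))) sums (K * \<rho> * (t * exp t))" by (intro sums_mult)
    moreover have "K * \<rho> * (t * (t ^ n / fact n)) = real (Suc n) * K * (\<rho> * (t ^ Suc n / fact (Suc n)))" for n
      by (simp add: field_simps del: of_nat_Suc)
    ultimately have "(\<lambda>n. real (Suc n) * K * (\<rho> * (t ^ Suc n / fact (Suc n)))) sums (K * \<rho> * (t * exp t))" by (simp only:)
    then have "(\<lambda>n. real n * K * (\<rho> * (t ^ n / fact n))) sums (K * \<rho> * (t * exp t) + real 0 * K * (\<rho> * (t ^ 0 / fact 0)))"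
      by (rule sums_Suc_iff[of "\<lambda>n. real n * K * (\<rho> * (t ^ n / fact n))", THEN iffD1])
    then show ?thesis by (simp only: of_nat_0 mult_zero_left add_0_right)
  qed
  have "(\<integral>\<^sup>+\<omega>. \<integral>\<^sup>+v. ennreal (weight \<rho> v * indicator {..t} (birth v \<omega>) * norm (pos v \<omega>)) \<partial>count_space UNIV \<partial>M) =
      (\<integral>\<^sup>+v. \<integral>\<^sup>+\<omega>. ennreal (weight \<rho> v * indicator {..t} (birth v \<omega>) * norm (pos v \<omega>)) \<partial>M \<partial>count_space UNIV)"
    by (rule nn_integral_count_space_nn_integral) auto
  also have "\<dots> \<le> (\<integral>\<^sup>+v. ennreal (real (length v) * K) * (ennreal (weight \<rho> v) * emeasure M {\<omega> \<in> space M. birth v \<omega> \<le> t}) \<partial>count_space UNIV)"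
    by (intro nn_integral_mono one)
  also have "\<dots> = (\<Sum>n. \<integral>\<^sup>+v. ennreal (real n * K) * (ennreal (weight \<rho> v) * emeasure M {\<omega> \<in> space M. birth v \<omega> \<le> t}) \<partial>count_space {v. length v = n})"
    unfolding nn_integral_generations by (intro suminf_cong nn_integral_cong) simp
  also have "\<dots> = (\<Sum>n. ennreal (real n * K * (\<rho> * (t ^ n / fact n))))"
  proof (intro suminf_cong)
    fix n
    have "(\<integral>\<^sup>+v. ennreal (real n * K) * (ennreal (weight \<rho> v) * emeasure M {\<omega> \<in> space M. birth v \<omega> \<le> t}) \<partial>count_space {v. length v = n}) =
        ennreal (real n * K) * (ennreal \<rho> * ennreal (t ^ n / fact n))"
      using t by (subst nn_integral_cmult) (simp_all add: sum_birth_le arrival_volume_def)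
    also have "\<dots> = ennreal (real n * K * (\<rho> * (t ^ n / fact n)))"
    proof -
      have "ennreal \<rho> * ennreal (t ^ n / fact n) = ennreal (\<rho> * (t ^ n / fact n))"
        using t weight_pos by (intro ennreal_mult[symmetric]) auto
      moreover have "ennreal (real n * K) * ennreal (\<rho> * (t ^ n / fact n)) = ennreal (real n * K * (\<rho> * (t ^ n / fact n)))"
        using K t weight_pos by (intro ennreal_mult[symmetric]) auto
      ultimately show ?thesis by (simp only:)
    qed
    finally show "(\<integral>\<^sup>+v. ennreal (real n * K) * (ennreal (weight \<rho> v) * emeasure M {\<omega> \<in> space M. birth v \<omega> \<le> t}) \<partial>count_space {v. length v = n}) =
        ennreal (real n * K * (\<rho> * (t ^ n / fact n)))" .
  qed
  also have "\<dots> = ennreal (K * \<rho> * (t * exp t))"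
    using sums K t weight_pos by (subst suminf_ennreal2) (auto simp: sums_iff)
  finally show ?thesis by (simp add: K_def)
qed

text \<open>The mean of the spread at time \<open>j\<close> is of order \<open>j\<close>. Division
  by the cube leaves a summable bound of order j^(-2), crude but cheap since the early time is a
  very small power.\<close>

lemma AE_spread:
  assumes D: "integrable D norm"
  shows "AE \<omega> in M. (\<lambda>j. spread (real j) \<omega> / (real j + 1) ^ 3) \<longlonglongrightarrow> 0"
proof -
  define K where "K = (\<integral>x. norm x \<partial>D)"
  have K: "0 \<le> K" by (simp add: K_def)
  let ?S = "\<lambda>j \<omega>. \<integral>\<^sup>+v. ennreal (weight \<rho> v * indicator {..real j} (birth v \<omega>) * norm (pos v \<omega>)) \<partial>count_space UNIV"
  let ?Y = "\<lambda>j \<omega>. exp (- real j) / (real j + 1) ^ 3 * enn2real (?S j \<omega>)"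
  have Sm [measurable]: "?S j \<in> borel_measurable M" for j
    by (rule borel_measurable_nn_integral_countable) measurable
  \<comment> \<open>Only an inequality, as \<open>enn2real\<close> sends infinity to 0; infinity
    occurs on a null event, where nothing is claimed.\<close>
  have enn2real_le: "ennreal (enn2real x) \<le> x" for x by (cases x) auto
  have "AE \<omega> in M. summable (\<lambda>j. \<bar>?Y j \<omega>\<bar>)"
  proof (rule AE_tendsto_zero_of_summable)
    show "\<forall>\<^sub>F j in sequentially. (\<integral>\<^sup>+\<omega>. ennreal \<bar>?Y j \<omega>\<bar> \<partial>M) \<le> ennreal (K * \<rho> * (1 / real (Suc j) ^ 2))"
    proof (rule always_eventually, rule allI)
      fix j
      have "(\<integral>\<^sup>+\<omega>. ennreal \<bar>?Y j \<omega>\<bar> \<partial>M) \<le> (\<integral>\<^sup>+\<omega>. ennreal (exp (- real j) / (real j + 1) ^ 3) * ?S j \<omega> \<partial>M)"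
      proof (intro nn_integral_mono)
        fix \<omega>
        have "ennreal \<bar>?Y j \<omega>\<bar> = ennreal (exp (- real j) / (real j + 1) ^ 3) * ennreal (enn2real (?S j \<omega>))"
          by (simp add: ennreal_mult[symmetric] abs_mult)
        also have "\<dots> \<le> ennreal (exp (- real j) / (real j + 1) ^ 3) * ?S j \<omega>"
          by (intro mult_left_mono enn2real_le) simp
        finally show "ennreal \<bar>?Y j \<omega>\<bar> \<le> ennreal (exp (- real j) / (real j + 1) ^ 3) * ?S j \<omega>" .
      qed
      also have "\<dots> \<le> ennreal (exp (- real j) / (real j + 1) ^ 3) * ennreal (K * \<rho> * (real j * exp (real j)))"
        unfolding K_def nn_integral_cmult[OF Sm] by (intro mult_left_mono nn_integral_spread D) auto
      also have "\<dots> = ennreal (K * \<rho> * (real j / (real j + 1) ^ 3))"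
      proof -
        have "exp (- real j) / (real j + 1) ^ 3 * (K * \<rho> * (real j * exp (real j))) =
            (exp (- real j) * exp (real j)) * (K * \<rho> * (real j / (real j + 1) ^ 3))" by simp
        also have "exp (- real j) * exp (real j) = 1" by (simp add: exp_minus)
        finally have "exp (- real j) / (real j + 1) ^ 3 * (K * \<rho> * (real j * exp (real j))) =
            K * \<rho> * (real j / (real j + 1) ^ 3)" by (simp only: mult_1_left)
        moreover have "ennreal (exp (- real j) / (real j + 1) ^ 3) * ennreal (K * \<rho> * (real j * exp (real j))) =
            ennreal (exp (- real j) / (real j + 1) ^ 3 * (K * \<rho> * (real j * exp (real j))))"
          using K weight_pos by (intro ennreal_mult[symmetric]) auto
        ultimately show ?thesis by (simp only:)
      qed
      also have "\<dots> \<le> ennreal (K * \<rho> * (1 / real (Suc j) ^ 2))"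
      proof (intro ennreal_leI mult_left_mono)
        have "real j / (real j + 1) ^ 3 \<le> (real j + 1) / (real j + 1) ^ 3" by (intro divide_right_mono) auto
        also have "\<dots> = 1 / real (Suc j) ^ 2" by (simp add: power2_eq_square power3_eq_cube add.commute)
        finally show "real j / (real j + 1) ^ 3 \<le> 1 / real (Suc j) ^ 2" .
      qed (use K weight_pos in auto)
      finally show "(\<integral>\<^sup>+\<omega>. ennreal \<bar>?Y j \<omega>\<bar> \<partial>M) \<le> ennreal (K * \<rho> * (1 / real (Suc j) ^ 2))" .
    qed
    have "summable (\<lambda>n. 1 / real n ^ 2)" using inverse_power_summable[of 2] by (simp add: field_simps)
    then show "summable (\<lambda>j. K * \<rho> * (1 / real (Suc j) ^ 2))"
      by (intro summable_mult) (subst summable_Suc_iff)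
  qed (use K weight_pos in auto)
  then show ?thesis
    using AE_finite_random_tree
  proof eventually_elim
    case (elim \<omega>)
    have "?S j \<omega> = ennreal (\<Sum>v\<in>random_tree age \<omega> (real j). weight \<rho> v * norm (pos v \<omega>))" for j
    proof -
      have fin: "finite (random_tree age \<omega> (real j))" using elim by blast
      have "?S j \<omega> = (\<integral>\<^sup>+v. ennreal (weight \<rho> v * norm (pos v \<omega>)) * indicator (random_tree age \<omega> (real j)) v \<partial>count_space UNIV)"
        by (intro nn_integral_cong) (auto simp: mem_random_tree split: split_indicator)
      also have "\<dots> = (\<Sum>v\<in>random_tree age \<omega> (real j). ennreal (weight \<rho> v * norm (pos v \<omega>)))"
        using fin by (subst nn_integral_indicator_finite) auto
      finally show ?thesis using weight_pos' by (simp add: sum_ennreal less_imp_le)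
    qed
    moreover have "0 \<le> (\<Sum>v\<in>random_tree age \<omega> (real j). weight \<rho> v * norm (pos v \<omega>))" for j
      by (intro sum_nonneg mult_nonneg_nonneg less_imp_le weight_pos' norm_ge_zero)
    ultimately have "enn2real (?S j \<omega>) = (\<Sum>v\<in>random_tree age \<omega> (real j). weight \<rho> v * norm (pos v \<omega>))" for j
      by (simp only: enn2real_ennreal)
    then have "?Y j \<omega> = spread (real j) \<omega> / (real j + 1) ^ 3" for j
      by (simp only: spread_def times_divide_eq_left)
    then have "summable (\<lambda>j. \<bar>spread (real j) \<omega> / (real j + 1) ^ 3\<bar>)" using elim(1) by (simp only:)
    then show ?case by (rule summable_LIMSEQ_zero[OF summable_rabs_cancel])
  qed
qed

end

section \<open>Elementary comparison estimates\<close>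

lemma tendsto_zero_power2D:
  fixes f :: "'x \<Rightarrow> real"
  assumes "((\<lambda>x. (f x)\<^sup>2) \<longlongrightarrow> 0) F"
  shows "(f \<longlongrightarrow> 0) F"
proof -
  have "((\<lambda>x. sqrt ((f x)\<^sup>2)) \<longlongrightarrow> sqrt 0) F" by (intro tendsto_intros assms)
  then show ?thesis by (simp add: tendsto_rabs_zero_iff)
qed

lemma norm_iexp_diff: "norm (iexp a - iexp b) \<le> \<bar>a - b\<bar>"
proof -
  have "iexp a - iexp b = iexp b * (iexp (a - b) - 1)"
    by (simp add: right_diff_distrib exp_add[symmetric] algebra_simps)
  then have "norm (iexp a - iexp b) = norm (iexp (a - b) - 1)" by (simp add: norm_mult)
  also have "\<dots> \<le> \<bar>a - b\<bar>" using iexp_approx1[of "a - b" 0] by simp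
  finally show ?thesis .
qed

text \<open>Three effects: the additional indices in \<open>B\<close>, the change of the
  normalization, and the change of the values on \<open>A\<close>. Each of the first two costs at
  most \<open>sum w B / sum w A - 1\<close>.\<close>

lemma weighted_mean_diff:
  fixes x y :: "'i \<Rightarrow> complex" and w :: "'i \<Rightarrow> real"
  assumes B: "finite B" "A \<subseteq> B" and w: "\<And>v. 0 \<le> w v" and A: "0 < sum w A"
    and x: "\<And>v. norm (x v) \<le> 1"
  shows "norm ((\<Sum>v\<in>B. of_real (w v) * x v) / of_real (sum w B) - (\<Sum>v\<in>A. of_real (w v) * y v) / of_real (sum w A)) \<le>
    2 * (sum w B / sum w A - 1) + (\<Sum>v\<in>A. w v * norm (x v - y v)) / sum w A"
proof -
  let ?NA = "sum w A" and ?NB = "sum w B"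
  have AB: "?NA \<le> ?NB" using B w by (intro sum_mono2) auto
  then have NB: "0 < ?NB" using A by linarith
  have le: "norm (\<Sum>v\<in>S. of_real (w v) * x v) \<le> sum w S" for S
  proof (rule order_trans[OF norm_sum sum_mono])
    show "norm (of_real (w v) * x v) \<le> w v" for v
      using w[of v] x[of v] by (simp add: norm_mult mult_left_le)
  qed
  have split: "(\<Sum>v\<in>B. of_real (w v) * x v) = (\<Sum>v\<in>A. of_real (w v) * x v) + (\<Sum>v\<in>B - A. of_real (w v) * x v)"
    using B by (subst sum.subset_diff[of A B]) auto
  have diffNB: "sum w (B - A) = ?NB - ?NA" using B by (simp add: sum_diff)
  let ?SA = "\<Sum>v\<in>A. of_real (w v) * x v"
  have "(\<Sum>v\<in>B. of_real (w v) * x v) / of_real ?NB - (\<Sum>v\<in>A. of_real (w v) * y v) / of_real ?NA =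
      (\<Sum>v\<in>B - A. of_real (w v) * x v) / of_real ?NB + ?SA * of_real (1 / ?NB - 1 / ?NA) +
      (\<Sum>v\<in>A. of_real (w v) * (x v - y v)) / of_real ?NA"
  proof -
    have alg: "(a + b) / p - y / q = b / p + a * (1 / p - 1 / q) + (a - y) / q" if "p \<noteq> 0" "q \<noteq> 0" for a b p q y :: complex
      using that by (simp add: field_simps)
    have 1: "(\<Sum>v\<in>A. of_real (w v) * (x v - y v)) = ?SA - (\<Sum>v\<in>A. of_real (w v) * y v)"
      by (simp add: right_diff_distrib sum_subtractf)
    have 2: "complex_of_real (1 / ?NB - 1 / ?NA) = 1 / of_real ?NB - 1 / of_real ?NA"
      by (simp del: of_real_sum)
    have "complex_of_real ?NB \<noteq> 0" "complex_of_real ?NA \<noteq> 0" using A NB by (simp_all del: of_real_sum)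
    from alg[OF this] show ?thesis unfolding split 1 2 .
  qed
  also have "norm \<dots> \<le> norm ((\<Sum>v\<in>B - A. of_real (w v) * x v) / of_real ?NB) + norm (?SA * of_real (1 / ?NB - 1 / ?NA)) +
      norm ((\<Sum>v\<in>A. of_real (w v) * (x v - y v)) / of_real ?NA)"
    by (intro order_trans[OF norm_triangle_ineq] add_right_mono norm_triangle_ineq)
  also have "\<dots> \<le> (?NB / ?NA - 1) + (?NB / ?NA - 1) + (\<Sum>v\<in>A. w v * norm (x v - y v)) / ?NA"
  proof (intro add_mono)
    have "norm ((\<Sum>v\<in>B - A. of_real (w v) * x v) / of_real ?NB) \<le> (?NB - ?NA) / ?NB"
      using le[of "B - A"] NB by (simp add: norm_divide diffNB divide_right_mono del: of_real_sum)
    also have "\<dots> \<le> (?NB - ?NA) / ?NA" using A AB by (intro divide_left_mono) auto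
    also have "\<dots> = ?NB / ?NA - 1" using A by (simp add: field_simps)
    finally show "norm ((\<Sum>v\<in>B - A. of_real (w v) * x v) / of_real ?NB) \<le> ?NB / ?NA - 1" .
    have "norm (?SA * of_real (1 / ?NB - 1 / ?NA)) \<le> ?NA * \<bar>1 / ?NB - 1 / ?NA\<bar>"
      unfolding norm_mult norm_of_real by (intro mult_right_mono le) auto
    also have "\<dots> = ?NA * (1 / ?NA - 1 / ?NB)" using A AB NB by (simp add: abs_if frac_le field_simps)
    also have "\<dots> = (?NB - ?NA) / ?NB" using A NB by (simp add: field_simps)
    also have "\<dots> \<le> (?NB - ?NA) / ?NA" using A AB by (intro divide_left_mono) auto
    also have "\<dots> = ?NB / ?NA - 1" using A by (simp add: field_simps)
    finally show "norm (?SA * of_real (1 / ?NB - 1 / ?NA)) \<le> ?NB / ?NA - 1" .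
    have "norm (\<Sum>v\<in>A. of_real (w v) * (x v - y v)) \<le> (\<Sum>v\<in>A. w v * norm (x v - y v))"
      using w by (intro order_trans[OF norm_sum sum_mono]) (simp add: norm_mult)
    then show "norm ((\<Sum>v\<in>A. of_real (w v) * (x v - y v)) / of_real ?NA) \<le> (\<Sum>v\<in>A. w v * norm (x v - y v)) / ?NA"
      using A by (simp add: norm_divide divide_right_mono del: of_real_sum)
  qed
  finally show ?thesis by simp
qed

section \<open>Convergence of the scaled characteristic function along the grid\<close>

context yule_branching_random_walk
begin

text \<open>The characteristic function of the normalized empirical distribution, as shown in
  \<open>char_empirical\<close>; the last factor is the effect of the centring.\<close>

definition scaled_char :: "'b \<Rightarrow> 'b \<Rightarrow> real \<Rightarrow> 'a \<Rightarrow> complex" where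
  "scaled_char m s t \<omega> = node_char s (1 / sqrt t) t \<omega> / of_real (total_weight \<rho> (random_tree age \<omega> t)) *
     iexp (- (sqrt t * (s \<bullet> m)))"

lemma scaled_char_eq:
  assumes "finite (random_tree age \<omega> t)"
  shows "scaled_char m s t \<omega> =
    (\<Sum>v\<in>random_tree age \<omega> t. of_real (weight \<rho> v) * iexp ((s \<bullet> pos v \<omega>) / sqrt t - sqrt t * (s \<bullet> m))) /
      of_real (sum (weight \<rho>) (random_tree age \<omega> t))"
proof -
  have e: "iexp (1 * x / sqrt t) * iexp (- y) = iexp (x / sqrt t - y)" for x y
    unfolding exp_add[symmetric] distrib_left[symmetric] of_real_add[symmetric] by simp
  show ?thesis
    unfolding scaled_char_def node_char_eq_sum[OF assms] total_weight_def times_divide_eq_left sum_distrib_right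
      mult.assoc e ..
qed

lemma norm_offset_char_diff:
  assumes D: "integrable D norm"
  shows "norm (1 - offset_char s c) \<le> \<bar>c\<bar> * (norm s * (\<integral>x. norm x \<partial>D))"
proof -
  interpret D: prob_space D by (rule prob_space_offset_law)
  have i: "integrable D (\<lambda>x. iexp (c * (s \<bullet> x)))"
    by (rule D.integrable_const_bound[of _ 1]) auto
  have "1 - offset_char s c = (\<integral>x. 1 - iexp (c * (s \<bullet> x)) \<partial>D)"
    unfolding offset_char_def char_def using i D.prob_space by (simp add: integral_distr)
  also have "norm \<dots> \<le> (\<integral>x. norm (1 - iexp (c * (s \<bullet> x))) \<partial>D)"
    by (rule integral_norm_bound)
  also have "\<dots> \<le> (\<integral>x. \<bar>c\<bar> * (norm s * norm x) \<partial>D)"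
  proof (rule integral_mono)
    fix x
    have "norm (1 - iexp (c * (s \<bullet> x))) \<le> \<bar>c * (s \<bullet> x)\<bar>"
      using norm_iexp_diff[of 0 "c * (s \<bullet> x)"] by simp
    also have "\<dots> \<le> \<bar>c\<bar> * (norm s * norm x)"
      unfolding abs_mult by (intro mult_left_mono Cauchy_Schwarz_ineq2) auto
    finally show "norm (1 - iexp (c * (s \<bullet> x))) \<le> \<bar>c\<bar> * (norm s * norm x)" .
  qed (use i D in auto)
  finally show ?thesis by simp
qed

lemma norm_node_char_diff:
  assumes fin: "finite (random_tree age \<omega> t)"
  shows "norm (node_char s c t \<omega> - of_real (total_weight \<rho> (random_tree age \<omega> t))) \<le> \<bar>c\<bar> * norm s * (exp t * spread t \<omega>)"
proof -
  let ?T = "random_tree age \<omega> t"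
  have "node_char s c t \<omega> - of_real (total_weight \<rho> ?T) = (\<Sum>v\<in>?T. of_real (weight \<rho> v) * (iexp (c * (s \<bullet> pos v \<omega>)) - iexp 0))"
    by (simp add: node_char_eq_sum[OF fin] total_weight_def right_diff_distrib sum_subtractf)
  also have "norm \<dots> \<le> (\<Sum>v\<in>?T. \<bar>c\<bar> * norm s * (weight \<rho> v * norm (pos v \<omega>)))"
  proof (rule order_trans[OF norm_sum sum_mono])
    fix v
    have "norm (iexp (c * (s \<bullet> pos v \<omega>)) - iexp 0) \<le> \<bar>c * (s \<bullet> pos v \<omega>)\<bar>"
      using norm_iexp_diff[of "c * (s \<bullet> pos v \<omega>)" 0] by simp
    also have "\<dots> \<le> \<bar>c\<bar> * (norm s * norm (pos v \<omega>))"
      unfolding abs_mult by (intro mult_left_mono Cauchy_Schwarz_ineq2) auto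
    finally have "weight \<rho> v * norm (iexp (c * (s \<bullet> pos v \<omega>)) - iexp 0) \<le> weight \<rho> v * (\<bar>c\<bar> * (norm s * norm (pos v \<omega>)))"
      using weight_pos'[of v] by (intro mult_left_mono) auto
    then show "norm (of_real (weight \<rho> v) * (iexp (c * (s \<bullet> pos v \<omega>)) - iexp 0)) \<le> \<bar>c\<bar> * norm s * (weight \<rho> v * norm (pos v \<omega>))"
      using weight_pos'[of v] by (simp add: norm_mult mult_ac)
  qed
  also have "\<dots> = \<bar>c\<bar> * norm s * (exp t * spread t \<omega>)"
    by (simp add: spread_def sum_distrib_left[symmetric] exp_minus)
  finally show ?thesis .
qed

text \<open>Mean square increments that are summable along a sequence of times vanish almost surely.
  One instance links early and grid times, the other consecutive grid times for the
  interpolation.\<close>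

lemma AE_normalized_weight_grid:
  "AE \<omega> in M. (\<lambda>n. normalized_weight (grid n) \<omega> - normalized_weight (real (early n)) \<omega>) \<longlonglongrightarrow> 0"
  "AE \<omega> in M. (\<lambda>n. normalized_weight (grid (Suc n)) \<omega> - normalized_weight (grid n) \<omega>) \<longlonglongrightarrow> 0"
proof -
  have gen: "AE \<omega> in M. (\<lambda>n. normalized_weight (t n) \<omega> - normalized_weight (r n) \<omega>) \<longlonglongrightarrow> 0"
    if tr: "\<And>n. 0 \<le> r n" "\<And>n. r n \<le> t n" and s: "summable (\<lambda>n. exp (- (r n / 4)))" for t r
  proof -
    have "AE \<omega> in M. summable (\<lambda>n. \<bar>(normalized_weight (t n) \<omega> - normalized_weight (r n) \<omega>)\<^sup>2\<bar>)"
    proof (rule AE_tendsto_zero_of_summable)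
      show "\<forall>\<^sub>F n in sequentially. (\<integral>\<^sup>+\<omega>. ennreal \<bar>(normalized_weight (t n) \<omega> - normalized_weight (r n) \<omega>)\<^sup>2\<bar> \<partial>M)
          \<le> ennreal (measure ancestor_law UNIV * exp (- (r n / 4)))"
        using normalized_weight_increment[OF tr] by (intro always_eventually allI) simp
      show "summable (\<lambda>n. measure ancestor_law UNIV * exp (- (r n / 4)))" by (intro summable_mult s)
    qed auto
    then show ?thesis
    proof eventually_elim
      case (elim \<omega>)
      then have "(\<lambda>n. (normalized_weight (t n) \<omega> - normalized_weight (r n) \<omega>)\<^sup>2) \<longlonglongrightarrow> 0"
        unfolding abs_power2 by (rule summable_LIMSEQ_zero)
      then show ?case by (rule tendsto_zero_power2D)
    qed
  qed
  show "AE \<omega> in M. (\<lambda>n. normalized_weight (grid n) \<omega> - normalized_weight (real (early n)) \<omega>) \<longlonglongrightarrow> 0"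
    by (rule gen[OF _ early_le_grid summable_exp_early]) simp
  show "AE \<omega> in M. (\<lambda>n. normalized_weight (grid (Suc n)) \<omega> - normalized_weight (grid n) \<omega>) \<longlonglongrightarrow> 0"
    by (rule gen[OF order_trans[OF zero_le_one grid_ge_1] grid_mono summable_exp_grid]) simp
qed

lemma integrable_norm_offset:
  assumes D2: "integrable D (\<lambda>x. (norm x)\<^sup>2)"
  shows "integrable D norm" "integrable D (\<lambda>x. x)"
proof -
  interpret D: prob_space D by (rule prob_space_offset_law)
  show "integrable D norm"
    by (rule D.square_integrable_imp_integrable[OF _ D2]) simp
  then show "integrable D (\<lambda>x. x)" by (simp add: integrable_norm_iff)
qed

lemma offset_char_limit:
  assumes D2: "integrable D (\<lambda>x. (norm x)\<^sup>2)" and t: "filterlim t at_top sequentially" "\<And>n. 0 < t n"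
  shows "(\<lambda>n. exp (of_real (t n) * (offset_char s (1 / sqrt (t n)) - 1) -
      \<i> * of_real (sqrt (t n) * (s \<bullet> (\<integral>x. x \<partial>D))))) \<longlonglongrightarrow>
    of_real (exp (- (\<integral>x. (s \<bullet> x)\<^sup>2 \<partial>D) / 2))"
proof -
  let ?R = "distr D borel (\<lambda>x. s \<bullet> x)"
  have sm: "(\<lambda>x. s \<bullet> x) \<in> borel_measurable D" by measurable
  have R: "real_distribution ?R"
    using prob_space.real_distribution_distr[OF prob_space_offset_law sm] .
  have e1: "(\<integral>x. x \<partial>?R) = s \<bullet> (\<integral>x. x \<partial>D)"
    using integrable_norm_offset(2)[OF D2] by (subst integral_distr[OF sm]) auto
  have e2: "(\<integral>x. x\<^sup>2 \<partial>?R) = (\<integral>x. (s \<bullet> x)\<^sup>2 \<partial>D)"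
    by (subst integral_distr[OF sm]) auto
  have "integrable D (\<lambda>x. (s \<bullet> x)\<^sup>2)"
  proof (rule Bochner_Integration.integrable_bound)
    show "integrable D (\<lambda>x. (norm s)\<^sup>2 * (norm x)\<^sup>2)" using D2 by simp
    show "AE x in D. norm ((s \<bullet> x)\<^sup>2) \<le> norm ((norm s)\<^sup>2 * (norm x)\<^sup>2)"
    proof (rule AE_I2)
      fix x
      have "\<bar>s \<bullet> x\<bar>\<^sup>2 \<le> (norm s * norm x)\<^sup>2"
        by (intro power_mono Cauchy_Schwarz_ineq2) simp
      then show "norm ((s \<bullet> x)\<^sup>2) \<le> norm ((norm s)\<^sup>2 * (norm x)\<^sup>2)"
        by (simp add: power_mult_distrib)
    qed
  qed simp
  then have i2: "integrable ?R (\<lambda>x. x\<^sup>2)" by (subst integrable_distr_eq[OF sm]) auto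
  show ?thesis
    using real_distribution.compound_poisson_limit[OF R i2 t] unfolding e1 e2 offset_char_def .
qed

text \<open>The martingale at the grid time is replaced by its value at the early time, this by the
  normalized weight there, and this by the normalized weight at the grid time. The weight is bounded
  away from 0, so the differences yield a quotient tending to 1, and what remains is the compound
  Poisson factor.\<close>

lemma AE_scaled_char_grid:
  assumes D2: "integrable D (\<lambda>x. (norm x)\<^sup>2)"
  shows "AE \<omega> in M. (\<lambda>n. scaled_char (\<integral>x. x \<partial>D) s (grid n) \<omega>) \<longlonglongrightarrow> of_real (exp (- (\<integral>x. (s \<bullet> x)\<^sup>2 \<partial>D) / 2))"
proof -
  interpret D: prob_space D by (rule prob_space_offset_law)
  define m where "m = (\<integral>x. x \<partial>D)"
  note Dn = integrable_norm_offset(1)[OF D2]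
  define c where "c n = 1 / sqrt (grid n)" for n
  define \<phi> where "\<phi> n = offset_char s (c n)" for n
  define A where "A = norm s * (\<integral>x. norm x \<partial>D)"
  have A: "0 \<le> A" by (simp add: A_def)
  have g0: "0 < grid n" for n using grid_ge_1[of n] by linarith
  have c0: "0 < c n" for n using g0 by (simp add: c_def)
  have \<phi>b: "norm (1 - \<phi> n) \<le> c n * A" for n
    using norm_offset_char_diff[OF Dn, of s "c n"] c0[of n] by (simp add: \<phi>_def A_def)
  have climit: "c \<longlonglongrightarrow> 0" unfolding c_def[abs_def]
    by (intro tendsto_divide_0[OF tendsto_const] filterlim_at_top_imp_at_infinity
        filterlim_compose[OF sqrt_at_top filterlim_grid])
  have "(\<lambda>n. 1 - \<phi> n) \<longlonglongrightarrow> 0"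
    by (rule Lim_null_comparison[of _ "\<lambda>n. c n * A"]) (use \<phi>b in \<open>auto intro!: tendsto_mult_left_zero climit\<close>)
  then have "(\<lambda>n. Re (1 - \<phi> n)) \<longlonglongrightarrow> 0" using tendsto_Re by fastforce
  then have ev: "\<forall>\<^sub>F n in sequentially. 3 / 4 \<le> Re (\<phi> n)"
    using order_tendstoD(2)[of "\<lambda>n. Re (1 - \<phi> n)" 0 sequentially "1 / 4"] by (auto elim: eventually_mono)
  \<comment> \<open>\<open>E\<close> and \<open>G\<close> are martingale values at the early and at
    the grid time, both taken at the frequency of the grid time.\<close>
  define E where "E n \<omega> = exp (- \<phi> n * of_real (real (early n))) * node_char s (c n) (real (early n)) \<omega>" for n \<omega>
  define G where "G n \<omega> = exp (- \<phi> n * of_real (grid n)) * node_char s (c n) (grid n) \<omega>" for n \<omega>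
  have [measurable]: "E n \<in> borel_measurable M" "G n \<in> borel_measurable M" for n
    unfolding E_def[abs_def] G_def[abs_def] by measurable
  have "AE \<omega> in M. summable (\<lambda>n. \<bar>(norm (G n \<omega> - E n \<omega>))\<^sup>2\<bar>)"
  proof (rule AE_tendsto_zero_of_summable)
    show "\<forall>\<^sub>F n in sequentially. (\<integral>\<^sup>+\<omega>. ennreal \<bar>(norm (G n \<omega> - E n \<omega>))\<^sup>2\<bar> \<partial>M)
        \<le> ennreal (measure ancestor_law UNIV * exp (- (real (early n) / 4)))"
      using ev
    proof eventually_elim
      case (elim n)
      then show ?case
        using node_char_increment[of "real (early n)" "grid n" s "c n"] early_le_grid[of n]
        by (simp add: G_def E_def \<phi>_def)
    qed
    show "summable (\<lambda>n. measure ancestor_law UNIV * exp (- (real (early n) / 4)))"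
      by (intro summable_mult summable_exp_early)
  qed auto
  then show ?thesis
    using AE_finite_random_tree AE_normalized_weight_lower_bound AE_convergent_normalized_weight
      AE_normalized_weight_grid(1) AE_spread[OF Dn]
  proof eventually_elim
    case (elim \<omega>)
    have fin: "finite (random_tree age \<omega> t)" for t using elim by blast
    have GE: "(\<lambda>n. G n \<omega> - E n \<omega>) \<longlonglongrightarrow> 0"
    proof -
      have "(\<lambda>n. (norm (G n \<omega> - E n \<omega>))\<^sup>2) \<longlonglongrightarrow> 0" using elim(1) unfolding abs_power2 by (rule summable_LIMSEQ_zero)
      then show ?thesis by (rule tendsto_norm_zero_cancel[OF tendsto_zero_power2D])
    qed
    define We where "We n = normalized_weight (real (early n)) \<omega>" for n
    define Wg where "Wg n = normalized_weight (grid n) \<omega>" for n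
    obtain L where "(\<lambda>n. normalized_weight (real n) \<omega>) \<longlonglongrightarrow> L" using elim(4) by (auto simp: convergent_def)
    then have We: "We \<longlonglongrightarrow> L"
      unfolding We_def[abs_def] by (rule filterlim_compose[OF _ filterlim_early])
    have sp: "(\<lambda>n. c n * spread (real (early n)) \<omega>) \<longlonglongrightarrow> 0"
    proof -
      have "(\<lambda>n. spread (real (early n)) \<omega> / (real (early n) + 1) ^ 3 * ((real (early n) + 1) ^ 3 / sqrt (grid n))) \<longlonglongrightarrow> 0 * 0"
        by (intro tendsto_mult early_cube_over_sqrt_grid filterlim_compose[OF elim(6) filterlim_early])
      moreover have "spread (real (early n)) \<omega> / (real (early n) + 1) ^ 3 * ((real (early n) + 1) ^ 3 / sqrt (grid n)) =
          c n * spread (real (early n)) \<omega>" for n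
      proof -
        have "(real (early n) + 1) ^ 3 \<noteq> 0" by (simp add: add_eq_0_iff)
        then show ?thesis by (simp add: c_def)
      qed
      ultimately show ?thesis by simp
    qed
    \<comment> \<open>At the early time \<open>r\<close> the martingale discounts with \<phi>
      instead of 1, and \<open>exp (- \<phi> r) = exp q * exp (- r)\<close>. The difference
      \<open>1 - \<phi> n\<close> is at most of order \<open>1 / sqrt (grid n)\<close>, so
      \<open>q\<close> vanishes.\<close>
    define q where "q n = (1 - \<phi> n) * of_real (real (early n))" for n
    have q: "q \<longlonglongrightarrow> 0"
    proof (rule Lim_null_comparison)
      have "(\<lambda>n. A * ((real (early n) + 1) ^ 3 / sqrt (grid n))) \<longlonglongrightarrow> A * 0"
        by (intro tendsto_intros early_cube_over_sqrt_grid)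
      then show "(\<lambda>n. A * ((real (early n) + 1) ^ 3 / sqrt (grid n))) \<longlonglongrightarrow> 0" by simp
      show "\<forall>\<^sub>F n in sequentially. norm (q n) \<le> A * ((real (early n) + 1) ^ 3 / sqrt (grid n))"
      proof (rule always_eventually, rule allI)
        fix n
        have "norm (q n) = norm (1 - \<phi> n) * real (early n)" by (simp add: q_def norm_mult)
        also have "\<dots> \<le> (c n * A) * real (early n)" by (intro mult_right_mono \<phi>b) auto
        also have "\<dots> \<le> (c n * A) * (real (early n) + 1) ^ 3"
        proof (intro mult_left_mono)
          have "real (early n) + 1 \<le> (real (early n) + 1) ^ 3" using self_le_power[of "real (early n) + 1" 3] by simp
          then show "real (early n) \<le> (real (early n) + 1) ^ 3" by linarith
        qed (use c0[of n] A in auto)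
        also have "c n * A * (real (early n) + 1) ^ 3 = A * ((real (early n) + 1) ^ 3 / sqrt (grid n))"
          unfolding c_def by simp
        finally show "norm (q n) \<le> A * ((real (early n) + 1) ^ 3 / sqrt (grid n))" .
      qed
    qed
    have EW: "(\<lambda>n. E n \<omega> - of_real (We n)) \<longlonglongrightarrow> 0"
    proof (rule Lim_null_comparison)
      have "(\<lambda>n. norm (exp (q n)) * (norm s * (c n * spread (real (early n)) \<omega>)) + norm (exp (q n) - 1) * We n) \<longlonglongrightarrow>
          norm (exp (0 :: complex)) * (norm s * 0) + norm (exp (0 :: complex) - 1) * L"
        by (intro tendsto_intros q sp We)
      then show "(\<lambda>n. norm (exp (q n)) * (norm s * (c n * spread (real (early n)) \<omega>)) + norm (exp (q n) - 1) * We n) \<longlonglongrightarrow> 0"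
        by simp
      show "\<forall>\<^sub>F n in sequentially. norm (E n \<omega> - of_real (We n)) \<le>
          norm (exp (q n)) * (norm s * (c n * spread (real (early n)) \<omega>)) + norm (exp (q n) - 1) * We n"
      proof (rule always_eventually, rule allI)
        fix n
        let ?r = "real (early n)"
        let ?N = "total_weight \<rho> (random_tree age \<omega> ?r)"
        have ex: "exp (- \<phi> n * of_real ?r) = exp (q n) * of_real (exp (- ?r))"
          unfolding exp_of_real[symmetric] exp_add[symmetric] q_def
          by (rule arg_cong[where f = exp]) (simp add: algebra_simps)
        have E': "E n \<omega> = exp (q n) * of_real (exp (- ?r)) * node_char s (c n) ?r \<omega>"
          unfolding E_def ex ..
        have "E n \<omega> - of_real (We n) = exp (q n) * of_real (exp (- ?r)) * (node_char s (c n) ?r \<omega> - of_real ?N) +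
            (exp (q n) - 1) * of_real (We n)"
          unfolding E' We_def normalized_weight_def of_real_mult by (simp add: algebra_simps)
        also have "norm \<dots> \<le> norm (exp (q n)) * exp (- ?r) * norm (node_char s (c n) ?r \<omega> - of_real ?N) +
            norm (exp (q n) - 1) * We n"
          using normalized_weight_nonneg[of ?r \<omega>]
          by (intro order_trans[OF norm_triangle_ineq]) (simp add: norm_mult We_def)
        also have "\<dots> \<le> norm (exp (q n)) * exp (- ?r) * (\<bar>c n\<bar> * norm s * (exp ?r * spread ?r \<omega>)) +
            norm (exp (q n) - 1) * We n"
          by (intro add_right_mono mult_left_mono norm_node_char_diff fin) auto
        also have "norm (exp (q n)) * exp (- ?r) * (\<bar>c n\<bar> * norm s * (exp ?r * spread ?r \<omega>)) =
            norm (exp (q n)) * (norm s * (c n * spread ?r \<omega>))"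
          using c0[of n] by (simp add: exp_minus)
        finally show "norm (E n \<omega> - of_real (We n)) \<le>
          norm (exp (q n)) * (norm s * (c n * spread ?r \<omega>)) + norm (exp (q n) - 1) * We n" .
      qed
    qed
    have "(\<lambda>n. (G n \<omega> - E n \<omega>) + (E n \<omega> - of_real (We n)) - of_real (Wg n - We n)) \<longlonglongrightarrow> 0 + 0 - of_real 0"
      using elim(5) unfolding We_def[symmetric] Wg_def[symmetric] by (intro tendsto_intros GE EW)
    then have GW: "(\<lambda>n. G n \<omega> - of_real (Wg n)) \<longlonglongrightarrow> 0" by simp
    obtain d where d: "0 < d" "\<forall>\<^sub>F t in at_top. d \<le> normalized_weight t \<omega>" using elim(3) by blast
    have Wgd: "\<forall>\<^sub>F n in sequentially. d \<le> Wg n"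
      unfolding Wg_def by (rule eventually_compose_filterlim[OF d(2) filterlim_grid])
    have ratio: "(\<lambda>n. G n \<omega> / of_real (Wg n)) \<longlonglongrightarrow> 1"
    proof (rule LIM_zero_cancel, rule Lim_null_comparison)
      have "(\<lambda>n. norm (G n \<omega> - of_real (Wg n)) / d) \<longlonglongrightarrow> 0 / d"
        using d(1) by (intro tendsto_intros tendsto_norm_zero GW) auto
      then show "(\<lambda>n. norm (G n \<omega> - of_real (Wg n)) / d) \<longlonglongrightarrow> 0" by simp
      show "\<forall>\<^sub>F n in sequentially. norm (G n \<omega> / of_real (Wg n) - 1) \<le> norm (G n \<omega> - of_real (Wg n)) / d"
        using Wgd
      proof eventually_elim
        case (elim n)
        then have "0 < Wg n" using d(1) by linarith
        then have "G n \<omega> / of_real (Wg n) - 1 = (G n \<omega> - of_real (Wg n)) / of_real (Wg n)" by (simp add: diff_divide_distrib)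
        then have "norm (G n \<omega> / of_real (Wg n) - 1) = norm (G n \<omega> - of_real (Wg n)) / Wg n"
          using \<open>0 < Wg n\<close> by (simp add: norm_divide)
        also have "\<dots> \<le> norm (G n \<omega> - of_real (Wg n)) / d" using elim d(1) by (intro divide_left_mono) auto
        finally show ?case .
      qed
    qed
    have P: "(\<lambda>n. exp (of_real (grid n) * (\<phi> n - 1) - \<i> * of_real (sqrt (grid n) * (s \<bullet> m)))) \<longlonglongrightarrow>
        of_real (exp (- (\<integral>x. (s \<bullet> x)\<^sup>2 \<partial>D) / 2))"
      unfolding \<phi>_def c_def m_def by (rule offset_char_limit[OF D2 filterlim_grid g0])
    have "(\<lambda>n. exp (of_real (grid n) * (\<phi> n - 1) - \<i> * of_real (sqrt (grid n) * (s \<bullet> m))) * (G n \<omega> / of_real (Wg n))) \<longlonglongrightarrow>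
        of_real (exp (- (\<integral>x. (s \<bullet> x)\<^sup>2 \<partial>D) / 2)) * 1"
      by (intro tendsto_mult P ratio)
    moreover have "exp (of_real (grid n) * (\<phi> n - 1) - \<i> * of_real (sqrt (grid n) * (s \<bullet> m))) * (G n \<omega> / of_real (Wg n)) =
        scaled_char m s (grid n) \<omega>" for n
    proof -
      let ?g = "grid n"
      \<comment> \<open>The normalization of \<open>G\<close> cancels against the compound Poisson
        factor. The remaining \<open>exp (- ?g)\<close> turns the normalized weight in the
        denominator back into the total weight.\<close>
      have 1: "exp (of_real ?g * (\<phi> n - 1) - \<i> * of_real (sqrt ?g * (s \<bullet> m))) * exp (- \<phi> n * of_real ?g) =
          of_real (exp (- ?g)) * iexp (- (sqrt ?g * (s \<bullet> m)))"
        unfolding exp_of_real[symmetric] exp_add[symmetric]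
        by (rule arg_cong[where f = exp]) (simp add: algebra_simps)
      have "exp (of_real ?g * (\<phi> n - 1) - \<i> * of_real (sqrt ?g * (s \<bullet> m))) * (G n \<omega> / of_real (Wg n)) =
          (exp (of_real ?g * (\<phi> n - 1) - \<i> * of_real (sqrt ?g * (s \<bullet> m))) * exp (- \<phi> n * of_real ?g)) *
            node_char s (c n) ?g \<omega> / of_real (Wg n)"
        by (simp only: G_def mult.assoc times_divide_eq_right)
      also have "\<dots> = scaled_char m s ?g \<omega>"
        unfolding 1 by (simp add: scaled_char_def c_def Wg_def normalized_weight_def)
      finally show ?thesis .
    qed
    ultimately show ?case by (simp add: m_def)
  qed
qed

end

section \<open>Interpolation between grid times\<close>

lemma
  shows grid_increment: "(\<lambda>n. grid (Suc n) - grid n) \<longlonglongrightarrow> 0"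
    and sqrt_grid_increment: "(\<lambda>n. sqrt (grid (Suc n)) - sqrt (grid n)) \<longlonglongrightarrow> 0"
    and inverse_sqrt_grid_increment:
      "(\<lambda>n. (grid n + 2) ^ 3 * (1 / sqrt (grid n) - 1 / sqrt (grid (Suc n)))) \<longlonglongrightarrow> 0"
  unfolding grid_def of_nat_Suc by real_asymp+

text \<open>The inverse of the grid up to rounding: \<open>grid n = t\<close> means
  \<open>n + 1 = t ^ 4\<close>, whence the subtraction of 1.\<close>

definition grid_index :: "real \<Rightarrow> nat" where "grid_index t = nat \<lfloor>t ^ 4\<rfloor> - 1"

lemma grid_index_bounds:
  assumes t: "1 \<le> t"
  shows "grid (grid_index t) \<le> t" "t \<le> grid (Suc (grid_index t))"
proof -
  have t4: "(t ^ 4) powr (1 / 4) = t"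
  proof -
    have "(t ^ 4) powr (1 / 4) = (t powr 4) powr (1 / 4)"
      using t by (simp only: powr_numeral)
    also have "\<dots> = t" using t unfolding powr_powr by simp
    finally show ?thesis .
  qed
  define z where "z = t ^ 4"
  have "1 \<le> z" using t unfolding z_def by (rule one_le_power)
  then have "1 \<le> \<lfloor>z\<rfloor>" by (simp only: one_le_floor)
  then have "int (grid_index t) + 1 = \<lfloor>z\<rfloor>"
    unfolding grid_index_def z_def[symmetric] by linarith
  then have k: "real (grid_index t) + 1 = real_of_int \<lfloor>z\<rfloor>" by linarith
  then have l: "real (grid_index t) + 1 \<le> z" "z \<le> real (grid_index t) + 1 + 1"
    by linarith+
  have "grid (grid_index t) \<le> z powr (1 / 4)"
    unfolding grid_def by (rule powr_mono2[OF _ _ l(1)]) simp_all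
  then show "grid (grid_index t) \<le> t" by (simp only: t4 z_def)
  have "z powr (1 / 4) \<le> grid (Suc (grid_index t))"
    unfolding grid_def of_nat_Suc using l(2) \<open>1 \<le> z\<close> by (intro powr_mono2) simp_all
  then show "t \<le> grid (Suc (grid_index t))" by (simp only: t4 z_def)
qed

lemma filterlim_grid_index: "filterlim grid_index sequentially at_top"
  unfolding filterlim_at_top
proof
  fix K :: nat
  show "\<forall>\<^sub>F t in at_top. K \<le> grid_index t"
    using eventually_ge_at_top[of "real K + 2"]
  proof eventually_elim
    case (elim t)
    have "t \<le> t ^ 4" using elim by (intro self_le_power) simp_all
    then have "real_of_int (int K + 2) \<le> t ^ 4" using elim by simp
    then have "int K + 2 \<le> \<lfloor>t ^ 4\<rfloor>" by (simp only: le_floor_iff)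
    then have "K + 2 \<le> nat \<lfloor>t ^ 4\<rfloor>" by (simp add: le_nat_iff)
    then show ?case unfolding grid_index_def by linarith
  qed
qed

context yule_branching_random_walk
begin

text \<open>The sum without normalization grows with the tree, so rounding the time up costs only
  the ratio of the exponential factors.\<close>

lemma spread_le_Suc:
  assumes fin: "\<And>t. finite (random_tree age \<omega> t)" and j: "t \<le> real j" "real j \<le> t + 1"
  shows "spread t \<omega> \<le> exp 1 * spread (real j) \<omega>"
proof -
  have "(\<Sum>v\<in>random_tree age \<omega> t. weight \<rho> v * norm (pos v \<omega>)) \<le> (\<Sum>v\<in>random_tree age \<omega> (real j). weight \<rho> v * norm (pos v \<omega>))"
    using weight_pos' by (intro sum_mono2 fin random_tree_mono j) (auto simp: less_imp_le)
  then have "spread t \<omega> \<le> exp (- t) * (\<Sum>v\<in>random_tree age \<omega> (real j). weight \<rho> v * norm (pos v \<omega>))"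
    unfolding spread_def by (intro mult_left_mono) auto
  also have "\<dots> = exp (real j - t) * spread (real j) \<omega>"
    by (simp add: spread_def exp_diff exp_minus field_simps)
  also have "\<dots> \<le> exp 1 * spread (real j) \<omega>"
    using j by (intro mult_right_mono spread_nonneg) auto
  finally show ?thesis .
qed

text \<open>An instance of \<open>weighted_mean_diff\<close> for the trees at \<open>g\<close> and
  \<open>t\<close>. Monotonicity then moves \<open>t\<close> to the right endpoint, which makes the
  bound uniform over the interval.\<close>

lemma scaled_char_diff:
  assumes fin: "\<And>t. finite (random_tree age \<omega> t)" and g: "0 < g" "g \<le> t" "t \<le> h"
    and W: "0 < normalized_weight g \<omega>"
  shows "norm (scaled_char m s t \<omega> - scaled_char m s g \<omega>) \<le>
    2 * (exp (h - g) * (normalized_weight h \<omega> / normalized_weight g \<omega>) - 1) +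
    (norm s * (1 / sqrt g - 1 / sqrt h) * (spread g \<omega> / normalized_weight g \<omega>) + \<bar>s \<bullet> m\<bar> * (sqrt h - sqrt g))"
proof -
  let ?w = "weight \<rho>" and ?A = "random_tree age \<omega> g" and ?B = "random_tree age \<omega> t" and ?C = "random_tree age \<omega> h"
  let ?y = "\<lambda>t v. (s \<bullet> pos v \<omega>) / sqrt t - sqrt t * (s \<bullet> m)"
  define a where "a = norm s * (1 / sqrt g - 1 / sqrt h)"
  define b where "b = \<bar>s \<bullet> m\<bar> * (sqrt h - sqrt g)"
  have NA: "sum ?w ?A = exp g * normalized_weight g \<omega>" and NC: "sum ?w ?C = exp h * normalized_weight h \<omega>"
    by (simp_all add: normalized_weight_def total_weight_def exp_minus)
  have pos: "0 < sum ?w ?A" unfolding NA using W by simp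
  have diff: "norm (iexp (?y t v) - iexp (?y g v)) \<le> a * norm (pos v \<omega>) + b" for v
  proof -
    have i: "1 / sqrt h \<le> 1 / sqrt t" "1 / sqrt t \<le> 1 / sqrt g" using g by (auto intro!: divide_left_mono)
    have q: "sqrt g \<le> sqrt t" "sqrt t \<le> sqrt h" using g by auto
    have "?y t v - ?y g v = (s \<bullet> pos v \<omega>) * (1 / sqrt t - 1 / sqrt g) - (s \<bullet> m) * (sqrt t - sqrt g)"
      by (simp add: algebra_simps diff_divide_distrib)
    then have "\<bar>?y t v - ?y g v\<bar> \<le> \<bar>s \<bullet> pos v \<omega>\<bar> * \<bar>1 / sqrt t - 1 / sqrt g\<bar> + \<bar>s \<bullet> m\<bar> * \<bar>sqrt t - sqrt g\<bar>"
      by (metis abs_mult abs_triangle_ineq4)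
    also have "\<dots> \<le> (norm s * norm (pos v \<omega>)) * (1 / sqrt g - 1 / sqrt h) + \<bar>s \<bullet> m\<bar> * (sqrt h - sqrt g)"
      using i q by (intro add_mono mult_mono Cauchy_Schwarz_ineq2) auto
    finally show ?thesis
      using norm_iexp_diff[of "?y t v" "?y g v"] by (simp add: a_def b_def mult_ac)
  qed
  have "norm (scaled_char m s t \<omega> - scaled_char m s g \<omega>) \<le>
      2 * (sum ?w ?B / sum ?w ?A - 1) + (\<Sum>v\<in>?A. ?w v * norm (iexp (?y t v) - iexp (?y g v))) / sum ?w ?A"
    unfolding scaled_char_eq[OF fin]
    using weight_pos' g pos by (intro weighted_mean_diff fin random_tree_mono) (auto simp: less_imp_le)
  also have "\<dots> \<le> 2 * (exp (h - g) * (normalized_weight h \<omega> / normalized_weight g \<omega>) - 1) +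
      (a * (spread g \<omega> / normalized_weight g \<omega>) + b)"
  proof (intro add_mono mult_left_mono diff_right_mono)
    have "sum ?w ?B \<le> sum ?w ?C"
      using weight_pos' g by (intro sum_mono2 fin random_tree_mono) (auto simp: less_imp_le)
    then have "sum ?w ?B / sum ?w ?A \<le> sum ?w ?C / sum ?w ?A" using pos by (intro divide_right_mono) auto
    also have "\<dots> = exp (h - g) * (normalized_weight h \<omega> / normalized_weight g \<omega>)"
      unfolding NA NC by (simp add: exp_diff)
    finally show "sum ?w ?B / sum ?w ?A \<le> exp (h - g) * (normalized_weight h \<omega> / normalized_weight g \<omega>)" .
    have "(\<Sum>v\<in>?A. ?w v * norm (iexp (?y t v) - iexp (?y g v))) \<le> (\<Sum>v\<in>?A. ?w v * (a * norm (pos v \<omega>) + b))"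
      using weight_pos' by (intro sum_mono mult_left_mono diff) (simp add: less_imp_le)
    also have "\<dots> = a * (\<Sum>v\<in>?A. ?w v * norm (pos v \<omega>)) + b * sum ?w ?A"
      by (simp add: distrib_left sum.distrib sum_distrib_left mult_ac)
    also have "(\<Sum>v\<in>?A. ?w v * norm (pos v \<omega>)) = exp g * spread g \<omega>" by (simp add: spread_def exp_minus)
    finally have "(\<Sum>v\<in>?A. ?w v * norm (iexp (?y t v) - iexp (?y g v))) / sum ?w ?A \<le>
        (a * (exp g * spread g \<omega>) + b * sum ?w ?A) / sum ?w ?A"
      using pos by (intro divide_right_mono) auto
    also have "\<dots> = a * (spread g \<omega> / normalized_weight g \<omega>) + b"
      using pos W unfolding NA by (simp add: add_divide_distrib)
    finally show "(\<Sum>v\<in>?A. ?w v * norm (iexp (?y t v) - iexp (?y g v))) / sum ?w ?A \<le>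
        a * (spread g \<omega> / normalized_weight g \<omega>) + b" .
  qed auto
  finally show ?thesis by (simp only: a_def b_def)
qed

text \<open>Everything concerns one fixed sample point, and of the hypotheses only the convergence
  along the grid mentions \<open>s\<close>. The interpolation thus introduces no null set that
  depends on the frequency.\<close>

lemma scaled_char_at_top:
  assumes fin: "\<And>t. finite (random_tree age \<omega> t)"
    and d: "0 < d" "\<forall>\<^sub>F t in at_top. d \<le> normalized_weight t \<omega>"
    and dW: "(\<lambda>n. normalized_weight (grid (Suc n)) \<omega> - normalized_weight (grid n) \<omega>) \<longlonglongrightarrow> 0"
    and sp: "(\<lambda>j. spread (real j) \<omega> / (real j + 1) ^ 3) \<longlonglongrightarrow> 0"
    and lim: "(\<lambda>n. scaled_char m s (grid n) \<omega>) \<longlonglongrightarrow> l"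
  shows "((\<lambda>t. scaled_char m s t \<omega>) \<longlongrightarrow> l) at_top"
proof -
  define W where "W n = normalized_weight (grid n) \<omega>" for n
  have g0: "0 < grid n" for n using grid_ge_1[of n] by linarith
  have Wd: "\<forall>\<^sub>F n in sequentially. d \<le> W n"
    unfolding W_def by (rule eventually_compose_filterlim[OF d(2) filterlim_grid])
  define err where "err n = 2 * (exp (grid (Suc n) - grid n) * (W (Suc n) / W n) - 1) +
    (norm s * (1 / sqrt (grid n) - 1 / sqrt (grid (Suc n))) * (spread (grid n) \<omega> / W n) +
      \<bar>s \<bullet> m\<bar> * (sqrt (grid (Suc n)) - sqrt (grid n)))" for n
  have ratio: "(\<lambda>n. W (Suc n) / W n) \<longlonglongrightarrow> 1"
  proof (rule LIM_zero_cancel, rule Lim_null_comparison)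
    have "(\<lambda>n. \<bar>W (Suc n) - W n\<bar> / d) \<longlonglongrightarrow> \<bar>0\<bar> / d"
      using d(1) dW unfolding W_def by (intro tendsto_intros) auto
    then show "(\<lambda>n. \<bar>W (Suc n) - W n\<bar> / d) \<longlonglongrightarrow> 0" by simp
    show "\<forall>\<^sub>F n in sequentially. norm (W (Suc n) / W n - 1) \<le> \<bar>W (Suc n) - W n\<bar> / d"
      using Wd
    proof eventually_elim
      case (elim n)
      then have "0 < W n" using d(1) by linarith
      then have "norm (W (Suc n) / W n - 1) = \<bar>W (Suc n) - W n\<bar> / W n"
        by (simp add: diff_divide_distrib[symmetric] divide_diff_eq_iff)
      also have "\<dots> \<le> \<bar>W (Suc n) - W n\<bar> / d" using elim d(1) by (intro divide_left_mono) auto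
      finally show ?case .
    qed
  qed
  \<comment> \<open>The spread is controlled at integers only, so the grid time is rounded up. From
    \<open>j n + 1 \<le> grid n + 2\<close> comes the cube in
    \<open>inverse_sqrt_grid_increment\<close>.\<close>
  define j where "j n = nat \<lceil>grid n\<rceil>" for n
  have j: "grid n \<le> real (j n)" "real (j n) \<le> grid n + 1" for n
    using grid_ge_1[of n] unfolding j_def by linarith+
  have jlim: "filterlim j sequentially sequentially"
  proof -
    have "filterlim (\<lambda>n. real (j n)) at_top sequentially"
      by (rule filterlim_at_top_mono[OF filterlim_grid]) (simp add: j)
    then show ?thesis by (simp add: filterlim_sequentially_iff_filterlim_real)
  qed
  define u where "u n = 1 / sqrt (grid n) - 1 / sqrt (grid (Suc n))" for n
  have u0: "0 \<le> u n" for n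
    unfolding u_def using g0[of n] g0[of "Suc n"] grid_mono[of n "Suc n"] by (simp add: divide_left_mono frac_le)
  have spr: "(\<lambda>n. u n * (spread (grid n) \<omega> / W n)) \<longlonglongrightarrow> 0"
  proof (rule Lim_null_comparison)
    have "(\<lambda>n. ((grid n + 2) ^ 3 * u n) * (exp 1 * (spread (real (j n)) \<omega> / (real (j n) + 1) ^ 3)) / d) \<longlonglongrightarrow> 0 * (exp 1 * 0) / d"
      using d(1) inverse_sqrt_grid_increment unfolding u_def
      by (intro tendsto_intros filterlim_compose[OF sp jlim]) auto
    then show "(\<lambda>n. ((grid n + 2) ^ 3 * u n) * (exp 1 * (spread (real (j n)) \<omega> / (real (j n) + 1) ^ 3)) / d) \<longlonglongrightarrow> 0" by simp
    show "\<forall>\<^sub>F n in sequentially. norm (u n * (spread (grid n) \<omega> / W n)) \<le>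
        ((grid n + 2) ^ 3 * u n) * (exp 1 * (spread (real (j n)) \<omega> / (real (j n) + 1) ^ 3)) / d"
      using Wd
    proof eventually_elim
      case (elim n)
      let ?S = "spread (real (j n)) \<omega>"
      have jp: "0 < (real (j n) + 1) ^ 3" by (intro zero_less_power) linarith
      have "spread (grid n) \<omega> \<le> exp 1 * ?S" by (rule spread_le_Suc[OF fin j])
      also have "\<dots> = exp 1 * (?S / (real (j n) + 1) ^ 3) * (real (j n) + 1) ^ 3" using jp by simp
      also have "\<dots> \<le> exp 1 * (?S / (real (j n) + 1) ^ 3) * (grid n + 2) ^ 3"
      proof (intro mult_left_mono power_mono)
        show "real (j n) + 1 \<le> grid n + 2" using j(2)[of n] by linarith
        show "0 \<le> exp 1 * (?S / (real (j n) + 1) ^ 3)" using jp spread_nonneg by simp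
      qed simp
      finally have "spread (grid n) \<omega> \<le> exp 1 * (?S / (real (j n) + 1) ^ 3) * (grid n + 2) ^ 3" .
      moreover have "spread (grid n) \<omega> / W n \<le> spread (grid n) \<omega> / d"
        using elim d(1) spread_nonneg by (intro divide_left_mono) auto
      ultimately have "spread (grid n) \<omega> / W n \<le> exp 1 * (?S / (real (j n) + 1) ^ 3) * (grid n + 2) ^ 3 / d"
        using d(1) by (meson divide_right_mono less_imp_le order_trans)
      then have "u n * (spread (grid n) \<omega> / W n) \<le> u n * (exp 1 * (?S / (real (j n) + 1) ^ 3) * (grid n + 2) ^ 3 / d)"
        using u0 by (intro mult_left_mono)
      moreover have "0 \<le> u n * (spread (grid n) \<omega> / W n)"
        using u0[of n] spread_nonneg[of "grid n" \<omega>] elim d(1) by simp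
      ultimately show ?case by (simp add: mult_ac)
    qed
  qed
  have "(\<lambda>n. 2 * (exp (grid (Suc n) - grid n) * (W (Suc n) / W n) - 1) +
      (norm s * (u n * (spread (grid n) \<omega> / W n)) + \<bar>s \<bullet> m\<bar> * (sqrt (grid (Suc n)) - sqrt (grid n))))
      \<longlonglongrightarrow> 2 * (exp 0 * 1 - 1) + (norm s * 0 + \<bar>s \<bullet> m\<bar> * 0)"
    by (intro tendsto_intros grid_increment sqrt_grid_increment ratio spr)
  then have err: "err \<longlonglongrightarrow> 0"
    unfolding err_def[abs_def] u_def by (simp add: mult.assoc)
  have "((\<lambda>t. scaled_char m s t \<omega> - scaled_char m s (grid (grid_index t)) \<omega>) \<longlongrightarrow> 0) at_top"
  proof (rule Lim_null_comparison)
    show "((\<lambda>t. err (grid_index t)) \<longlongrightarrow> 0) at_top"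
      by (rule filterlim_compose[OF err filterlim_grid_index])
    show "\<forall>\<^sub>F t in at_top. norm (scaled_char m s t \<omega> - scaled_char m s (grid (grid_index t)) \<omega>) \<le> err (grid_index t)"
      using eventually_ge_at_top[of 1] eventually_compose_filterlim[OF Wd filterlim_grid_index]
    proof eventually_elim
      case (elim t)
      have "0 < W (grid_index t)" using elim d(1) by linarith
      then show ?case
        unfolding err_def W_def
        by (intro scaled_char_diff fin g0 grid_index_bounds elim)
    qed
  qed
  moreover have "((\<lambda>t. scaled_char m s (grid (grid_index t)) \<omega>) \<longlongrightarrow> l) at_top"
    by (rule filterlim_compose[OF lim filterlim_grid_index])
  ultimately have "((\<lambda>t. (scaled_char m s t \<omega> - scaled_char m s (grid (grid_index t)) \<omega>) +
      scaled_char m s (grid (grid_index t)) \<omega>) \<longlongrightarrow> 0 + l) at_top"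
    by (rule tendsto_add)
  then show ?thesis by simp
qed

section \<open>The normalized empirical distribution\<close>

lemma
  fixes f :: "'b \<Rightarrow> 'c :: {banach, second_countable_topology}" and m :: 'b
  assumes fin: "finite (random_tree age \<omega> t)" and t: "0 \<le> t"
  defines "\<mu> \<equiv> Theta (sqrt t) (t *\<^sub>R m) (empirical_distribution \<rho> (\<lambda>v. X v \<omega>) (random_tree age \<omega> t))"
  shows prob_algebra_empirical: "\<mu> \<in> space (prob_algebra borel)"
    and integral_empirical: "f \<in> borel_measurable borel \<Longrightarrow> (\<integral>x. f x \<partial>\<mu>) =
      (\<Sum>v\<in>random_tree age \<omega> t. (weight \<rho> v / total_weight \<rho> (random_tree age \<omega> t)) *\<^sub>R f ((pos v \<omega> - t *\<^sub>R m) /\<^sub>R sqrt t))"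
proof -
  let ?T = "random_tree age \<omega> t"
  let ?p = "point_measure ?T (\<lambda>v. ennreal (weight \<rho> v / total_weight \<rho> ?T))"
  \<comment> \<open>The root, born at time 0, keeps the total weight positive.\<close>
  have "[] \<in> ?T" using t by (simp add: mem_random_tree)
  then have tw: "0 < total_weight \<rho> ?T"
    unfolding total_weight_def using fin weight_pos' by (intro sum_pos) auto
  have m1: "position (\<lambda>v. X v \<omega>) \<in> ?p \<rightarrow>\<^sub>M borel"
    by (simp add: measurable_def sets_point_measure space_point_measure)
  have m2: "(\<lambda>x. (x - t *\<^sub>R m) /\<^sub>R sqrt t) \<in> borel_measurable borel" by measurable
  have eq: "\<mu> = distr ?p borel (\<lambda>v. (pos v \<omega> - t *\<^sub>R m) /\<^sub>R sqrt t)"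
    unfolding \<mu>_def Theta_def empirical_distribution_def
    by (subst distr_distr) (use m1 in \<open>auto simp: comp_def pos_def\<close>)
  have m3: "(\<lambda>v. (pos v \<omega> - t *\<^sub>R m) /\<^sub>R sqrt t) \<in> ?p \<rightarrow>\<^sub>M borel"
    by (simp add: measurable_def sets_point_measure space_point_measure)
  have "prob_space ?p"
  proof
    have "emeasure ?p (space ?p) = (\<Sum>v\<in>?T. ennreal (weight \<rho> v / total_weight \<rho> ?T))"
      using fin by (simp add: space_point_measure emeasure_point_measure_finite)
    also have "\<dots> = ennreal (\<Sum>v\<in>?T. weight \<rho> v / total_weight \<rho> ?T)"
      using weight_pos' tw by (intro sum_ennreal) (simp add: less_imp_le)
    also have "(\<Sum>v\<in>?T. weight \<rho> v / total_weight \<rho> ?T) = 1"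
      using tw by (simp add: sum_divide_distrib[symmetric] total_weight_def[symmetric])
    finally show "emeasure ?p (space ?p) = 1" by simp
  qed
  then show "\<mu> \<in> space (prob_algebra borel)"
    unfolding eq space_prob_algebra using prob_space.prob_space_distr[OF _ m3] by auto
  assume f: "f \<in> borel_measurable borel"
  show "(\<integral>x. f x \<partial>\<mu>) =
      (\<Sum>v\<in>?T. (weight \<rho> v / total_weight \<rho> ?T) *\<^sub>R f ((pos v \<omega> - t *\<^sub>R m) /\<^sub>R sqrt t))"
    unfolding eq using weight_pos' tw fin
    by (subst integral_distr[OF m3 f], subst lebesgue_integral_point_measure_finite) (auto simp: less_imp_le)
qed

lemma char_empirical:
  assumes fin: "finite (random_tree age \<omega> t)" and t: "0 < t"
  shows "(\<integral>x. iexp (s \<bullet> x) \<partial>Theta (sqrt t) (t *\<^sub>R m) (empirical_distribution \<rho> (\<lambda>v. X v \<omega>) (random_tree age \<omega> t))) =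
    scaled_char m s t \<omega>"
proof -
  have "s \<bullet> ((pos v \<omega> - t *\<^sub>R m) /\<^sub>R sqrt t) = (s \<bullet> pos v \<omega>) / sqrt t - sqrt t * (s \<bullet> m)" for v
  proof -
    have "s \<bullet> ((pos v \<omega> - t *\<^sub>R m) /\<^sub>R sqrt t) = (s \<bullet> pos v \<omega>) / sqrt t - (t / sqrt t) * (s \<bullet> m)"
      by (simp add: inner_diff_right divide_inverse algebra_simps)
    then show ?thesis using t by (simp add: real_div_sqrt)
  qed
  then show ?thesis
    using fin t
    by (subst integral_empirical)
      (simp_all add: scaled_char_eq total_weight_def scaleR_conv_of_real sum_divide_distrib)
qed

text \<open>Joint measurability in the sample point and the frequency, for the exchange of the two
  almost-everywhere quantifiers.\<close>

lemma scaled_char_measurable_pair: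
  assumes [measurable]: "g \<in> borel_measurable K"
  shows "(\<lambda>z. scaled_char m (g (snd z)) t (fst z)) \<in> borel_measurable (M \<Otimes>\<^sub>M K)"
proof -
  interpret C: sigma_finite_measure "count_space UNIV :: node measure"
    by (rule sigma_finite_measure_count_space)
  have "(\<lambda>y. of_real (weight \<rho> (snd y) * indicator {..t} (birth (snd y) (fst (fst y)))) *
      iexp (1 / sqrt t * (g (snd (fst y)) \<bullet> pos (snd y) (fst (fst y)))))
      \<in> borel_measurable ((M \<Otimes>\<^sub>M K) \<Otimes>\<^sub>M count_space UNIV)"
    by (rule measurable_compose_countable'[where I = UNIV and g = snd]) auto
  then have [measurable]: "(\<lambda>z. node_char (g (snd z)) (1 / sqrt t) t (fst z)) \<in> borel_measurable (M \<Otimes>\<^sub>M K)"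
    unfolding node_char_def by (intro C.borel_measurable_lebesgue_integral) (simp add: split_beta')
  have w: "total_weight \<rho> (random_tree age \<omega> t) = exp t * normalized_weight t \<omega>" for \<omega>
    by (simp add: normalized_weight_def exp_minus)
  show ?thesis unfolding scaled_char_def w by measurable
qed

text \<open>The exchange by Fubini needs a measurable set of good pairs. Convergence along the grid
  is a countable condition and provides it; this is why the exchange comes before the
  interpolation.\<close>

lemma AE_AE_scaled_char_grid:
  assumes D2: "integrable D (\<lambda>x. (norm x)\<^sup>2)" and K: "prob_space K" "sets K = sets borel"
  shows "AE \<omega> in M. \<forall>k :: nat. AE z in K. (\<lambda>n. scaled_char (\<integral>x. x \<partial>D) (real k *\<^sub>R z) (grid n) \<omega>)
    \<longlonglongrightarrow> of_real (exp (- (\<integral>x. ((real k *\<^sub>R z) \<bullet> x)\<^sup>2 \<partial>D) / 2))"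
proof -
  interpret D: prob_space D by (rule prob_space_offset_law)
  interpret K: prob_space K by fact
  interpret MK: pair_sigma_finite M K ..
  note [measurable_cong] = K(2) sets_offset_law
  let ?m = "\<integral>x. x \<partial>D" and ?l = "\<lambda>z. complex_of_real (exp (- (\<integral>x. (z \<bullet> x)\<^sup>2 \<partial>D) / 2))"
  have [measurable]: "(\<lambda>z. \<integral>x. ((real k *\<^sub>R snd z) \<bullet> x)\<^sup>2 \<partial>D) \<in> borel_measurable (M \<Otimes>\<^sub>M K)" for k
    by (rule D.borel_measurable_lebesgue_integral) (simp add: split_beta')
  have "(AE \<omega> in M. AE z in K. (\<lambda>n. scaled_char ?m (real k *\<^sub>R z) (grid n) \<omega>) \<longlonglongrightarrow> ?l (real k *\<^sub>R z)) \<longleftrightarrow>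
      (AE z in K. AE \<omega> in M. (\<lambda>n. scaled_char ?m (real k *\<^sub>R z) (grid n) \<omega>) \<longlonglongrightarrow> ?l (real k *\<^sub>R z))" for k :: nat
  proof (rule MK.AE_commute)
    have [measurable]: "(\<lambda>z. scaled_char ?m (real k *\<^sub>R snd z) (grid n) (fst z)) \<in> borel_measurable (M \<Otimes>\<^sub>M K)" for n
      by (rule scaled_char_measurable_pair) measurable
    show "{x \<in> space (M \<Otimes>\<^sub>M K). (\<lambda>n. scaled_char ?m (real k *\<^sub>R snd x) (grid n) (fst x)) \<longlonglongrightarrow> ?l (real k *\<^sub>R snd x)}
        \<in> sets (M \<Otimes>\<^sub>M K)"
      unfolding LIM_zero_iff[symmetric, where l = "?l _"] tendsto_zero_iff_nat by measurable
  qed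
  then show ?thesis
    unfolding AE_all_countable using AE_scaled_char_grid[OF D2] by (simp only: AE_I2 simp_thms)
qed

lemma AE_AE_scaled_char:
  assumes D2: "integrable D (\<lambda>x. (norm x)\<^sup>2)" and K: "prob_space K" "sets K = sets borel"
  shows "AE \<omega> in M. \<forall>k :: nat. AE z in K. ((\<lambda>t. scaled_char (\<integral>x. x \<partial>D) (real k *\<^sub>R z) t \<omega>)
    \<longlongrightarrow> of_real (exp (- (\<integral>x. ((real k *\<^sub>R z) \<bullet> x)\<^sup>2 \<partial>D) / 2))) at_top"
  using AE_AE_scaled_char_grid[OF assms] AE_finite_random_tree AE_normalized_weight_lower_bound
    AE_normalized_weight_grid(2) AE_spread[OF integrable_norm_offset(1)[OF D2]]
proof eventually_elim
  case (elim \<omega>)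
  then obtain d where d: "0 < d" "\<forall>\<^sub>F t in at_top. d \<le> normalized_weight t \<omega>" by blast
  show ?case
  proof
    fix k :: nat
    from elim(1) have "AE z in K. (\<lambda>n. scaled_char (\<integral>x. x \<partial>D) (real k *\<^sub>R z) (grid n) \<omega>)
      \<longlonglongrightarrow> of_real (exp (- (\<integral>x. ((real k *\<^sub>R z) \<bullet> x)\<^sup>2 \<partial>D) / 2))" by blast
    then show "AE z in K. ((\<lambda>t. scaled_char (\<integral>x. x \<partial>D) (real k *\<^sub>R z) t \<omega>)
        \<longlongrightarrow> of_real (exp (- (\<integral>x. ((real k *\<^sub>R z) \<bullet> x)\<^sup>2 \<partial>D) / 2))) at_top"
    proof (rule AE_mp, intro AE_I2 impI)
      fix z assume "(\<lambda>n. scaled_char (\<integral>x. x \<partial>D) (real k *\<^sub>R z) (grid n) \<omega>)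
        \<longlonglongrightarrow> of_real (exp (- (\<integral>x. ((real k *\<^sub>R z) \<bullet> x)\<^sup>2 \<partial>D) / 2))"
      then show "((\<lambda>t. scaled_char (\<integral>x. x \<partial>D) (real k *\<^sub>R z) t \<omega>)
        \<longlongrightarrow> of_real (exp (- (\<integral>x. ((real k *\<^sub>R z) \<bullet> x)\<^sup>2 \<partial>D) / 2))) at_top"
        using elim(2) by (intro scaled_char_at_top[OF _ d elim(4,5)]) blast
    qed
  qed
qed

end

section \<open>The limiting covariance and the conclusion\<close>

lemma
  fixes \<eta> :: "'b \<Rightarrow> real ^ 'd"
  assumes [measurable]: "\<eta> \<in> borel_measurable N" and i2: "integrable N (\<lambda>y. (norm (\<eta> y))\<^sup>2)"
  defines "S \<equiv> (\<integral>y. (\<chi> i j. \<eta> y $ i * \<eta> y $ j) \<partial>N)"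
  shows second_moment_matrix_sym: "S $ i $ j = S $ j $ i"
    and second_moment_matrix_form: "s \<bullet> (S *v s) = (\<integral>y. (s \<bullet> \<eta> y)\<^sup>2 \<partial>N)"
proof -
  have [measurable]: "(\<lambda>y. \<eta> y $ i) \<in> borel_measurable N" for i
    unfolding cart_eq_inner_axis by measurable
  have c: "\<bar>\<eta> y $ i * \<eta> y $ j\<bar> \<le> (norm (\<eta> y))\<^sup>2" for y i j
    unfolding abs_mult power2_eq_square by (intro mult_mono component_le_norm_cart) auto
  have ic: "integrable N (\<lambda>y. \<eta> y $ i * \<eta> y $ j)" for i j
    by (rule Bochner_Integration.integrable_bound[OF i2]) (use c in \<open>auto intro!: AE_I2\<close>)
  have "continuous_on UNIV (\<lambda>x :: real ^ 'd. \<chi> i j. x $ i * x $ j)"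
    by (intro continuous_on_vec_lambda continuous_intros)
  then have [measurable]: "(\<lambda>y. \<chi> i j. \<eta> y $ i * \<eta> y $ j) \<in> borel_measurable N"
    using measurable_compose[OF assms(1) borel_measurable_continuous_onI] by blast
  have int: "integrable N (\<lambda>y. \<chi> i j. \<eta> y $ i * \<eta> y $ j)"
  proof (rule Bochner_Integration.integrable_bound)
    show "integrable N (\<lambda>y. real CARD('d) * (real CARD('d) * (norm (\<eta> y))\<^sup>2))" using i2 by simp
    show "AE y in N. norm (\<chi> i j. \<eta> y $ i * \<eta> y $ j) \<le> norm (real CARD('d) * (real CARD('d) * (norm (\<eta> y))\<^sup>2))"
    proof (rule AE_I2)
      fix y
      \<comment> \<open>The norm of a matrix is bounded by the sum of the absolute values of its
        entries. Any integrable bound would do; it allows the integral to be taken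
        entrywise.\<close>
      have "norm (\<chi> i j. \<eta> y $ i * \<eta> y $ j) \<le> (\<Sum>i\<in>UNIV. norm (\<chi> j. \<eta> y $ i * \<eta> y $ j))"
        unfolding norm_vec_def[of "\<chi> i j. \<eta> y $ i * \<eta> y $ j"] by (rule order_trans[OF L2_set_le_sum]) auto
      also have "\<dots> \<le> (\<Sum>i\<in>UNIV. \<Sum>j\<in>UNIV. \<bar>\<eta> y $ i * \<eta> y $ j\<bar>)"
        by (intro sum_mono order_trans[OF norm_le_l1_cart]) simp
      also have "\<dots> \<le> (\<Sum>(i :: 'd)\<in>UNIV. \<Sum>(j :: 'd)\<in>UNIV. (norm (\<eta> y))\<^sup>2)"
        by (intro sum_mono c)
      finally show "norm (\<chi> i j. \<eta> y $ i * \<eta> y $ j) \<le> norm (real CARD('d) * (real CARD('d) * (norm (\<eta> y))\<^sup>2))"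
        by simp
    qed
  qed measurable
  have S: "S $ i $ j = (\<integral>y. \<eta> y $ i * \<eta> y $ j \<partial>N)" for i j
  proof -
    have "bounded_linear (\<lambda>A :: real ^ 'd ^ 'd. A $ i $ j)"
      by (rule bounded_linear_compose[OF bounded_linear_vec_nth bounded_linear_vec_nth])
    from integral_bounded_linear[OF this int] show ?thesis by (simp add: S_def)
  qed
  show "S $ i $ j = S $ j $ i" unfolding S by (simp only: mult.commute)
  have "s \<bullet> (S *v s) = (\<Sum>i\<in>UNIV. \<Sum>j\<in>UNIV. s $ i * (S $ i $ j * s $ j))"
    by (simp add: inner_vec_def matrix_vector_mult_def sum_distrib_left)
  also have "\<dots> = (\<integral>y. (\<Sum>i\<in>UNIV. \<Sum>j\<in>UNIV. s $ i * (\<eta> y $ i * \<eta> y $ j * s $ j)) \<partial>N)"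
    unfolding S using ic by simp
  also have "(\<lambda>y. \<Sum>i\<in>UNIV. \<Sum>j\<in>UNIV. s $ i * (\<eta> y $ i * \<eta> y $ j * s $ j)) = (\<lambda>y. (s \<bullet> \<eta> y)\<^sup>2)"
    by (simp add: inner_vec_def power2_eq_square sum_product mult_ac)
  finally show "s \<bullet> (S *v s) = (\<integral>y. (s \<bullet> \<eta> y)\<^sup>2 \<partial>N)" .
qed

theorem theorem6p2:
  fixes N :: "'b measure" and \<eta> :: "'b \<Rightarrow> real ^ 'd"
    and M :: "'a measure" and \<rho> :: real
    and age :: "node \<Rightarrow> nat \<Rightarrow> 'a \<Rightarrow> real" and X :: "node \<Rightarrow> 'a \<Rightarrow> real ^ 'd"
    and m :: "real ^ 'd"
  assumes "prob_space N"
    and "\<eta> \<in> borel_measurable N"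
    and "integrable N (\<lambda>y. (norm (\<eta> y))\<^sup>2)"
    and "m = (\<integral>y. \<eta> y \<partial>N)"
    and "yule_branching_random_walk M \<rho> age X (distr N borel \<eta>)"
  shows "AE \<omega> in M.
    weakly_converges
      (\<lambda>t. Theta (sqrt t) (t *\<^sub>R m)
             (empirical_distribution \<rho> (\<lambda>v. X v \<omega>) (random_tree age \<omega> t)))
      (centered_normal (\<integral>y. (\<chi> i j. \<eta> y $ i * \<eta> y $ j) \<partial>N))
      at_top"
proof -
  note \<eta> [measurable] = assms(2)
  let ?D = "distr N borel \<eta>"
  interpret yule_branching_random_walk M \<rho> age X ?D by fact
  define S where "S = (\<integral>y. (\<chi> i j. \<eta> y $ i * \<eta> y $ j) \<partial>N)"
  note sym = second_moment_matrix_sym[OF \<eta> assms(3), folded S_def]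
  note form = second_moment_matrix_form[OF \<eta> assms(3), folded S_def]
  have nonneg: "0 \<le> v \<bullet> (S *v v)" for v unfolding form by simp
  have D2: "integrable ?D (\<lambda>x. (norm x)\<^sup>2)" using assms(3) by (simp add: integrable_distr_eq)
  have Dm: "(\<integral>x. x \<partial>?D) = m" by (simp add: integral_distr assms(4))
  have DS: "(\<integral>x. (s \<bullet> x)\<^sup>2 \<partial>?D) = s \<bullet> (S *v s)" for s by (simp add: integral_distr form)
  have \<nu>: "centered_normal S \<in> space (prob_algebra borel)"
    by (rule prob_algebra_centered_normal[OF sym nonneg])
  have "AE \<omega> in M. \<forall>k :: nat. AE z in std_normal_vector. ((\<lambda>t. scaled_char m (real k *\<^sub>R z) t \<omega>)
      \<longlongrightarrow> (\<integral>x. iexp ((real k *\<^sub>R z) \<bullet> x) \<partial>centered_normal S)) at_top"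
    using AE_AE_scaled_char[OF D2 prob_space_std_normal_vector sets_std_normal_vector]
    unfolding Dm DS char_centered_normal[OF sym nonneg] by simp
  then show ?thesis
    unfolding S_def[symmetric] using AE_finite_random_tree
  proof eventually_elim
    case (elim \<omega>)
    have fin: "finite (random_tree age \<omega> t)" for t using elim(2) by blast
    let ?\<mu> = "\<lambda>t. Theta (sqrt t) (t *\<^sub>R m) (empirical_distribution \<rho> (\<lambda>v. X v \<omega>) (random_tree age \<omega> t))"
    show ?case
      unfolding weakly_converges_def
    proof (intro conjI allI impI)
      show "\<forall>\<^sub>F t in at_top. ?\<mu> t \<in> space (prob_algebra borel)"
        using eventually_ge_at_top[of 0] by eventually_elim (rule prob_algebra_empirical[OF fin])
      show "centered_normal S \<in> space (prob_algebra borel)" by fact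
      fix f :: "real ^ 'd \<Rightarrow> real" assume f: "continuous_on UNIV f \<and> bounded (range f)"
      show "((\<lambda>t. \<integral>x. f x \<partial>?\<mu> t) \<longlongrightarrow> (\<integral>x. f x \<partial>centered_normal S)) at_top"
      \<comment> \<open>The sample point is fixed already, so passing to arbitrary sequences of
        times costs no further null set.\<close>
      proof (rule tendsto_at_topI_sequentially)
        fix T :: "nat \<Rightarrow> real" assume T: "filterlim T at_top sequentially"
        then have ev: "\<forall>\<^sub>F n in sequentially. 1 \<le> T n" by (simp add: filterlim_at_top)
        \<comment> \<open>At times below 1, which occur for finitely many \<open>n\<close> only, the
          limit law is inserted: the criterion asks for a probability law at every index, and the
          empirical one need not be one at negative times.\<close>
        define \<mu>' where "\<mu>' n = (if 1 \<le> T n then ?\<mu> (T n) else centered_normal S)" for n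
        have \<mu>': "\<mu>' n \<in> space (prob_algebra borel)" for n
          using prob_algebra_empirical[OF fin] \<nu> by (simp add: \<mu>'_def)
        have "(\<lambda>n. \<integral>x. f x \<partial>\<mu>' n) \<longlonglongrightarrow> (\<integral>x. f x \<partial>centered_normal S)"
        proof (rule tendsto_integral_if_char)
          fix k :: nat
          have "AE z in std_normal_vector. ((\<lambda>t. scaled_char m (real k *\<^sub>R z) t \<omega>)
              \<longlongrightarrow> (\<integral>x. iexp ((real k *\<^sub>R z) \<bullet> x) \<partial>centered_normal S)) at_top"
            using elim(1) by blast
          then show "AE z in std_normal_vector. (\<lambda>n. \<integral>x. iexp ((real k *\<^sub>R z) \<bullet> x) \<partial>\<mu>' n)
              \<longlonglongrightarrow> (\<integral>x. iexp ((real k *\<^sub>R z) \<bullet> x) \<partial>centered_normal S)"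
          proof (rule AE_mp, intro AE_I2 impI)
            fix z :: "real ^ 'd"
            let ?s = "real k *\<^sub>R z"
            assume "((\<lambda>t. scaled_char m ?s t \<omega>) \<longlongrightarrow> (\<integral>x. iexp (?s \<bullet> x) \<partial>centered_normal S)) at_top"
            from filterlim_compose[OF this T]
            show "(\<lambda>n. \<integral>x. iexp (?s \<bullet> x) \<partial>\<mu>' n) \<longlonglongrightarrow> (\<integral>x. iexp (?s \<bullet> x) \<partial>centered_normal S)"
            proof (rule Lim_transform_eventually)
              show "\<forall>\<^sub>F n in sequentially. scaled_char m ?s (T n) \<omega> = (\<integral>x. iexp (?s \<bullet> x) \<partial>\<mu>' n)"
                using ev
              proof eventually_elim
                case (elim n)
                then show ?case unfolding \<mu>'_def by (simp only: if_True char_empirical[OF fin])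
              qed
            qed
          qed
        qed (use \<mu>' \<nu> f in \<open>auto simp: space_prob_algebra\<close>)
        then show "(\<lambda>n. \<integral>x. f x \<partial>?\<mu> (T n)) \<longlonglongrightarrow> (\<integral>x. f x \<partial>centered_normal S)"
        proof (rule Lim_transform_eventually)
          show "\<forall>\<^sub>F n in sequentially. (\<integral>x. f x \<partial>\<mu>' n) = (\<integral>x. f x \<partial>?\<mu> (T n))"
            using ev by eventually_elim (simp add: \<mu>'_def)
        qed
      qed
    qed
  qed
qed

end
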